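(* Let $\theta\ge0$ and let $\boldsymbol\alpha\in\mathbb{G}_m^3$ be such that $h^*(\boldsymbol\alpha)>0$. Then, given any collection of pairwise inequivalent functions $f_1,\dots,f_N\in\mathcal{L}_3(\boldsymbol\alpha,\theta)$, one has $$\sum_{j=1}^N\operatorname{mult}_{\ge\nu_1}(f_j)\le24\quad\text{for}\quad\nu_1=\frac{2.8+6\theta}{h^*(\boldsymbol\alpha)},$$ and $$\sum_{j=1}^N\operatorname{mult}_{\ge\nu_2}(f_j)\le5\quad\text{for}\quad\nu_2=\frac{33.1+73.1\,\theta}{h^*(\boldsymbol\alpha)}.$$
   Context: $\mathbb{G}_m^3$ denotes the group $(\overline{\mathbb{Q}}^* )^3$ with coordinatewise multiplication, $h:\overline{\mathbb{Q}}^*\to\mathbb{R}_{\ge0}$ is the absolute logarithmic Weil height, and for $\boldsymbol x\in\mathbb{G}_m^3$, $h^*(\boldsymbol x):=\max_{1\le i<j\le3}h(x_i/x_j)$. For $\boldsymbol\alpha\in\mathbb{G}_m^3$ and $\theta\ge0$, $\mathcal{L}_3(\boldsymbol\alpha,\theta)$ is the set of functions $f:\mathbb{N}_0\to\overline{\mathbb{Q}}$ of the form $f(n)=c_1\alpha_1^n+c_2\alpha_2^n+c_3\alpha_3^n$, each given together with its coefficient vector $\operatorname{coeff}_{\boldsymbol\alpha}(f):=(c_1,c_2,c_3)$, which is required to lie in $\mathbb{G}_m^3$ and to satisfy $h^*(\operatorname{coeff}_{\boldsymbol\alpha}(f))\le\theta$. Two functions $f,g\in\mathcal{L}_3(\boldsymbol\alpha,\theta)$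 are equivalent if there exists $n\in\mathbb{Z}$ such that $[\operatorname{coeff}_{\boldsymbol\alpha}(f)]=[\boldsymbol\alpha^n\operatorname{coeff}_{\boldsymbol\alpha}(g)]$, where $[\boldsymbol x]$ denotes the point of the projective space $\mathbb{P}(\overline{\mathbb{Q}}^3)$ determined by $\boldsymbol x$. For $f:\mathbb{N}_0\to\overline{\mathbb{Q}}$ and a real number $\nu\ge0$, $\operatorname{mult}_{\ge\nu}(f):=\#\{n\in\mathbb{N}_0:n\ge\nu,\ f(n)=0\}\in\mathbb{N}_0\cup\{\infty\}$. *)

theory Defs
  imports
    "HOL-Analysis.Analysis"
    "HOL-Computational_Algebra.Computational_Algebra"
    "HOL-Library.Extended_Nat"
begin

text \<open>
  The field of algebraic numbers is realised as the subfield of those complex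
  numbers that satisfy the predicate \<^const>\<open>algebraic\<close>.
\<close>

text \<open>
  Irreducibility is meant in the ring of integer polynomials, so it includes
  primitivity; together with the positive leading coefficient this makes the
  polynomial unique.
\<close>
definition min_int_poly :: "complex \<Rightarrow> int poly" where
  "min_int_poly x =
     (THE p. irreducible p \<and> lead_coeff p > 0 \<and> poly (map_poly of_int p) x = 0)"

text \<open>
  The absolute logarithmic Weil height of an algebraic number \<open>x\<close> of degree \<open>d\<close>:
  \<open>(log a + \<Sum> log max(1, |z|)) / d\<close>, where \<open>a\<close> is the leading coefficient of
  the minimal polynomial of \<open>x\<close> over the integers and \<open>z\<close> runs over the \<open>d\<close>
  conjugates of \<open>x\<close>. The conjugates are pairwise distinct, hence the sum over
  the set of roots. The value is meaningful only for algebraic \<open>x\<close>.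
\<close>
definition weil_height :: "complex \<Rightarrow> real" where
  "weil_height x =
     (let p = min_int_poly x in
       (ln (of_int (lead_coeff p))
         + (\<Sum>z\<in>{z::complex. poly (map_poly of_int p) z = 0}. ln (max 1 (cmod z))))
       / real (degree p))"

definition Gm3 :: "(complex ^ 3) set" where
  "Gm3 = {x. \<forall>i. algebraic (x $ i) \<and> x $ i \<noteq> 0}"

definition hstar :: "complex ^ 3 \<Rightarrow> real" where
  "hstar x = Max {weil_height (x $ 1 / x $ 2), weil_height (x $ 1 / x $ 3),
                  weil_height (x $ 2 / x $ 3)}"

text \<open>
  A function is carried together with its coefficient vector, because the
  function alone need not determine the vector (the entries of \<open>\<alpha>\<close> may coincide).
\<close>
type_synonym lin_rec3 = "(nat \<Rightarrow> complex) \<times> (complex ^ 3)"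

abbreviation fun_of :: "lin_rec3 \<Rightarrow> nat \<Rightarrow> complex" where
  "fun_of \<equiv> fst"

abbreviation coeff_of :: "lin_rec3 \<Rightarrow> complex ^ 3" where
  "coeff_of \<equiv> snd"

definition L3 :: "complex ^ 3 \<Rightarrow> real \<Rightarrow> lin_rec3 set" where
  "L3 \<alpha> \<theta> = {(f, c). f = (\<lambda>n. c $ 1 * \<alpha> $ 1 ^ n + c $ 2 * \<alpha> $ 2 ^ n + c $ 3 * \<alpha> $ 3 ^ n)
                     \<and> c \<in> Gm3 \<and> hstar c \<le> \<theta>}"

text \<open>
  A point of the projective plane over the algebraic numbers is represented by
  its set of homogeneous coordinate vectors.
\<close>
definition proj_point :: "complex ^ 3 \<Rightarrow> (complex ^ 3) set" where
  "proj_point x = {t *s x | t. algebraic t \<and> t \<noteq> 0}"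

definition equivalent :: "complex ^ 3 \<Rightarrow> lin_rec3 \<Rightarrow> lin_rec3 \<Rightarrow> bool" where
  "equivalent \<alpha> f g \<longleftrightarrow>
     (\<exists>n::int. proj_point (coeff_of f) = proj_point (\<chi> i. (\<alpha> $ i) powi n * coeff_of g $ i))"

definition mult_ge :: "real \<Rightarrow> (nat \<Rightarrow> complex) \<Rightarrow> enat" where
  "mult_ge \<nu> f =
     (let Z = {n. real n \<ge> \<nu> \<and> f n = 0} in if finite Z then enat (card Z) else \<infinity>)"

end

theory Submission
  imports Defs "Jordan_Normal_Form.Char_Poly"
begin

text \<open>
  A zero \<open>n\<close> of \<open>c\<^sub>1 \<alpha>\<^sub>1\<^sup>n + c\<^sub>2 \<alpha>\<^sub>2\<^sup>n + c\<^sub>3 \<alpha>\<^sub>3\<^sup>n\<close> is a point \<open>u\<close> of the line \<open>u\<^sub>1 + u\<^sub>2 + u\<^sub>3 = 0\<close>, and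
  inequivalence makes the points of all zeros distinct. If \<open>u\<close> and \<open>v\<close> are two of them, the points
  \<open>(1 : 1 : 1)\<close> and \<open>v / u\<close> lie on the line with coefficients \<open>u\<close>, so \<open>u\<close> is their cross product and
  \<open>h*(u)\<close> is at most \<open>2 h*(v / u) + log 2\<close>.
  Hence \<open>T = n h*(\<alpha>) - 5\<theta> - 1\<close> grows by a factor \<open>3/2\<close> from one zero to the next.
  Conversely, if \<open>m \<ge> 7n\<close> then \<open>v\<close> is close to \<open>u\<^bsup>2N\<^esup>\<close> for a suitable \<open>N\<close>, and Pade approximation to
  \<open>(1 - x)\<^bsup>2N\<^esup>\<close> bounds \<open>h*(u)\<close>, which is impossible for \<open>n\<close> beyond the second threshold. As
  \<open>(3/2)\<^sup>5 > 7\<close>, at most 5 zeros lie beyond it, and at most 11 lie between the two thresholds.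

  All height estimates follow from one inequality for quotients of integer polynomials in several
  algebraic numbers. It is proved with the embeddings of a number field; the finite places are
  replaced by the integrality of \<open>a\<close> times any product of distinct conjugates of \<open>x\<close>, where \<open>a\<close> is the
  leading coefficient of the integer minimal polynomial of \<open>x\<close>.
\<close>

text \<open>The offset in \<open>T\<close> comes from the gap estimate. With x = n h and y = m h,
  where h = \<open>hstar \<alpha>\<close>, it reads x - \<theta> \<le> 4\<theta> + 2 (y - x) + 1,
  that is 3 x \<le> 2 y + s with s = 5\<theta> + 1, and this is the same as 3 (x - s) \<le> 2 (y -
  s). The Pade step gains through its degrees. Scale the line to x + (1 - x) = 1. Closeness of v to
  u^(2N) then gives a x^(2N) + b (1 - x)^(2N) = 1 with a and b of height at most (2N + 1)\<theta> +
  n h, and polynomials of degree N, half the exponent, turn this into 2N h(x) \<le> N h(x) + h(a) +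
  h(b) + (5N + 1) log 2. As h(x) is at least n h - \<theta> for a suitable choice of coordinates, a
  and b use up only two of the N copies of n h. What remains, (N - 2) n h \<le> (5N + 2)\<theta> +
  5N + 1, bounds n h independently of m once N \<ge> 4. Arithmetic enters the lower bounds only
  through the fact that a nonzero rational algebraic integer has modulus at least 1; integrality is
  always shown with finitely generated modules inside the complex numbers, without ideals or
  valuations.\<close>

hide_const (open) Module.smult

section \<open>Algebraic integers\<close>

interpretation int_module: Modules.module "\<lambda>(n::int) (x::complex). of_int n * x"
  by unfold_locales (auto simp: algebra_simps)

lemma int_span_mult:
  assumes AB: "\<And>a b. a \<in> A \<Longrightarrow> b \<in> B \<Longrightarrow> a * b \<in> int_module.span C"
    and u: "u \<in> int_module.span A" and w: "w \<in> int_module.span B"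
  shows "u * w \<in> int_module.span C"
proof -
  have 1: "a * w \<in> int_module.span C" if a: "a \<in> A" for a
    using w
  proof (induction rule: int_module.span_induct_alt)
    case base then show ?case by (simp add: int_module.span_zero)
  next
    case (step c x y)
    have "a * (of_int c * x + y) = of_int c * (a * x) + a * y" by (simp add: algebra_simps)
    then show ?case using step AB[OF a] by (auto intro: int_module.span_add int_module.span_scale)
  qed
  show ?thesis using u
  proof (induction rule: int_module.span_induct_alt)
    case base then show ?case by (simp add: int_module.span_zero)
  next
    case (step c x y)
    have "(of_int c * x + y) * w = of_int c * (x * w) + y * w" by (simp add: algebra_simps)
    then show ?case using step 1 by (auto intro: int_module.span_add int_module.span_scale)
  qed
qed

text \<open>The determinant trick: multiplication by \<open>z\<close> acts on \<open>S\<close>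
  through an integer matrix, and the elements of \<open>S\<close> form an eigenvector for
  \<open>z\<close>, nonzero because of \<open>s0\<close>. So \<open>z\<close> is a root of a monic
  integer characteristic polynomial.\<close>

lemma algebraic_int_if_stable:
  fixes z :: complex
  assumes fin: "finite S" and s0: "s0 \<in> S" "s0 \<noteq> 0"
    and stab: "\<And>s. s \<in> S \<Longrightarrow> z * s \<in> int_module.span S"
  shows "algebraic_int z"
proof -
  define n where "n = card S"
  obtain e where e: "bij_betw e {0..<n} S"
    using ex_bij_betw_nat_finite[OF fin] unfolding n_def by blast
  have "\<forall>s\<in>S. \<exists>c. z * s = (\<Sum>v\<in>S. of_int (c v) * v)"
    using stab unfolding int_module.span_finite[OF fin] by auto
  then obtain C where C: "\<And>s. s \<in> S \<Longrightarrow> z * s = (\<Sum>v\<in>S. of_int (C s v) * v)" by metis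
  define A where "A = mat n n (\<lambda>(i,j). C (e i) (e j))"
  define B where "B = map_mat (of_int :: int \<Rightarrow> complex) A"
  define v where "v = vec n e"
  have A: "A \<in> carrier_mat n n" and B: "B \<in> carrier_mat n n"
    by (auto simp: A_def B_def)
  have eS: "e i \<in> S" if "i < n" for i using e that by (auto simp: bij_betw_def)
  have "B *\<^sub>v v = z \<cdot>\<^sub>v v"
  proof (rule eq_vecI)
    fix i assume "i < dim_vec (z \<cdot>\<^sub>v v)"
    then have i: "i < n" by (simp add: v_def)
    have "vec_index (B *\<^sub>v v) i = (\<Sum>j\<in>{0..<n}. of_int (C (e i) (e j)) * e j)"
      using i by (simp add: B_def A_def v_def scalar_prod_def)
    also have "\<dots> = (\<Sum>w\<in>S. of_int (C (e i) w) * w)"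
      by (rule sum.reindex_bij_betw[OF e])
    also have "\<dots> = z * e i" using C[OF eS[OF i]] by simp
    finally show "vec_index (B *\<^sub>v v) i = vec_index (z \<cdot>\<^sub>v v) i" using i by (simp add: v_def)
  qed (simp add: B_def A_def v_def)
  moreover obtain i0 where i0: "i0 < n" "e i0 = s0"
    using e s0 by (auto simp: bij_betw_def)
  have "v \<noteq> 0\<^sub>v n"
  proof
    assume "v = 0\<^sub>v n"
    then have "vec_index v i0 = 0" using i0 by simp
    then show False using i0 s0 by (simp add: v_def)
  qed
  moreover have "v \<in> carrier_vec n" by (simp add: v_def)
  ultimately have "eigenvalue B z"
    using B unfolding eigenvalue_def eigenvector_def by auto
  then have "poly (char_poly B) z = 0" using eigenvalue_root_char_poly[OF B] by simp
  moreover have "char_poly B = map_poly of_int (char_poly A)"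
    unfolding B_def by (rule of_int_hom.char_poly_hom[OF A])
  ultimately have "poly (map_poly of_int (char_poly A)) z = 0" by simp
  moreover have "lead_coeff (char_poly A) = 1" using degree_monic_char_poly[OF A] by simp
  ultimately show ?thesis unfolding algebraic_int_altdef_ipoly by blast
qed

text \<open>A ring that is finitely generated as a module over the integers, recorded with its
  generators: each of its elements multiplies \<open>S\<close> into the span of \<open>S\<close>, so
  all of them are integral at once.\<close>

definition fg_ring :: "complex set \<Rightarrow> complex set \<Rightarrow> bool" where
  "fg_ring S R \<longleftrightarrow> finite S \<and> 1 \<in> S \<and> R = int_module.span S \<and> (\<forall>x\<in>R. \<forall>y\<in>R. x * y \<in> R)"

lemma fg_ring_mult: "fg_ring S R \<Longrightarrow> x \<in> R \<Longrightarrow> y \<in> R \<Longrightarrow> x * y \<in> R"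
  and fg_ring_add: "fg_ring S R \<Longrightarrow> x \<in> R \<Longrightarrow> y \<in> R \<Longrightarrow> x + y \<in> R"
  by (auto simp: fg_ring_def intro: int_module.span_add)

lemma fg_ring_imp_algebraic_int:
  assumes "fg_ring S R" "z \<in> R" shows "algebraic_int z"
proof (rule algebraic_int_if_stable[of S 1])
  show "z * s \<in> int_module.span S" if "s \<in> S" for s
    using assms that by (auto simp: fg_ring_def int_module.span_base)
qed (use assms in \<open>auto simp: fg_ring_def\<close>)

lemma fg_ring_Ints: "fg_ring {1} (int_module.span {1})"
  unfolding fg_ring_def using int_span_mult[of "{1}" "{1}" "{1}"] by (auto simp: int_module.span_base)

text \<open>The products s x^j with j below the degree of a monic equation of \<open>x\<close>
  generate the ring obtained by adjoining \<open>x\<close>, since that equation lowers every higher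
  power.\<close>

lemma fg_ring_extend:
  assumes R: "fg_ring S R" and x: "algebraic_int x"
  shows "\<exists>S' R'. fg_ring S' R' \<and> R \<subseteq> R' \<and> x \<in> R'"
proof -
  from x obtain p where p: "lead_coeff p = 1" "\<forall>i. coeff p i \<in> \<int>" "poly p x = 0"
    by (auto simp: algebraic_int.simps)
  define n where "n = degree p"
  have n: "n > 0"
  proof (rule ccontr)
    assume "\<not> n > 0"
    then obtain a where "p = [:a:]" unfolding n_def by (metis degree_eq_zeroE gr0I)
    then show False using p by auto
  qed
  define S' where "S' = (\<lambda>(s,j). s * x ^ j) ` (S \<times> {..<n})"
  have fS: "finite S" and S1: "1 \<in> S" and RS: "R = int_module.span S" using R by (auto simp: fg_ring_def)
  have xn: "x ^ n = - (\<Sum>i<n. coeff p i * x ^ i)"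
  proof -
    have "0 = (\<Sum>i\<le>n. coeff p i * x ^ i)" using p(3) by (simp add: poly_altdef n_def)
    also have "\<dots> = (\<Sum>i<n. coeff p i * x ^ i) + x ^ n"
      using p(1) by (simp add: lessThan_Suc_atMost[symmetric] n_def)
    finally show ?thesis by (simp add: add_eq_0_iff)
  qed
  have pw: "r * x ^ k \<in> int_module.span S'" if r: "r \<in> int_module.span S" for r k
  proof (induction k rule: less_induct)
    case (less k)
    show ?case
    proof (cases "k < n")
      case True
      show ?thesis
      proof (rule int_span_mult[of S "{x ^ k}"])
        show "a * b \<in> int_module.span S'" if "a \<in> S" "b \<in> {x ^ k}" for a b
          using that True by (intro int_module.span_base) (auto simp: S'_def)
      qed (use r in \<open>auto simp: int_module.span_base\<close>)
    next
      case False
      have "x ^ k = x ^ n * x ^ (k - n)" using False by (simp add: power_add[symmetric])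
      then have "r * x ^ k = (\<Sum>i<n. - coeff p i * (r * x ^ (k - n + i)))"
        unfolding xn by (simp add: sum_distrib_left sum_distrib_right power_add sum_negf algebra_simps)
      moreover have "- coeff p i * (r * x ^ (k - n + i)) \<in> int_module.span S'" if "i < n" for i
      proof -
        obtain c where "coeff p i = of_int c" using p(2) by (auto elim: Ints_cases)
        then show ?thesis
          using int_module.span_scale[OF less.IH[of "k - n + i"], of "-c"] that False by simp
      qed
      ultimately show ?thesis by (auto intro: int_module.span_sum)
    qed
  qed
  have "fg_ring S' (int_module.span S')"
    unfolding fg_ring_def
  proof (intro conjI ballI)
    show "finite S'" using fS by (simp add: S'_def)
    show "1 \<in> S'" unfolding S'_def using S1 n by (auto intro!: image_eqI[of _ _ "(1,0)"])
    fix u w assume uw: "u \<in> int_module.span S'" "w \<in> int_module.span S'"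
    show "u * w \<in> int_module.span S'"
    proof (rule int_span_mult[OF _ uw])
      fix a b assume "a \<in> S'" "b \<in> S'"
      then obtain s i t j where "a = s * x ^ i" "b = t * x ^ j" "s \<in> S" "t \<in> S"
        by (auto simp: S'_def)
      moreover from this have "s * t \<in> int_module.span S"
        using R by (auto simp: fg_ring_def int_module.span_base)
      ultimately show "a * b \<in> int_module.span S'" using pw[of "s * t" "i + j"]
        by (simp add: power_add algebra_simps)
    qed
  qed simp
  moreover have "R \<subseteq> int_module.span S'" using pw[of _ 0] RS by auto
  moreover have "x \<in> int_module.span S'" using pw[of 1 1] S1 by (simp add: int_module.span_base)
  ultimately show ?thesis by blast
qed

lemma fg_ring_finite:
  assumes "finite A" "\<And>a. a \<in> A \<Longrightarrow> algebraic_int a"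
  shows "\<exists>S R. fg_ring S R \<and> A \<subseteq> R"
  using assms
proof (induction rule: finite_induct)
  case empty
  then show ?case using fg_ring_Ints by blast
next
  case (insert a A)
  then obtain S R where "fg_ring S R" "A \<subseteq> R" by auto
  moreover obtain S' R' where "fg_ring S' R'" "R \<subseteq> R'" "a \<in> R'"
    using fg_ring_extend[OF \<open>fg_ring S R\<close>] insert.prems by blast
  ultimately show ?case by blast
qed

lemma
  fixes x y :: complex
  assumes "algebraic_int x" "algebraic_int y"
  shows algebraic_int_plus: "algebraic_int (x + y)" and algebraic_int_mult: "algebraic_int (x * y)"
proof -
  obtain S R where R: "fg_ring S R" "{x, y} \<subseteq> R" using fg_ring_finite[of "{x,y}"] assms by auto
  show "algebraic_int (x + y)" "algebraic_int (x * y)"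
    using R by (auto intro!: fg_ring_imp_algebraic_int[OF R(1)] fg_ring_add fg_ring_mult)
qed

lemma algebraic_int_power: "algebraic_int (x :: complex) \<Longrightarrow> algebraic_int (x ^ n)"
  by (induction n) (auto intro: algebraic_int_mult)

lemma algebraic_int_sum: "(\<And>i. i \<in> I \<Longrightarrow> algebraic_int (f i :: complex)) \<Longrightarrow> algebraic_int (sum f I)"
  by (induction I rule: infinite_finite_induct) (auto intro: algebraic_int_plus)

lemma algebraic_int_prod: "(\<And>i. i \<in> I \<Longrightarrow> algebraic_int (f i :: complex)) \<Longrightarrow> algebraic_int (prod f I)"
  by (induction I rule: infinite_finite_induct) (auto intro: algebraic_int_mult)

text \<open>
  Each coefficient of the quotient maps the module spanned by the \<open>s z\<^sup>j\<close> with
  \<open>j \<le> degree q\<close> into itself: for \<open>j \<le> i\<close> write \<open>q\<^sub>i\<close> through the coefficients of the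
  product above \<open>i\<close>, otherwise through those below.
\<close>
lemma algebraic_int_coeffs_div_linear:
  fixes q :: "complex poly"
  assumes f: "\<And>i. algebraic_int (coeff ([:-z, 1:] * q) i)"
  shows "algebraic_int (coeff q i)"
proof (cases "q = 0")
  case False
  define f where "f = [:-z, 1:] * q"
  define n where "n = Suc (degree q)"
  have c0: "coeff f 0 = - z * coeff q 0" by (simp add: f_def)
  have cS: "coeff f (Suc i) = coeff q i - z * coeff q (Suc i)" for i by (simp add: f_def)
  obtain S R where R: "fg_ring S R" "coeff f ` {..n} \<subseteq> R"
    using fg_ring_finite[of "coeff f ` {..n}"] assms by (auto simp: f_def)
  have fS: "finite S" and S1: "1 \<in> S" and RS: "R = int_module.span S" using R(1) by (auto simp: fg_ring_def)
  define T where "T = (\<lambda>(s,j). s * z ^ j) ` (S \<times> {..<n})"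
  have fz: "r * z ^ j \<in> int_module.span T" if "r \<in> R" "j < n" for r j
  proof (rule int_span_mult[of S "{z ^ j}"])
    show "a * b \<in> int_module.span T" if "a \<in> S" "b \<in> {z ^ j}" for a b
      using that \<open>j < n\<close> by (intro int_module.span_base) (auto simp: T_def)
  qed (use that RS in \<open>auto simp: int_module.span_base\<close>)
  have qi0: "coeff q i = 0" if "i \<ge> n" for i using that by (simp add: n_def coeff_eq_0)
  have up: "coeff q i * z ^ j \<in> int_module.span T" if "j \<le> i" for i j
    using that
  proof (induction "n - i" arbitrary: i j)
    case 0
    then show ?case by (simp add: qi0 int_module.span_zero)
  next
    case (Suc k)
    have "coeff q i * z ^ j = coeff f (Suc i) * z ^ j + coeff q (Suc i) * z ^ Suc j"
      by (simp add: cS algebra_simps)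
    moreover have "coeff q (Suc i) * z ^ Suc j \<in> int_module.span T" using Suc by (intro Suc.hyps) auto
    moreover have "coeff f (Suc i) * z ^ j \<in> int_module.span T" using Suc R(2) by (intro fz) auto
    ultimately show ?case by (auto intro: int_module.span_add)
  qed
  have down: "coeff q i * z ^ j \<in> int_module.span T" if "i < j" "j \<le> n" for i j
    using that
  proof (induction i arbitrary: j)
    case 0
    have "coeff q 0 * z ^ j = - (coeff f 0 * z ^ (j - 1))" 
      using 0 by (cases j) (auto simp: c0)
    also have "\<dots> \<in> int_module.span T" using 0 R(2) by (intro int_module.span_neg fz) auto
    finally show ?case .
  next
    case (Suc i)
    have "coeff q (Suc i) * z ^ j = coeff q i * z ^ (j - 1) - coeff f (Suc i) * z ^ (j - 1)"
      using Suc.prems by (cases j) (auto simp: cS algebra_simps)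
    also have "\<dots> \<in> int_module.span T" using Suc R(2) by (intro int_module.span_diff fz Suc.IH) auto
    finally show ?case .
  qed
  show ?thesis
  proof (rule algebraic_int_if_stable[of T 1])
    show "finite T" using fS by (simp add: T_def)
    show "1 \<in> T" unfolding T_def using S1 by (auto intro!: image_eqI[of _ _ "(1,0)"] simp: n_def)
    fix t assume "t \<in> T"
    then obtain s j where t: "t = s * z ^ j" "s \<in> S" "j < n" by (auto simp: T_def)
    have "coeff q i * z ^ j \<in> int_module.span T" using up[of j i] down[of i j] t(3) by (cases "j \<le> i") auto
    then have "s * (coeff q i * z ^ j) \<in> int_module.span T"
    proof (rule int_span_mult[of S T T, rotated 2])
      fix a b assume "a \<in> S" "b \<in> T"
      then obtain u k where b: "b = u * z ^ k" "u \<in> S" "k < n" by (auto simp: T_def)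
      have "a * u \<in> R" using R(1) RS \<open>a \<in> S\<close> b(2) by (auto simp: int_module.span_base intro: fg_ring_mult)
      then show "a * b \<in> int_module.span T" using fz[of "a * u" k] b by (simp add: mult.assoc)
    qed (use t in \<open>auto simp: int_module.span_base\<close>)
    then show "coeff q i * t \<in> int_module.span T" using t by (simp add: mult.left_commute mult.assoc)
  qed simp
qed simp

section \<open>Integer minimal polynomials\<close>

abbreviation ipoly :: "int poly \<Rightarrow> complex \<Rightarrow> complex" where
  "ipoly p x \<equiv> poly (map_poly of_int p) x"

text \<open>Pseudo-division stays within integer polynomials; its remainder vanishes at
  \<open>x\<close> and has too small a degree, so it is 0. The scalar that it introduces is
  cancelled by Gauss's lemma, as \<open>p\<close> is primitive.\<close>

lemma dvd_if_minimal_degree: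
  assumes p: "Polynomial.content p = 1" "ipoly p x = 0" "p \<noteq> 0"
    and min: "\<And>f. f \<noteq> 0 \<Longrightarrow> ipoly f x = 0 \<Longrightarrow> degree p \<le> degree f"
    and f: "ipoly f x = 0"
  shows "p dvd f"
proof -
  obtain a q where aq: "a \<noteq> 0" "smult a f = p * q + pseudo_mod f p"
    using pseudo_mod(1)[OF p(3), of f] by auto
  have "ipoly (smult a f) x = ipoly (p * q + pseudo_mod f p) x" by (simp only: aq(2))
  then have "ipoly (pseudo_mod f p) x = 0"
    using f p by (simp add: of_int_poly_hom.hom_mult of_int_poly_hom.hom_add map_poly_smult of_int_hom.map_poly_hom_smult)
  then have "pseudo_mod f p = 0"
    using pseudo_mod(2)[OF p(3), of f] min[of "pseudo_mod f p"] by fastforce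
  then have eq: "smult a f = p * q" using aq by simp
  have "[:a:] dvd smult a f" by (simp add: dvd_smult_iff const_poly_dvd_iff)
  then have "a dvd Polynomial.content (p * q)" by (simp only: eq const_poly_dvd_iff_dvd_content)
  then have "a dvd Polynomial.content q" using p(1) by (simp add: content_mult)
  then have "[:a:] dvd q" by (simp only: const_poly_dvd_iff_dvd_content)
  then obtain q' where "q = [:a:] * q'" by (elim dvdE)
  then have "q = smult a q'" by simp
  then have "[:a:] * f = [:a:] * (p * q')" using eq by simp
  then have "f = p * q'" using aq(1) by (subst (asm) mult_cancel_left) simp
  then show ?thesis by simp
qed

lemma ex_minimal_int_poly:
  fixes x :: complex
  assumes "algebraic x"
  obtains p :: "int poly" where "Polynomial.content p = 1" "lead_coeff p > 0" "ipoly p x = 0"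
     "\<And>f. ipoly f x = 0 \<Longrightarrow> p dvd f"
proof -
  obtain p0 :: "int poly" where p0: "p0 \<noteq> 0" "ipoly p0 x = 0"
    using assms by (elim algebraicE') auto
  obtain p1 where p1: "p1 \<noteq> 0" "ipoly p1 x = 0" "\<And>f. f \<noteq> 0 \<Longrightarrow> ipoly f x = 0 \<Longrightarrow> degree p1 \<le> degree f"
    using p0 arg_min_nat_lemma[of "\<lambda>p. p \<noteq> 0 \<and> ipoly p x = 0" p0 degree] by blast
  define p2 where "p2 = primitive_part p1"
  have 2: "p1 = smult (Polynomial.content p1) p2" by (simp add: p2_def)
  have c: "Polynomial.content p1 \<noteq> 0" using p1 by simp
  have p2: "p2 \<noteq> 0" "Polynomial.content p2 = 1" "degree p2 = degree p1" using p1 by (auto simp: p2_def)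
  have "ipoly p1 x = of_int (Polynomial.content p1) * ipoly p2 x"
    by (subst 2) (simp only: of_int_hom.map_poly_hom_smult poly_smult)
  then have r2: "ipoly p2 x = 0" using p1(2) c by simp
  define p3 where "p3 = smult (sgn (lead_coeff p2)) p2"
  have "coeff p2 (degree p1) \<noteq> 0" using leading_coeff_neq_0[OF p2(1)] p2(3) by metis
  then have s: "sgn (lead_coeff p2) \<noteq> 0" "coeff p2 (degree p1) \<noteq> 0" using p2 by (simp_all add: sgn_if)
  have p3: "p3 \<noteq> 0" "Polynomial.content p3 = 1" "degree p3 = degree p1" "lead_coeff p3 > 0"
    using p2 s by (auto simp: p3_def sgn_if)
  have r3: "ipoly p3 x = 0" using r2 by (simp add: p3_def of_int_hom.map_poly_hom_smult)
  show thesis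
  proof (rule that[of p3])
    show "p3 dvd f" if "ipoly f x = 0" for f
    proof (rule dvd_if_minimal_degree[OF p3(2) r3 p3(1) _ that])
      show "degree p3 \<le> degree g" if "g \<noteq> 0" "ipoly g x = 0" for g
        unfolding p3(3) using p1(3) that by blast
    qed
  qed (use p3 r3 in blast)+
qed

text \<open>This resolves the definite description: every irreducible annihilator is an associate of
  the polynomial dividing all annihilators, and the sign condition leaves 1 as the only
  unit.\<close>

lemma min_int_poly_eq:
  assumes "irreducible p" "lead_coeff p > 0" "ipoly p x = 0"
  shows "min_int_poly x = p"
proof -
  have "algebraic x" using assms by (intro algebraicI[of "map_poly of_int p"]) auto
  then obtain m where m: "lead_coeff m > 0" "ipoly m x = 0" "\<And>f. ipoly f x = 0 \<Longrightarrow> m dvd f"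
    using ex_minimal_int_poly by metis
  have *: "q = m" if q: "irreducible q" "lead_coeff q > 0" "ipoly q x = 0" for q
  proof -
    obtain c where c: "q = m * c" using m(3)[OF q(3)] by auto
    have "\<not> is_unit m" using m(1,2) by (auto simp: is_unit_poly_iff)
    then have "is_unit c" using irreducibleD[OF q(1) c] by auto
    then obtain d where d: "c = [:d:]" "is_unit d" by (auto simp: is_unit_poly_iff)
    then have "d = 1" using q(2) m(1) by (auto simp: c zero_less_mult_iff)
    then show ?thesis using c d by simp
  qed
  show ?thesis unfolding min_int_poly_def using assms * by (intro the_equality) metis+
qed

lemma min_int_poly:
  assumes "algebraic x"
  shows "irreducible (min_int_poly x)" "lead_coeff (min_int_poly x) > 0" "ipoly (min_int_poly x) x = 0"
    "Polynomial.content (min_int_poly x) = 1" "degree (min_int_poly x) > 0"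
    and "\<And>f. ipoly f x = 0 \<Longrightarrow> min_int_poly x dvd f"
proof -
  obtain m where m: "Polynomial.content m = 1" "lead_coeff m > 0" "ipoly m x = 0" "\<And>f. ipoly f x = 0 \<Longrightarrow> m dvd f"
    using assms ex_minimal_int_poly by metis
  have dm: "degree m > 0"
  proof (rule ccontr)
    assume "\<not> 0 < degree m"
    then obtain a where "m = [:a:]" by (metis degree_eq_zeroE gr0I)
    then show False using m by auto
  qed
  have "irreducible m"
  proof (rule irreducibleI)
    show "m \<noteq> 0" "\<not> is_unit m" using m dm by (auto simp: is_unit_poly_iff)
    fix a b assume ab: "m = a * b"
    have "ipoly a x = 0 \<or> ipoly b x = 0" using m(3) by (simp add: ab of_int_poly_hom.hom_mult)
    then show "is_unit a \<or> is_unit b"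
    proof
      assume "ipoly a x = 0"
      then obtain c where "a = m * c" using m(4) by blast
      then have "m * (c * b) = m * 1" using ab by (metis mult.assoc mult_1_right)
      then have "c * b = 1" using \<open>m \<noteq> 0\<close> mult_cancel_left by blast
      then show ?thesis by (metis dvd_triv_right)
    next
      assume "ipoly b x = 0"
      then obtain c where "b = m * c" using m(4) by blast
      then have "m * (a * c) = m * 1" using ab by (metis mult.assoc mult.commute mult_1_right)
      then have "a * c = 1" using \<open>m \<noteq> 0\<close> mult_cancel_left by blast
      then show ?thesis by (metis dvd_triv_left)
    qed
  qed
  then have eq: "min_int_poly x = m" using m(2,3) by (rule min_int_poly_eq)
  show "irreducible (min_int_poly x)" "lead_coeff (min_int_poly x) > 0" "ipoly (min_int_poly x) x = 0"
    "Polynomial.content (min_int_poly x) = 1" "degree (min_int_poly x) > 0"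
    unfolding eq by (fact \<open>irreducible m\<close> m dm)+
  show "min_int_poly x dvd f" if "ipoly f x = 0" for f
    unfolding eq using that by (rule m(4))
qed

lemma min_int_poly_conjugate:
  assumes "algebraic x" "ipoly (min_int_poly x) y = 0"
  shows "min_int_poly y = min_int_poly x" "algebraic y"
proof -
  show "min_int_poly y = min_int_poly x" using assms min_int_poly by (intro min_int_poly_eq)
  show "algebraic y" using assms min_int_poly(2)[of x] 
    by (intro algebraicI[of "map_poly of_int (min_int_poly x)"]) auto
qed

lemma ipoly_conjugate:
  assumes "algebraic x" "ipoly (min_int_poly x) y = 0" "ipoly f x = 0"
  shows "ipoly f y = 0"
  using min_int_poly(6)[OF assms(1,3)] assms(2) by (auto simp: of_int_poly_hom.hom_mult)

text \<open>A multiple root \<open>a\<close> is a conjugate of \<open>x\<close> and so has the same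
  minimal polynomial, which would then divide its own nonzero derivative.\<close>

lemma rsquarefree_min_int_poly:
  assumes "algebraic x"
  shows "rsquarefree (map_poly of_int (min_int_poly x) :: complex poly)"
  unfolding rsquarefree_roots
proof (intro allI notI)
  fix a assume a: "ipoly (min_int_poly x) a = 0 \<and> poly (pderiv (map_poly of_int (min_int_poly x))) a = 0"
  define p where "p = min_int_poly x"
  note p = min_int_poly[OF assms, folded p_def]
  have "min_int_poly a = p" "algebraic a" using min_int_poly_conjugate[OF assms] a by (auto simp: p_def)
  moreover have "ipoly (pderiv p) a = 0" using a by (simp add: p_def of_int_hom.map_poly_pderiv)
  ultimately have "p dvd pderiv p" using min_int_poly(6)[of a "pderiv p"] by simp
  moreover have "pderiv p \<noteq> 0" using p(5) by (simp add: pderiv_eq_0_iff)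
  ultimately show False using dvd_imp_degree_le[of p "pderiv p"] p(5) by (simp add: degree_pderiv)
qed

lemma min_int_poly_decompose:
  assumes "algebraic x"
  defines "p \<equiv> min_int_poly x"
  shows "map_poly of_int p = smult (of_int (lead_coeff p)) (\<Prod>z\<in>{z. ipoly p z = 0}. [:-z, 1::complex:])"
proof -
  have lc: "lead_coeff (map_poly of_int p :: complex poly) = of_int (lead_coeff p)" by simp
  show ?thesis
    using complex_poly_decompose_rsquarefree[OF rsquarefree_min_int_poly[OF assms(1)], folded p_def, symmetric]
    unfolding lc .
qed

text \<open>Any complex root of \<open>f\<close> is a conjugate of \<open>x\<close>, so the minimal
  polynomial of \<open>x\<close> can be split off until a constant remains. This will identify
  characteristic polynomials.\<close>

lemma power_of_irreducible:
  fixes f :: "int poly"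
  assumes x: "algebraic x" and f: "f \<noteq> 0" "\<And>z. ipoly f z = 0 \<Longrightarrow> ipoly (min_int_poly x) z = 0"
  shows "\<exists>c e. f = smult c (min_int_poly x ^ e)"
  using f
proof (induction "degree f" arbitrary: f rule: less_induct)
  case less
  define p where "p = min_int_poly x"
  note p = min_int_poly[OF x, folded p_def]
  show ?case
  proof (cases "degree f = 0")
    case True
    then obtain a where "f = [:a:]" by (metis degree_eq_zeroE)
    then show ?thesis by (intro exI[of _ a] exI[of _ 0]) simp
  next
    case False
    then have "\<not> constant (poly (map_poly of_int f :: complex poly))"
      by (simp add: constant_degree)
    then obtain z where z: "ipoly f z = 0" using fundamental_theorem_of_algebra by blast
    have "p dvd f" unfolding p_def
      using min_int_poly(6)[OF min_int_poly_conjugate(2)[OF x less(3)[OF z]] z]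
      by (simp only: min_int_poly_conjugate(1)[OF x less(3)[OF z]])
    then obtain g where g: "f = p * g" by auto
    have "g \<noteq> 0" "p \<noteq> 0" using g less(2) by auto
    then have dg: "degree g < degree f" using p(5) by (simp add: g degree_mult_eq)
    have rg: "ipoly (min_int_poly x) w = 0" if "ipoly g w = 0" for w
      by (rule less(3)) (simp add: g of_int_poly_hom.hom_mult that)
    obtain c e where "g = smult c (p ^ e)"
      using less(1)[OF dg \<open>g \<noteq> 0\<close> rg] unfolding p_def by blast
    then have "f = smult c (p ^ Suc e)" using g by simp
    then show ?thesis unfolding p_def by blast
  qed
qed

section \<open>Power sums\<close>

lemma coeff_0_prod_poly: "coeff (prod f A :: complex poly) 0 = (\<Prod>a\<in>A. coeff (f a) 0)"
  by (induction A rule: infinite_finite_induct) (auto simp: coeff_mult_0)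

text \<open>Compare coefficients in the logarithmic derivative of the product.\<close>
lemma newton_identity:
  fixes w :: "'a \<Rightarrow> complex"
  assumes fin: "finite G"
  shows "of_nat (Suc n) * coeff (\<Prod>s\<in>G. [:1, - w s:]) (Suc n) =
     - (\<Sum>i\<le>n. coeff (\<Prod>s\<in>G. [:1, - w s:]) i * (\<Sum>s\<in>G. w s ^ (Suc n - i)))"
proof -
  define E where "E = (\<Prod>s\<in>G. [:1, - w s:])"
  define P where "P = Abs_fps (\<lambda>k. \<Sum>s\<in>G. w s ^ Suc k)"
  define geo where "geo = (\<lambda>s. Abs_fps (\<lambda>k. w s ^ k))"
  have geo: "fps_of_poly [:1, - w s:] * geo s = 1" for s
  proof -
    have "fps_of_poly [:1, - w s:] = 1 - fps_const (w s) * fps_X"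
      by (simp add: fps_of_poly_pCons fps_mult_fps_X_commute flip: fps_const_neg)
    moreover have "(1 - fps_const (w s) * fps_X) * geo s = 1"
    proof (rule fps_ext)
      show "fps_nth ((1 - fps_const (w s) * fps_X) * geo s) n = fps_nth 1 n" for n
        by (cases n) (simp_all add: geo_def left_diff_distrib mult.assoc)
    qed
    ultimately show ?thesis by (simp only:)
  qed
  \<comment> \<open>The geometric series inverts a linear factor, so omitting that factor from
    \<open>E\<close> is multiplication by a power series.\<close>
  have Es: "fps_of_poly (\<Prod>t\<in>G-{s}. [:1, - w t:]) = fps_of_poly E * geo s" if "s \<in> G" for s
  proof -
    have "E = [:1, - w s:] * (\<Prod>t\<in>G-{s}. [:1, - w t:])"
      unfolding E_def by (rule prod.remove[OF fin that])
    then have "fps_of_poly E * geo s = (fps_of_poly [:1, - w s:] * geo s) * fps_of_poly (\<Prod>t\<in>G-{s}. [:1, - w t:])"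
      by (simp only: fps_of_poly_mult mult_ac)
    then show ?thesis by (simp only: geo mult_1_left)
  qed
  have "pderiv E = (\<Sum>s\<in>G. (\<Prod>t\<in>G-{s}. [:1, - w t:]) * pderiv [:1, - w s:])"
    unfolding E_def by (rule pderiv_prod)
  also have "\<dots> = (\<Sum>s\<in>G. smult (- w s) (\<Prod>t\<in>G-{s}. [:1, - w t:]))"
    by (simp add: pderiv_pCons)
  finally have "fps_of_poly (pderiv E) = (\<Sum>s\<in>G. fps_const (- w s) * fps_of_poly (\<Prod>t\<in>G-{s}. [:1, - w t:]))"
    by (simp only: fps_of_poly_sum fps_of_poly_smult)
  also have "\<dots> = (\<Sum>s\<in>G. fps_const (- w s) * (fps_of_poly E * geo s))"
    by (intro sum.cong refl) (simp only: Es)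
  also have "\<dots> = - fps_of_poly E * (\<Sum>s\<in>G. fps_const (w s) * geo s)"
    by (simp add: sum_distrib_left sum_negf mult_ac flip: fps_const_neg)
  also have "(\<Sum>s\<in>G. fps_const (w s) * geo s) = P"
    by (rule fps_ext) (simp add: P_def geo_def fps_sum_nth)
  finally have "fps_nth (fps_of_poly (pderiv E)) n = fps_nth (- (fps_of_poly E * P)) n"
    by (simp only: mult_minus_left)
  then have "of_nat (Suc n) * coeff E (Suc n) = - (\<Sum>i\<le>n. coeff E i * fps_nth P (n - i))"
    by (simp only: fps_of_poly_nth coeff_pderiv fps_neg_nth fps_mult_nth atLeast0AtMost)
  also have "(\<Sum>i\<le>n. coeff E i * fps_nth P (n - i)) = (\<Sum>i\<le>n. coeff E i * (\<Sum>s\<in>G. w s ^ (Suc n - i)))"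
    by (intro sum.cong refl) (simp add: P_def Suc_diff_le)
  finally show ?thesis by (simp only: E_def)
qed

text \<open>Newton's identities are triangular with nonzero integers on the diagonal, so over the
  rationals power sums and coefficients determine each other. This takes the place of the theorem on
  symmetric polynomials.\<close>

lemma Rats_coeffs_iff_power_sums_aux:
  fixes w :: "'a \<Rightarrow> complex"
  assumes fin: "finite G"
  shows "(\<forall>i. coeff (\<Prod>s\<in>G. [:1, - w s:]) i \<in> \<rat>) \<longleftrightarrow> (\<forall>k. (\<Sum>s\<in>G. w s ^ k) \<in> \<rat>)"
    (is "(\<forall>i. ?e i \<in> _) \<longleftrightarrow> (\<forall>k. ?p k \<in> _)")
proof -
  have e0: "?e 0 = 1" by (simp add: coeff_0_prod_poly) 
  note N = newton_identity[OF fin, of _ w]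
  have aux: "p = - c - t" if "c = - S" "S = p + t" for c S p t :: complex
    using that by simp
  show ?thesis
  proof (intro iffI allI)
    fix k assume e: "\<forall>i. ?e i \<in> \<rat>"
    show "?p k \<in> \<rat>"
    proof (induction k rule: less_induct)
      case (less k)
      show ?case
      proof (cases k)
        case (Suc n)
        have "(\<Sum>i\<le>n. ?e i * ?p (Suc n - i)) = ?p (Suc n) + (\<Sum>i=1..n. ?e i * ?p (Suc n - i))"
          using e0 by (simp add: sum.atMost_shift sum.atLeast1_atMost_eq)
        then have "?p (Suc n) = - (of_nat (Suc n) * ?e (Suc n)) - (\<Sum>i=1..n. ?e i * ?p (Suc n - i))"
          by (rule aux[OF N[of n]])
        also have "\<dots> \<in> \<rat>"
        proof (intro Rats_diff Rats_minus_iff[THEN iffD2] Rats_mult Rats_of_nat)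
          show "(\<Sum>i=1..n. ?e i * ?p (Suc n - i)) \<in> \<rat>"
            using e less Suc by (intro Rats_sum[of "{1..n}"]) (auto intro!: Rats_mult)
        qed (use e in blast)
        finally show ?thesis using Suc by simp
      qed simp
    qed
  next
    fix k assume p: "\<forall>k. ?p k \<in> \<rat>"
    show "?e k \<in> \<rat>"
    proof (induction k rule: less_induct)
      case (less k)
      show ?case
      proof (cases k)
        case 0 then show ?thesis by (simp only: e0 Rats_1)
      next
        case (Suc n)
        have "?e (Suc n) = - (\<Sum>i\<le>n. ?e i * ?p (Suc n - i)) / of_nat (Suc n)"
          using N[of n] by (simp add: field_simps del: of_nat_Suc)
        also have "\<dots> \<in> \<rat>"
          using p less Suc by (intro Rats_divide Rats_minus_iff[THEN iffD2] Rats_sum[of "{..n}"] Rats_of_nat) (auto intro!: Rats_mult)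
        finally show ?thesis using Suc by simp
      qed
    qed
  qed
qed

text \<open>Reversing coefficients passes from the factors \<open>[:- w s, 1:]\<close> to the
  factors \<open>[:1, - w s:]\<close>, which are invertible as power series.\<close>

lemma Rats_coeffs_iff_power_sums:
  fixes w :: "'a \<Rightarrow> complex"
  assumes fin: "finite G"
  shows "(\<forall>i. coeff (\<Prod>s\<in>G. [:- w s, 1:]) i \<in> \<rat>) \<longleftrightarrow> (\<forall>k. (\<Sum>s\<in>G. w s ^ k) \<in> \<rat>)"
proof -
  define p where "p = (\<Prod>s\<in>G. [:- w s, 1:])"
  have r1: "reflect_poly [:- w s, 1:] = [:1, - w s:]" for s
    by (rule poly_eqI) (auto simp: coeff_reflect_poly coeff_pCons split: nat.splits)
  have r: "reflect_poly p = (\<Prod>s\<in>G. [:1, - w s:])"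
    by (simp only: p_def reflect_poly_prod r1)
  have "(\<forall>i. coeff p i \<in> \<rat>) \<longleftrightarrow> (\<forall>i. coeff (reflect_poly p) i \<in> \<rat>)"
  proof (intro iffI allI)
    fix i assume "\<forall>i. coeff (reflect_poly p) i \<in> \<rat>"
    then have "coeff (reflect_poly p) (degree p - i) \<in> \<rat>" by blast
    then show "coeff p i \<in> \<rat>" 
      by (cases "i \<le> degree p") (auto simp: coeff_reflect_poly coeff_eq_0 split: if_splits)
  qed (auto simp: coeff_reflect_poly)
  then show ?thesis using Rats_coeffs_iff_power_sums_aux[OF fin, of w] r p_def by simp
qed

section \<open>Primitive elements and their conjugates\<close>

text \<open>The factors outside \<open>S\<close> are divided out one at a time by
  \<open>algebraic_int_coeffs_div_linear\<close>. The constant coefficient of the result is, up to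
  sign, \<open>c\<close> times a product of roots.\<close>

lemma algebraic_int_coeffs_subproduct:
  fixes w :: "'a \<Rightarrow> complex"
  assumes "finite G" "\<And>i. algebraic_int (coeff (smult c (\<Prod>s\<in>G. [:- w s, 1:])) i)" "S \<subseteq> G"
  shows "algebraic_int (coeff (smult c (\<Prod>s\<in>S. [:- w s, 1:])) i)"
proof -
  have "\<forall>i. algebraic_int (coeff (smult c (\<Prod>s\<in>G-T. [:- w s, 1:])) i)" if "finite T" "T \<subseteq> G" for T
    using that
  proof (induction T rule: finite_induct)
    case empty then show ?case using assms(2) by simp
  next
    case (insert t T)
    have "G - T = insert t (G - insert t T)" using insert.hyps insert.prems by blast
    then have "(\<Prod>s\<in>G-T. [:- w s, 1:]) = (\<Prod>s\<in>insert t (G - insert t T). [:- w s, 1:])" by (rule arg_cong)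
    also have "\<dots> = [:- w t, 1:] * (\<Prod>s\<in>G - insert t T. [:- w s, 1:])"
      using assms(1) by (intro prod.insert) auto
    finally have "smult c (\<Prod>s\<in>G-T. [:- w s, 1:]) = [:- w t, 1:] * smult c (\<Prod>s\<in>G - insert t T. [:- w s, 1:])"
      by (simp only: mult_smult_right)
    moreover have "\<forall>i. algebraic_int (coeff (smult c (\<Prod>s\<in>G-T. [:- w s, 1:])) i)"
      using insert by auto
    ultimately show ?case using algebraic_int_coeffs_div_linear[of "w t"] by metis
  qed
  from this[of "G - S"] show ?thesis using assms by (simp add: double_diff finite_subset)
qed

lemma algebraic_scaled_algebraic_int:
  assumes "algebraic (x::complex)"
  obtains a :: int where "a \<noteq> 0" "algebraic_int (of_int a * x)"
proof -
  define p where "p = min_int_poly x"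
  note p = min_int_poly[OF assms, folded p_def]
  define a where "a = lead_coeff p"
  have fin: "finite {z. ipoly p z = 0}" using p(2) by (intro poly_roots_finite) auto
  have "algebraic_int (coeff (smult (of_int a) (\<Prod>z\<in>{z. ipoly p z = 0}. [:- z, 1:])) i)" for i
    unfolding a_def p_def min_int_poly_decompose[OF assms, symmetric] by simp
  \<comment> \<open>Keeping only the factor of \<open>x\<close> itself, the constant coefficient is
    - a x.\<close>
  from algebraic_int_coeffs_subproduct[OF fin this, of "{x}" 0] p(3)
  have "algebraic_int (- (of_int a * x))" by simp
  moreover have "a \<noteq> 0" using p(2) by (metis a_def less_irrefl)
  ultimately show thesis using that[of a] by simp
qed

lemma algebraic_of_scaled:
  assumes "algebraic (of_int a * x :: complex)" "a \<noteq> 0"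
  shows "algebraic x"
proof -
  obtain p :: "int poly" where p: "p \<noteq> 0" "ipoly p (of_int a * x) = 0"
    using assms(1) by (elim algebraicE') auto
  define q where "q = pcompose p [:0, a:]"
  have "q \<noteq> 0" using p(1) assms(2) by (simp add: q_def pcompose_eq_0_iff)
  moreover have "ipoly q x = 0" using p(2)
    by (simp add: q_def of_int_hom.map_poly_pcompose poly_pcompose of_int_hom.map_poly_pCons_hom mult.commute)
  ultimately show ?thesis by (intro algebraicI[of "map_poly of_int q"]) auto
qed

text \<open>Clearing denominators reduces this to sums of algebraic integers. It is just enough
  closure to form a primitive element; closure under all operations follows later from number
  fields.\<close>

lemma algebraic_add_int_multiple: 
  assumes "algebraic (x::complex)" "algebraic y" shows "algebraic (x + of_int c * y)"
proof -
  obtain a :: int where a: "a \<noteq> 0" "algebraic_int (of_int a * x)"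
    by (rule algebraic_scaled_algebraic_int[OF assms(1)])
  obtain b :: int where b: "b \<noteq> 0" "algebraic_int (of_int b * y)"
    by (rule algebraic_scaled_algebraic_int[OF assms(2)])
  have 1: "algebraic_int (of_int b * (of_int a * x))"
    by (rule algebraic_int_mult[OF algebraic_int_of_int a(2)])
  have 2: "algebraic_int (of_int (a * c) * (of_int b * y))"
    by (rule algebraic_int_mult[OF algebraic_int_of_int b(2)])
  have "of_int b * (of_int a * x) + of_int (a * c) * (of_int b * y) = of_int (a * b) * (x + of_int c * y)"
    by (simp only: of_int_mult ring_distribs mult_ac)
  then have "algebraic (of_int (a * b) * (x + of_int c * y))"
    using algebraic_int_imp_algebraic[OF algebraic_int_plus[OF 1 2]] by (simp only:)
  moreover have "a * b \<noteq> 0" using a b by simp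
  ultimately show ?thesis by (rule algebraic_of_scaled)
qed

lemma Rats_coeffs_scale:
  assumes "\<And>i. coeff (f :: complex poly) i \<in> \<rat>"
  obtains d :: int and p where "d \<noteq> 0" "smult (of_int d) f = map_poly of_int p"
proof -
  have "\<exists>d p. d \<noteq> 0 \<and> smult (of_int d) f = map_poly of_int p" using assms
  proof (induction f)
    case 0 then show ?case by (intro exI[of _ 1] exI[of _ 0]) simp
  next
    case (pCons a f)
    have "a \<in> \<rat>" using pCons.prems[of 0] by simp
    then obtain m n where mn: "n > 0" "a = of_int m / of_int n" by (auto elim: Rats_cases')
    have "coeff f i \<in> \<rat>" for i using pCons.prems[of "Suc i"] by simp
    then obtain d p where d: "d \<noteq> 0" "smult (of_int d) f = map_poly of_int p" using pCons.IH by auto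
    have "smult (of_int (n * d)) (pCons a f) = map_poly of_int (pCons (m * d) (smult n p))"
      using mn d(2)[symmetric] by (simp add: of_int_hom.map_poly_pCons_hom of_int_hom.map_poly_hom_smult smult_smult[symmetric] del: smult_smult)
    moreover have "n * d \<noteq> 0" using mn d by simp
    ultimately show ?case by blast
  qed
  then show thesis using that by blast
qed

section \<open>Subfields of the complex numbers and simple extensions of the rationals\<close>

definition subfield :: "complex set \<Rightarrow> bool" where
  "subfield F \<longleftrightarrow> 1 \<in> F \<and> (\<forall>x\<in>F. \<forall>y\<in>F. x - y \<in> F \<and> x * y \<in> F \<and> inverse x \<in> F)"

lemma subfieldD:
  assumes "subfield F"
  shows "1 \<in> F" "0 \<in> F" "x \<in> F \<Longrightarrow> - x \<in> F" "x \<in> F \<Longrightarrow> y \<in> F \<Longrightarrow> x + y \<in> F"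
    "x \<in> F \<Longrightarrow> y \<in> F \<Longrightarrow> x - y \<in> F" "x \<in> F \<Longrightarrow> y \<in> F \<Longrightarrow> x * y \<in> F" "x \<in> F \<Longrightarrow> inverse x \<in> F"
    "x \<in> F \<Longrightarrow> y \<in> F \<Longrightarrow> x / y \<in> F"
proof -
  show 1: "1 \<in> F" and d: "\<And>x y. x \<in> F \<Longrightarrow> y \<in> F \<Longrightarrow> x - y \<in> F" and m: "\<And>x y. x \<in> F \<Longrightarrow> y \<in> F \<Longrightarrow> x * y \<in> F"
    and i: "\<And>x. x \<in> F \<Longrightarrow> inverse x \<in> F"
    using assms by (auto simp: subfield_def)
  show 0: "0 \<in> F" using d[OF 1 1] by simp
  show n: "- x \<in> F" if "x \<in> F" for x using d[OF 0 that] by simp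
  show "x + y \<in> F" if "x \<in> F" "y \<in> F" for x y using d[OF that(1) n[OF that(2)]] by simp
  show "x / y \<in> F" if "x \<in> F" "y \<in> F" for x y using m[OF that(1) i[OF that(2)]] by (simp add: divide_inverse)
qed

context
  fixes F assumes F: "subfield F"
begin

lemma subfield_of_nat: "of_nat n \<in> F" by (induction n) (auto intro: subfieldD[OF F])
lemma subfield_of_int: "of_int n \<in> F"
  by (cases n rule: int_cases2) (auto intro: subfieldD[OF F] subfield_of_nat)
lemma subfield_sum: "(\<And>i. i \<in> A \<Longrightarrow> f i \<in> F) \<Longrightarrow> sum f A \<in> F"
  by (induction A rule: infinite_finite_induct) (auto intro: subfieldD[OF F])
lemma subfield_prod: "(\<And>i. i \<in> A \<Longrightarrow> f i \<in> F) \<Longrightarrow> prod f A \<in> F"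
  by (induction A rule: infinite_finite_induct) (auto intro: subfieldD[OF F])
lemma subfield_power: "x \<in> F \<Longrightarrow> x ^ n \<in> F"
  by (induction n) (auto intro: subfieldD[OF F])
lemma subfield_poly: "(\<And>i. coeff p i \<in> F) \<Longrightarrow> x \<in> F \<Longrightarrow> poly p x \<in> F"
  unfolding poly_altdef by (intro subfield_sum subfieldD[OF F] subfield_power)

lemma subfield_coeff_mult: "(\<And>i. coeff p i \<in> F) \<Longrightarrow> (\<And>i. coeff q i \<in> F) \<Longrightarrow> coeff (p * q) i \<in> F"
  unfolding coeff_mult by (intro subfield_sum subfieldD[OF F])

lemma subfield_coeff_pcompose:
  "(\<And>i. coeff p i \<in> F) \<Longrightarrow> (\<And>i. coeff q i \<in> F) \<Longrightarrow> coeff (pcompose p q) i \<in> F"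
proof (induction p arbitrary: i)
  case (pCons a p)
  have "coeff p i \<in> F" for i using pCons.prems(1)[of "Suc i"] by simp
  moreover have "a \<in> F" using pCons.prems(1)[of 0] by simp
  ultimately show ?case using pCons.IH pCons.prems(2) 
    by (auto simp: pcompose_pCons coeff_pCons split: nat.splits intro!: subfieldD(4)[OF F] subfield_coeff_mult subfieldD(2)[OF F])
qed (auto intro: subfieldD[OF F])

text \<open>Long division over \<open>F\<close>, done on complex polynomials with coefficients in
  \<open>F\<close> because \<open>F\<close> is a set and not a type: one leading term is removed at
  a time.\<close>

lemma minimal_poly_dvd:
  assumes m: "m \<noteq> 0" "\<And>i. coeff m i \<in> F" "poly m y = 0"
    and min: "\<And>f. f \<noteq> 0 \<Longrightarrow> (\<And>i. coeff f i \<in> F) \<Longrightarrow> poly f y = 0 \<Longrightarrow> degree m \<le> degree f"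
    and f: "\<And>i. coeff f i \<in> F" "poly f y = 0"
  shows "m dvd f"
  using f
proof (induction "degree f" arbitrary: f rule: less_induct)
  case less
  show ?case
  proof (cases "f = 0")
    case False
    have le: "degree m \<le> degree f" using min[OF False less.prems] by blast
    define h where "h = monom (lead_coeff f / lead_coeff m) (degree f - degree m)"
    define g where "g = f - h * m"
    have hF: "coeff h i \<in> F" for i
      using m(2) less.prems(1) by (auto simp: h_def intro: subfieldD[OF F])
    have gF: "coeff g i \<in> F" for i unfolding g_def coeff_diff
      using m(2) less.prems(1) hF by (intro subfieldD(5)[OF F] subfield_coeff_mult)
    have g0: "poly g y = 0" using m(3) less.prems(2) by (simp add: g_def)
    have "degree (h * m) \<le> degree f"
      using degree_mult_le[of h m] degree_monom_le[of "lead_coeff f / lead_coeff m" "degree f - degree m"] le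
      by (simp add: h_def)
    then have "degree g \<le> degree f" unfolding g_def by (intro degree_diff_le) auto
    moreover have "coeff g (degree f) = 0"
      using le m(1) by (simp add: g_def h_def coeff_monom_mult)
    ultimately have "g = 0 \<or> degree g < degree f" by (rule eq_zero_or_degree_less)
    then have "m dvd g" using less.hyps[of g] gF g0 by auto
    then have "m dvd g + h * m" by (intro dvd_add) auto
    then show ?thesis by (simp add: g_def)
  qed simp
qed

end

text \<open>The field generated by \<open>g\<close> over the rationals, if \<open>g\<close> is
  algebraic. Integer numerators with one denominator let integer minimal polynomials act
  directly.\<close>

definition rat_ext :: "complex \<Rightarrow> complex set" where
  "rat_ext g = {ipoly f g / of_int d | f d. d \<noteq> 0}"

text \<open>The embedding of \<open>rat_ext g\<close> that sends \<open>g\<close> to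
  \<open>s\<close>. It is computed from an arbitrarily chosen representation and is meaningful only
  if \<open>s\<close> is a conjugate of \<open>g\<close> and \<open>z\<close> lies in
  \<open>rat_ext g\<close>.\<close>

definition embed :: "complex \<Rightarrow> complex \<Rightarrow> complex \<Rightarrow> complex" where
  "embed g s z = (let (f, d) = SOME (f, d). d \<noteq> 0 \<and> z = ipoly f g / of_int d in ipoly f s / of_int d)"

text \<open>Independence of the representation: two representations differ by an integer polynomial
  that vanishes at \<open>g\<close>, hence at its conjugate \<open>s\<close>.\<close>

lemma embed_eq:
  assumes g: "algebraic g" and s: "ipoly (min_int_poly g) s = 0" and d: "d \<noteq> 0"
  shows "embed g s (ipoly f g / of_int d) = ipoly f s / of_int d"
proof -
  define fd where "fd = (SOME (f', d'). d' \<noteq> 0 \<and> ipoly f g / of_int d = ipoly f' g / of_int d')"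
  obtain f' d' where fd': "fd = (f', d')" by (cases fd)
  have "case fd of (f', d') \<Rightarrow> d' \<noteq> 0 \<and> ipoly f g / of_int d = ipoly f' g / of_int d'"
    unfolding fd_def by (rule someI[of _ "(f, d)"]) (use d in auto)
  then have d': "d' \<noteq> 0" "ipoly f g / of_int d = ipoly f' g / of_int d'" by (auto simp: fd')
  then have "ipoly (smult d' f - smult d f') g = 0"
    using d by (simp add: field_simps of_int_poly_hom.hom_minus of_int_hom.map_poly_hom_smult)
  then have "ipoly (smult d' f - smult d f') s = 0" by (rule ipoly_conjugate[OF g s])
  then have "ipoly f s / of_int d = ipoly f' s / of_int d'"
    using d d' by (simp add: field_simps of_int_poly_hom.hom_minus of_int_hom.map_poly_hom_smult)
  then show ?thesis unfolding embed_def fd_def[symmetric] by (simp add: fd')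
qed

lemma rat_extE:
  assumes "z \<in> rat_ext g" obtains f d where "d \<noteq> 0" "z = ipoly f g / of_int d"
  using assms by (auto simp: rat_ext_def)

lemma rat_extI: "d \<noteq> 0 \<Longrightarrow> ipoly f g / of_int d \<in> rat_ext g"
  by (auto simp: rat_ext_def)

lemma rat_ext_ring:
  assumes "x \<in> rat_ext g" "y \<in> rat_ext g"
  shows "x - y \<in> rat_ext g" "x * y \<in> rat_ext g"
    and "algebraic g \<Longrightarrow> ipoly (min_int_poly g) s = 0 \<Longrightarrow> embed g s (x - y) = embed g s x - embed g s y"
    and "algebraic g \<Longrightarrow> ipoly (min_int_poly g) s = 0 \<Longrightarrow> embed g s (x * y) = embed g s x * embed g s y"
proof -
  obtain f d where x: "d \<noteq> 0" "x = ipoly f g / of_int d" by (rule rat_extE[OF assms(1)])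
  obtain f' d' where y: "d' \<noteq> 0" "y = ipoly f' g / of_int d'" by (rule rat_extE[OF assms(2)])
  have sub: "ipoly f t / of_int d - ipoly f' t / of_int d' = ipoly (smult d' f - smult d f') t / of_int (d * d')" for t
    using x y by (simp add: field_simps of_int_poly_hom.hom_minus of_int_hom.map_poly_hom_smult)
  have mul: "(ipoly f t / of_int d) * (ipoly f' t / of_int d') = ipoly (f * f') t / of_int (d * d')" for t
    by (simp add: of_int_poly_hom.hom_mult)
  have dd: "d * d' \<noteq> 0" using x y by simp
  show "x - y \<in> rat_ext g" unfolding x y sub by (rule rat_extI[OF dd])
  show "x * y \<in> rat_ext g" unfolding x y mul by (rule rat_extI[OF dd])
  assume g: "algebraic g" "ipoly (min_int_poly g) s = 0"
  show "embed g s (x - y) = embed g s x - embed g s y"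
    unfolding x(2) y(2) sub embed_eq[OF g dd] embed_eq[OF g x(1)] embed_eq[OF g y(1)] by simp
  show "embed g s (x * y) = embed g s x * embed g s y"
    unfolding x(2) y(2) mul embed_eq[OF g dd] embed_eq[OF g x(1)] embed_eq[OF g y(1)] by simp
qed

lemma rat_ext_of_int: "of_int n \<in> rat_ext g"
  using rat_extI[of 1 "[:n:]" g] by (simp add: of_int_hom.map_poly_pCons_hom)

lemma rat_ext_self: "g \<in> rat_ext g"
  using rat_extI[of 1 "[:0, 1:]" g] by (simp add: of_int_hom.map_poly_pCons_hom)

text \<open>This trace is an integer combination of power sums of the conjugates of
  \<open>g\<close>, and these are rational by the coefficients of the minimal polynomial.\<close>

lemma sum_conjugates_Rats:
  assumes g: "algebraic g"
  shows "(\<Sum>s | ipoly (min_int_poly g) s = 0. ipoly f s) \<in> \<rat>"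
proof -
  define p where "p = min_int_poly g"
  define G where "G = {s. ipoly p s = 0}"
  note p = min_int_poly[OF g, folded p_def]
  have fin: "finite G" unfolding G_def using p(2) by (intro poly_roots_finite) auto
  have "map_poly of_int p = smult (of_int (lead_coeff p)) (\<Prod>z\<in>G. [:-z, 1::complex:])"
    unfolding G_def p_def by (rule min_int_poly_decompose[OF g])
  then have "coeff (\<Prod>z\<in>G. [:-z, 1::complex:]) i = of_int (coeff p i) / of_int (lead_coeff p)" for i
    using p(2) by (metis (no_types, lifting) coeff_smult nonzero_mult_div_cancel_left of_int_eq_0_iff
      of_int_hom.coeff_map_poly_hom less_irrefl)
  then have "\<forall>i. coeff (\<Prod>z\<in>G. [:-z, 1::complex:]) i \<in> \<rat>" by simp
  then have pw: "(\<Sum>s\<in>G. s ^ k) \<in> \<rat>" for k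
    using Rats_coeffs_iff_power_sums[OF fin, of "\<lambda>s. s"] by simp
  have "(\<Sum>s\<in>G. ipoly f s) = (\<Sum>i\<le>degree f. of_int (coeff f i) * (\<Sum>s\<in>G. s ^ i))"
    by (simp add: poly_altdef sum_distrib_left) (rule sum.swap)
  also have "\<dots> \<in> \<rat>" by (rule Rats_sum) (use pw in \<open>auto intro: Rats_mult\<close>)
  finally show ?thesis by (simp add: G_def p_def)
qed

text \<open>The power sums of the images of \<open>z\<close> are traces of f^k divided by d^k, hence
  rational, and Newton's identities lead back to the coefficients.\<close>

lemma embed_charpoly_Rats:
  assumes g: "algebraic g" and z: "z \<in> rat_ext g"
  shows "coeff (\<Prod>s | ipoly (min_int_poly g) s = 0. [:- embed g s z, 1:]) i \<in> \<rat>"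
proof -
  define p where "p = min_int_poly g"
  define G where "G = {s. ipoly p s = 0}"
  note p = min_int_poly[OF g, folded p_def]
  have fin: "finite G" unfolding G_def using p(2) by (intro poly_roots_finite) auto
  obtain f d where x: "d \<noteq> 0" "z = ipoly f g / of_int d" by (rule rat_extE[OF z])
  have "(\<Sum>s\<in>G. embed g s z ^ k) \<in> \<rat>" for k
  proof -
    have "(\<Sum>s\<in>G. embed g s z ^ k) = (\<Sum>s\<in>G. ipoly (f ^ k) s / of_int d ^ k)"
      by (intro sum.cong refl) (use x embed_eq[OF g _ x(1)] in 
        \<open>auto simp: G_def p_def power_divide of_int_poly_hom.hom_power\<close>)
    also have "\<dots> = (\<Sum>s\<in>G. ipoly (f ^ k) s) / of_int (d ^ k)" by (simp add: sum_divide_distrib)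
    also have "\<dots> \<in> \<rat>" using sum_conjugates_Rats[OF g, of "f ^ k"] by (auto simp: G_def p_def intro: Rats_divide)
    finally show ?thesis .
  qed
  then show ?thesis using Rats_coeffs_iff_power_sums[OF fin, of "\<lambda>s. embed g s z"] by (simp add: G_def p_def)
qed

text \<open>Only the inverse needs an argument. The polynomial with the roots
  \<open>embed g s x\<close> has rational coefficients and vanishes at \<open>x\<close>; it does not
  vanish at 0, since f(s) = 0 would give f(g) = 0 by conjugation. Solving for its constant term
  writes 1/x as a polynomial in \<open>x\<close>.\<close>

lemma subfield_rat_ext:
  assumes g: "algebraic g"
  shows "subfield (rat_ext g)"
  unfolding subfield_def
proof (intro conjI ballI)
  show "1 \<in> rat_ext g" using rat_ext_of_int[of 1] by simp
  fix x y assume xy: "x \<in> rat_ext g" "y \<in> rat_ext g"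
  show "x - y \<in> rat_ext g" "x * y \<in> rat_ext g" using rat_ext_ring(1,2)[OF xy] by auto
  show "inverse x \<in> rat_ext g"
  proof (cases "x = 0")
    case True then show ?thesis using rat_ext_of_int[of 0] by simp
  next
    case False
    define p where "p = min_int_poly g"
    define G where "G = {s. ipoly p s = 0}"
    note p = min_int_poly[OF g, folded p_def]
    have fin: "finite G" unfolding G_def using p(2) by (intro poly_roots_finite) auto
    have gG: "g \<in> G" using p(3) by (simp add: G_def)
    obtain f d where x: "d \<noteq> 0" "x = ipoly f g / of_int d" by (rule rat_extE[OF xy(1)])
    have xg: "embed g g x = x" using embed_eq[OF g p(3)[unfolded p_def] x(1)] x(2) by simp
    have nz: "embed g s x \<noteq> 0" if "s \<in> G" for s
    proof
      assume "embed g s x = 0"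
      then have "ipoly f s = 0" using embed_eq[OF g _ x(1), of s f] that x by (simp add: G_def p_def)
      moreover have "min_int_poly s = p" "algebraic s" using min_int_poly_conjugate[OF g] that by (auto simp: G_def p_def)
      ultimately have "ipoly f g = 0" using ipoly_conjugate[of s g f] p(3) by simp
      then show False using False x by simp
    qed
    define h where "h = (\<Prod>s\<in>G. [:- embed g s x, 1:])"
    have "coeff h i \<in> \<rat>" for i unfolding h_def G_def p_def by (rule embed_charpoly_Rats[OF g xy(1)])
    then obtain e q where e: "e \<noteq> 0" "smult (of_int e) h = map_poly of_int q" by (rule Rats_coeffs_scale)
    have "poly h x = 0" using gG fin xg by (auto simp: h_def poly_prod prod_zero_iff intro!: bexI[of _ g])
    then have q0: "ipoly q x = 0" by (simp add: e(2)[symmetric])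
    have "poly h 0 \<noteq> 0" using nz fin by (auto simp: h_def poly_prod prod_zero_iff)
    then have "ipoly q 0 \<noteq> 0" using e(1) by (simp add: e(2)[symmetric])
    obtain c q' where q: "q = pCons c q'" by (cases q)
    have c: "c \<noteq> 0" using \<open>ipoly q 0 \<noteq> 0\<close> by (simp add: q of_int_hom.map_poly_pCons_hom)
    have "of_int c + x * ipoly q' x = 0" using q0 by (simp add: q of_int_hom.map_poly_pCons_hom)
    then have inv: "inverse x = ipoly (- q') x * (1 / of_int c)"
      using c False by (simp add: field_simps of_int_poly_hom.hom_uminus eq_neg_iff_add_eq_0)
    have "ipoly r x \<in> rat_ext g" for r
    proof (induction r)
      case 0 show ?case using rat_ext_of_int[of 0] by simp
    next
      case (pCons a r)
      have "of_int a - (of_int (-1) * x) * ipoly r x \<in> rat_ext g"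
        using pCons xy by (intro rat_ext_ring rat_ext_of_int)
      then show ?case by (simp add: of_int_hom.map_poly_pCons_hom)
    qed
    moreover have "1 / of_int c \<in> rat_ext g" using rat_extI[OF c, of 1 g] by simp
    ultimately show ?thesis unfolding inv by (intro rat_ext_ring)
  qed
qed

lemma rat_ext_least:
  assumes F: "subfield F" "g \<in> F" shows "rat_ext g \<subseteq> F"
proof
  fix x assume "x \<in> rat_ext g"
  then obtain f d where x: "d \<noteq> 0" "x = ipoly f g / of_int d" by (rule rat_extE)
  show "x \<in> F" unfolding x
    by (intro subfieldD(8)[OF F(1)] subfield_poly[OF F(1)] F) (auto intro: subfield_of_int[OF F(1)])
qed

text \<open>
  The minimal polynomial of \<open>y\<close> over the field generated by \<open>g = x + c y\<close> divides both the integer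
  minimal polynomial of \<open>y\<close> and \<open>p(g - c T)\<close>; by the choice of \<open>c\<close> these share only the root \<open>y\<close>.
\<close>
lemma primitive_element:
  assumes x: "algebraic x" and y: "algebraic y"
  obtains g where "algebraic g" "x \<in> rat_ext g" "y \<in> rat_ext g"
proof -
  define p where "p = min_int_poly x"
  define q where "q = min_int_poly y"
  note p = min_int_poly[OF x, folded p_def]
  note q = min_int_poly[OF y, folded q_def]
  have fp: "finite {z. ipoly p z = 0}" using p(2) by (intro poly_roots_finite) auto
  have fq: "finite {z. ipoly q z = 0}" using q(2) by (intro poly_roots_finite) auto
  \<comment> \<open>The values of \<open>c\<close> to avoid: the quotient equals c exactly when x' +
    c y' = x + c y for some conjugates with y' different from y.\<close>
  define B where "B = (\<lambda>(x', y'). (x' - x) / (y - y')) ` ({z. ipoly p z = 0} \<times> {z. ipoly q z = 0})"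
  have "finite B" unfolding B_def using fp fq by auto
  moreover have "infinite (range (of_int :: int \<Rightarrow> complex))"
    using infinite_UNIV_char_0[where 'a = int] by (simp add: finite_image_iff inj_on_def)
  ultimately obtain c :: int where c: "of_int c \<notin> B" by (metis finite_subset image_subset_iff)
  define g where "g = x + of_int c * y"
  have g: "algebraic g" unfolding g_def by (rule algebraic_add_int_multiple[OF x y])
  define F where "F = rat_ext g"
  have F: "subfield F" unfolding F_def by (rule subfield_rat_ext[OF g])
  note cF = subfield_of_int[OF F]
  define h where "h = pcompose (map_poly of_int p) [:g, - of_int c:]"
  have hF: "coeff h i \<in> F" for i
    unfolding h_def by (rule subfield_coeff_pcompose[OF F])
     (auto simp: coeff_pCons cF F_def rat_ext_self subfieldD(2)[OF F, unfolded F_def] 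
        subfieldD(3)[OF F, unfolded F_def] split: nat.splits intro: cF[unfolded F_def] subfieldD(3)[OF F, unfolded F_def])
  have hy: "poly h y = 0" using p(3) by (simp add: h_def poly_pcompose g_def mult.commute)
  define P where "P = (\<lambda>f. f \<noteq> 0 \<and> (\<forall>i. coeff f i \<in> F) \<and> poly f y = 0)"
  have "P (map_poly of_int q)" using q(2,3) cF by (auto simp: P_def)
  then obtain m where m: "P m" "\<And>f. P f \<Longrightarrow> degree m \<le> degree f"
    using arg_min_nat_lemma[of P _ degree] by blast
  have mdvd: "m dvd f" if "\<And>i. coeff f i \<in> F" "poly f y = 0" for f
    using m that by (intro minimal_poly_dvd[OF F, of m y f]) (auto simp: P_def)
  have mq: "m dvd map_poly of_int q" using q(3) cF by (intro mdvd) auto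
  have mh: "m dvd h" using hF hy by (intro mdvd) auto
  have roots: "z = y" if "poly m z = 0" for z
  proof (rule ccontr)
    assume ne: "z \<noteq> y"
    have "ipoly q z = 0" using mq that by (auto elim!: dvdE)
    moreover have "poly h z = 0" using mh that by (auto elim!: dvdE)
    then have "ipoly p (g - of_int c * z) = 0" by (simp add: h_def poly_pcompose mult.commute)
    ultimately have "((g - of_int c * z) - x) / (y - z) \<in> B" by (force simp: B_def)
    moreover have "((g - of_int c * z) - x) / (y - z) = of_int c" using ne by (simp add: g_def field_simps)
    ultimately show False using c by simp
  qed
  obtain m' where m': "m = [:- y, 1:] * m'" using m(1) by (auto simp: P_def poly_eq_0_iff_dvd elim: dvdE)
  \<comment> \<open>A further root of \<open>m\<close> would again be \<open>y\<close>, giving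
    \<open>q\<close> a double root. So \<open>m\<close> is a constant multiple of T - y, and
    \<open>y\<close> is a quotient of its coefficients.\<close>
  have "degree m' = 0"
  proof (rule ccontr)
    assume "degree m' \<noteq> 0"
    then obtain z where z: "poly m' z = 0" using fundamental_theorem_of_algebra[of m'] constant_degree[of m'] by auto
    then have "z = y" using roots[of z] by (simp add: m')
    then obtain m'' where m'': "m' = [:- y, 1:] * m''" using z by (auto simp: poly_eq_0_iff_dvd elim: dvdE)
    obtain k where k: "map_poly of_int q = m * k" using mq by (elim dvdE)
    define r where "r = m'' * k"
    have r: "map_poly of_int q = [:- y, 1:] * ([:- y, 1:] * r)"
      unfolding k m' m'' r_def by (simp only: mult.assoc)
    have "poly (map_poly of_int q) y = 0 \<and> poly (pderiv (map_poly of_int q)) y = 0"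
      unfolding r by (simp add: pderiv_mult del: mult_pCons_left)
    then show False using rsquarefree_min_int_poly[OF y] unfolding rsquarefree_roots q_def by blast
  qed
  then obtain b where b: "m' = [:b:]" by (metis degree_eq_zeroE)
  have "b \<noteq> 0" using m(1) by (auto simp: P_def m' b)
  moreover have "coeff m 0 \<in> F" "coeff m 1 \<in> F" using m(1) by (auto simp: P_def)
  then have "- (y * b) \<in> F" "b \<in> F" by (auto simp: m' b mult.commute)
  then have "(- (y * b)) / (- b) \<in> F" by (rule subfieldD(8)[OF F _ subfieldD(3)[OF F]])
  ultimately have yF: "y \<in> F" by simp
  have "g - of_int c * y \<in> F" 
    by (intro subfieldD(5,6)[OF F] cF yF) (simp add: F_def rat_ext_self)
  then have "x \<in> F" by (simp add: g_def)
  then show thesis using that[OF g] yF by (simp add: F_def)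
qed

lemma finite_primitive_element:
  assumes "finite A" "\<And>a. a \<in> A \<Longrightarrow> algebraic a"
  shows "\<exists>g. algebraic g \<and> A \<subseteq> rat_ext g"
  using assms
proof (induction rule: finite_induct)
  case empty then show ?case using algebraic_int_1 by blast
next
  case (insert a A)
  then obtain g where g: "algebraic g" "A \<subseteq> rat_ext g" by auto
  obtain g' where g': "algebraic g'" "g \<in> rat_ext g'" "a \<in> rat_ext g'"
    using primitive_element[OF g(1), of a] insert.prems by auto
  have "rat_ext g \<subseteq> rat_ext g'" by (rule rat_ext_least[OF subfield_rat_ext[OF g'(1)] g'(2)])
  then show ?case using g g' by blast
qed

section \<open>Embeddings of a number field\<close>

lemma smult_cancel: "(a :: 'a :: idom) \<noteq> 0 \<Longrightarrow> smult a p = smult a q \<Longrightarrow> p = q"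
  by (simp add: poly_eq_iff)

text \<open>
  The functions \<open>E s\<close>, for \<open>s \<in> G\<close>, are the embeddings of \<open>K\<close>; they are constrained only on \<open>K\<close>.
\<close>
locale number_field =
  fixes K G :: "complex set" and E :: "complex \<Rightarrow> complex \<Rightarrow> complex"
  assumes K: "subfield K" and fin: "finite G" and id: "\<exists>s\<in>G. \<forall>x\<in>K. E s x = x"
    and E_diff: "s \<in> G \<Longrightarrow> x \<in> K \<Longrightarrow> y \<in> K \<Longrightarrow> E s (x - y) = E s x - E s y"
    and E_mult: "s \<in> G \<Longrightarrow> x \<in> K \<Longrightarrow> y \<in> K \<Longrightarrow> E s (x * y) = E s x * E s y"
    and E_1: "s \<in> G \<Longrightarrow> E s 1 = 1"
    and charpoly_Rats: "x \<in> K \<Longrightarrow> coeff (\<Prod>s\<in>G. [:- E s x, 1:]) i \<in> \<rat>"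

lemma ex_number_field:
  assumes "finite A" "\<And>a. a \<in> A \<Longrightarrow> algebraic a"
  obtains K G E where "number_field K G E" "A \<subseteq> K"
proof -
  obtain g where g: "algebraic g" "A \<subseteq> rat_ext g" using finite_primitive_element[OF assms] by blast
  define G where "G = {s. ipoly (min_int_poly g) s = 0}"
  have "number_field (rat_ext g) G (embed g)"
  proof
    show "subfield (rat_ext g)" by (rule subfield_rat_ext[OF g(1)])
    show "finite G" unfolding G_def using min_int_poly(2)[OF g(1)] by (intro poly_roots_finite) auto
    have gr: "ipoly (min_int_poly g) g = 0" by (rule min_int_poly(3)[OF g(1)])
    have "embed g g x = x" if "x \<in> rat_ext g" for x
      using that embed_eq[OF g(1) gr] by (auto elim!: rat_extE)
    then show "\<exists>s\<in>G. \<forall>x\<in>rat_ext g. embed g s x = x" using gr by (intro bexI[of _ g]) (auto simp: G_def)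
    fix s assume "s \<in> G"
    then have s: "ipoly (min_int_poly g) s = 0" by (simp add: G_def)
    show "embed g s 1 = 1" using embed_eq[OF g(1) s, of 1 1] by simp
    fix x y assume xy: "x \<in> rat_ext g" "y \<in> rat_ext g"
    show "embed g s (x - y) = embed g s x - embed g s y" "embed g s (x * y) = embed g s x * embed g s y"
      using rat_ext_ring(3,4)[OF xy g(1) s] by auto
  next
    show "coeff (\<Prod>s\<in>G. [:- embed g s x, 1:]) i \<in> \<rat>" if "x \<in> rat_ext g" for x i
      unfolding G_def by (rule embed_charpoly_Rats[OF g(1) that])
  qed
  then show thesis using that g by blast
qed

context number_field begin

lemmas KD = subfieldD[OF K]

lemma G_ne: "G \<noteq> {}" using id by blast
lemma card_pos: "card G > 0" using fin G_ne by (simp add: card_gt_0_iff)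

lemma E_0: "s \<in> G \<Longrightarrow> E s 0 = 0"
  using E_diff[of s 0 0] KD(2) by simp
lemma E_uminus: "s \<in> G \<Longrightarrow> x \<in> K \<Longrightarrow> E s (- x) = - E s x"
  using E_diff[of s 0 x] KD(2) E_0 by simp
lemma E_add: "s \<in> G \<Longrightarrow> x \<in> K \<Longrightarrow> y \<in> K \<Longrightarrow> E s (x + y) = E s x + E s y"
  using E_diff[of s x "- y"] KD(3) E_uminus by simp
lemma E_power: "s \<in> G \<Longrightarrow> x \<in> K \<Longrightarrow> E s (x ^ n) = E s x ^ n"
  by (induction n) (auto simp: E_1 E_mult subfield_power[OF K])
lemma E_of_nat: "s \<in> G \<Longrightarrow> E s (of_nat n) = of_nat n"
  by (induction n) (auto simp: E_0 E_1 E_add KD subfield_of_nat[OF K])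
lemma E_of_int: "s \<in> G \<Longrightarrow> E s (of_int n) = of_int n"
  by (cases n rule: int_cases2) (auto simp: E_of_nat E_uminus subfield_of_nat[OF K])
lemma E_sum: "s \<in> G \<Longrightarrow> (\<And>i. i \<in> A \<Longrightarrow> f i \<in> K) \<Longrightarrow> E s (sum f A) = (\<Sum>i\<in>A. E s (f i))"
  by (induction A rule: infinite_finite_induct) (auto simp: E_0 E_add subfield_sum[OF K])
lemma E_prod: "s \<in> G \<Longrightarrow> (\<And>i. i \<in> A \<Longrightarrow> f i \<in> K) \<Longrightarrow> E s (prod f A) = (\<Prod>i\<in>A. E s (f i))"
  by (induction A rule: infinite_finite_induct) (auto simp: E_1 E_mult subfield_prod[OF K])
lemma E_poly: "s \<in> G \<Longrightarrow> x \<in> K \<Longrightarrow> E s (ipoly p x) = ipoly p (E s x)"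
  by (simp add: poly_altdef E_sum KD subfield_of_int[OF K] subfield_power[OF K] E_mult E_of_int E_power)
lemma E_nonzero: assumes "s \<in> G" "x \<in> K" "x \<noteq> 0" shows "E s x \<noteq> 0"
  using E_mult[OF assms(1,2) KD(7)[OF assms(2)]] assms E_1 by auto
lemma E_divide: assumes "s \<in> G" "x \<in> K" "y \<in> K" "y \<noteq> 0" shows "E s (x / y) = E s x / E s y"
  using E_mult[OF assms(1) KD(8)[OF assms(2,3)] assms(3)] E_nonzero[OF assms(1,3,4)] assms(4)
  by (simp add: field_simps)

lemma algebraic_K: 
  assumes "x \<in> K" shows "algebraic x"
proof -
  obtain e q where e: "e \<noteq> 0" "smult (of_int e) (\<Prod>s\<in>G. [:- E s x, 1:]) = map_poly of_int q"
    using charpoly_Rats[OF assms] by (rule Rats_coeffs_scale)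
  obtain s where "s \<in> G" "E s x = x" using id assms by blast
  then have "poly (\<Prod>s\<in>G. [:- E s x, 1:]) x = 0" using fin by (auto simp: poly_prod prod_zero_iff intro!: bexI[of _ s])
  then have "ipoly q x = 0" by (simp flip: e(2))
  moreover have "(\<Prod>s\<in>G. [:- E s x, 1:]) \<noteq> 0" using fin by (auto simp: prod_zero_iff)
  then have "map_poly of_int q \<noteq> (0 :: complex poly)" using e(1) by (simp flip: e(2))
  ultimately show ?thesis by (intro algebraicI[of "map_poly of_int q"]) auto
qed

text \<open>All roots of the characteristic polynomial are images of \<open>x\<close> and hence
  conjugates of it, so \<open>power_of_irreducible\<close> applies; degrees and leading coefficients
  fix the exponent and the scalar.\<close>

lemma charpoly_eq_power:
  assumes x: "x \<in> K"
  defines "p \<equiv> min_int_poly x"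
  obtains e where "e * degree p = card G"
    "smult (of_int (lead_coeff p ^ e)) (\<Prod>s\<in>G. [:- E s x, 1:]) = map_poly of_int (p ^ e)"
proof -
  define H where "H = (\<Prod>s\<in>G. [:- E s x, 1:])"
  note ax = algebraic_K[OF x]
  note p = min_int_poly[OF ax, folded p_def]
  obtain d q where d: "d \<noteq> 0" "smult (of_int d) H = map_poly of_int q"
    using charpoly_Rats[OF x] unfolding H_def by (rule Rats_coeffs_scale)
  have H: "degree H = card G"
    unfolding H_def by (simp add: degree_prod_eq_sum_degree)
  have H2: "lead_coeff H = 1" unfolding H_def by (subst lead_coeff_prod) simp
  have "H \<noteq> 0" using H2 by auto
  then have "map_poly of_int q \<noteq> (0 :: complex poly)" using d(1) by (simp flip: d(2))
  then have q0: "q \<noteq> 0" by auto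
  have "ipoly p z = 0" if "ipoly q z = 0" for z
  proof -
    have "poly H z = 0" using that d(1) by (simp flip: d(2))
    then obtain s where s: "s \<in> G" "z = E s x" using fin by (auto simp: H_def poly_prod prod_zero_iff)
    have "ipoly p z = E s (ipoly p x)" using s x by (simp add: E_poly)
    then show ?thesis using p(3) s by (simp add: E_0)
  qed
  then obtain c e where ce: "q = smult c (p ^ e)"
    using power_of_irreducible[OF ax q0] unfolding p_def by blast
  have c: "c \<noteq> 0" using q0 ce by auto
  have eq: "smult (of_int d) H = smult (of_int c) (map_poly of_int (p ^ e))"
    unfolding d(2) ce by (simp only: of_int_hom.map_poly_hom_smult)
  have "degree (smult (of_int d) H) = degree (smult (of_int c :: complex) (map_poly of_int (p ^ e)))" by (simp only: eq)
  then have "degree (p ^ e) = card G" using c d(1) H by simp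
  moreover have "p \<noteq> 0" using p(2) by (metis leading_coeff_0_iff less_irrefl)
  ultimately have deg: "e * degree p = card G" by (simp add: degree_power_eq mult.commute)
  have "lead_coeff (smult (of_int d) H) = lead_coeff (smult (of_int c :: complex) (map_poly of_int (p ^ e)))" by (simp only: eq)
  then have "of_int d * lead_coeff H = of_int c * lead_coeff (map_poly of_int (p ^ e) :: complex poly)"
    by (simp only: lead_coeff_smult)
  moreover have "lead_coeff (map_poly of_int (p ^ e) :: complex poly) = of_int (lead_coeff (p ^ e))" by simp
  ultimately have lc: "of_int d = (of_int c * of_int (lead_coeff p ^ e) :: complex)"
    by (simp only: H2 lead_coeff_power mult_1_right)
  have "smult (of_int c) (smult (of_int (lead_coeff p ^ e)) H) = smult (of_int c) (map_poly of_int (p ^ e))"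
    unfolding eq[symmetric] lc by simp
  moreover have "(of_int c :: complex) \<noteq> 0" using c by simp
  ultimately have "smult (of_int (lead_coeff p ^ e)) H = map_poly of_int (p ^ e)"
    by (rule smult_cancel[rotated])
  then show thesis using that deg unfolding H_def by blast
qed

end

text \<open>By Bezout the content is an integer combination of the coefficients.\<close>

lemma algebraic_int_mult_content:
  fixes u :: complex
  assumes "\<And>i. algebraic_int (u * of_int (coeff p i))"
  shows "algebraic_int (u * of_int (Polynomial.content p))"
proof -
  have "algebraic_int (u * of_int (gcd_list cs))" if "\<And>c. c \<in> set cs \<Longrightarrow> algebraic_int (u * of_int c)" for cs :: "int list"
    using that
  proof (induction cs)
    case (Cons c cs)
    obtain a b where ab: "a * c + b * gcd_list cs = gcd c (gcd_list cs)" using bezout_int by blast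
    have 1: "algebraic_int (of_int a * (u * of_int c))"
      by (rule algebraic_int_mult[OF algebraic_int_of_int]) (rule Cons.prems, simp)
    have 2: "algebraic_int (of_int b * (u * of_int (gcd_list cs)))"
      by (rule algebraic_int_mult[OF algebraic_int_of_int]) (rule Cons.IH, simp add: Cons.prems)
    have "gcd_list (c # cs) = a * c + b * gcd_list cs" unfolding ab by simp
    then have "u * of_int (gcd_list (c # cs)) = u * of_int (a * c + b * gcd_list cs)" by (simp only:)
    also have "\<dots> = of_int a * (u * of_int c) + of_int b * (u * of_int (gcd_list cs))" by (simp add: algebra_simps)
    finally show ?case using algebraic_int_plus[OF 1 2] by (simp only:)
  qed simp
  moreover have "algebraic_int (u * of_int c)" if "c \<in> set (coeffs p)" for c
    using that assms by (auto simp: coeffs_def split: if_splits)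
  ultimately show ?thesis unfolding content_def by blast
qed

lemma content_power_eq_1: "Polynomial.content (p :: int poly) = 1 \<Longrightarrow> Polynomial.content (p ^ n) = 1"
  by (induction n) (simp_all add: content_mult)

lemma prod_const_poly: "(\<Prod>s\<in>S. [:f s:]) = [:\<Prod>s\<in>S. f s:: 'a :: comm_semiring_1:]"
  by (induction S rule: infinite_finite_induct) (simp_all add: one_pCons mult.commute)

context number_field begin

text \<open>
  The contribution of the finite places of \<open>K\<close> to the height: \<open>den x\<close> times the characteristic
  polynomial of \<open>x\<close> is a primitive integer polynomial.
\<close>
definition den :: "complex \<Rightarrow> real" where
  "den x = real_of_int (lead_coeff (min_int_poly x)) ^ (card G div degree (min_int_poly x))"

lemma den_ge_1:
  assumes "x \<in> K" shows "den x \<ge> 1"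
  using min_int_poly(2)[OF algebraic_K[OF assms]] unfolding den_def by (intro one_le_power) simp

lemma den_charpoly:
  assumes x: "x \<in> K"
  shows "smult (of_real (den x)) (\<Prod>s\<in>G. [:- E s x, 1:]) =
    map_poly of_int (min_int_poly x ^ (card G div degree (min_int_poly x)))"
    and "card G div degree (min_int_poly x) * degree (min_int_poly x) = card G"
proof -
  obtain e where e: "e * degree (min_int_poly x) = card G"
    "smult (of_int (lead_coeff (min_int_poly x) ^ e)) (\<Prod>s\<in>G. [:- E s x, 1:]) = map_poly of_int (min_int_poly x ^ e)"
    using charpoly_eq_power[OF x] by blast
  have "card G div degree (min_int_poly x) = e"
    using e(1) min_int_poly(5)[OF algebraic_K[OF x]] by (metis nonzero_mult_div_cancel_right less_irrefl)
  then show "smult (of_real (den x)) (\<Prod>s\<in>G. [:- E s x, 1:]) =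
    map_poly of_int (min_int_poly x ^ (card G div degree (min_int_poly x)))"
    "card G div degree (min_int_poly x) * degree (min_int_poly x) = card G"
    using e by (simp_all add: den_def)
qed

text \<open>Comparing the multisets of roots in \<open>den_charpoly\<close>, each conjugate of
  \<open>x\<close> occurs equally often among the embeddings. Heights of different elements of
  \<open>K\<close> thereby become sums over the same set \<open>G\<close>.\<close>

lemma weil_height_eq:
  assumes x: "x \<in> K"
  shows "real (card G) * weil_height x = ln (den x) + (\<Sum>s\<in>G. ln (max 1 (cmod (E s x))))"
proof -
  define p where "p = min_int_poly x"
  define e where "e = card G div degree p"
  define Z where "Z = {z. ipoly p z = 0}"
  define \<phi> where "\<phi> = (\<lambda>z. ln (max 1 (cmod z)))"
  note ax = algebraic_K[OF x]
  note p = min_int_poly[OF ax, folded p_def]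
  note e = den_charpoly[OF x, folded p_def, folded e_def]
  have finZ: "finite Z" unfolding Z_def using p(2) by (intro poly_roots_finite) auto
  have dec: "map_poly of_int p = smult (of_int (lead_coeff p)) (\<Prod>z\<in>Z. [:-z, 1::complex:])"
    unfolding p_def Z_def by (rule min_int_poly_decompose[OF ax])
  have nz: "(of_int (lead_coeff p) :: complex) \<noteq> 0" using p(2) by (metis of_int_eq_0_iff less_irrefl)
  have pr: "proots (\<Prod>s\<in>A. [:- w s, 1::complex:]) = (\<Sum>s\<in>A. {#w s#})" for w :: "complex \<Rightarrow> complex" and A
    by (subst proots_prod) auto
  have sm: "sum_mset (image_mset \<phi> (\<Sum>s\<in>A. {#w s#})) = (\<Sum>s\<in>A. \<phi> (w s))" for w :: "complex \<Rightarrow> complex" and A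
    by (induction A rule: infinite_finite_induct) auto
  have rp: "sum_mset (image_mset \<phi> (repeat_mset k M)) = real k * sum_mset (image_mset \<phi> M)" for k M
  proof (induction k)
    case (Suc k)
    have "repeat_mset (Suc k) M = M + repeat_mset k M" by simp
    then show ?case
      by (simp only: image_mset_union sum_mset.union Suc of_nat_Suc distrib_right mult_1_left)
  qed simp
  have "den x > 0" using den_ge_1[OF x] by simp
  then have "proots (\<Prod>s\<in>G. [:- E s x, 1:]) = proots (smult (of_real (den x)) (\<Prod>s\<in>G. [:- E s x, 1:]))" by simp
  also have "\<dots> = proots ((map_poly of_int p :: complex poly) ^ e)"
    unfolding e(1) by (simp add: of_int_poly_hom.hom_power)
  also have "\<dots> = repeat_mset e (proots (map_poly of_int p))" by (rule proots_power)
  also have "proots (map_poly of_int p :: complex poly) = (\<Sum>z\<in>Z. {#z#})"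
    by (subst dec) (simp only: proots_smult[OF nz] pr)
  finally have "(\<Sum>s\<in>G. {#E s x#}) = repeat_mset e (\<Sum>z\<in>Z. {#z#})" by (simp only: pr)
  then have "sum_mset (image_mset \<phi> (\<Sum>s\<in>G. {#E s x#})) = sum_mset (image_mset \<phi> (repeat_mset e (\<Sum>z\<in>Z. {#z#})))" by (simp only:)
  then have S: "(\<Sum>s\<in>G. \<phi> (E s x)) = real e * (\<Sum>z\<in>Z. \<phi> z)"
    by (simp only: sm rp)
  have "real (card G) = real e * real (degree p)" using e(2) by (metis of_nat_mult)
  moreover have "weil_height x = (ln (of_int (lead_coeff p)) + (\<Sum>z\<in>Z. \<phi> z)) / real (degree p)"
    by (simp add: weil_height_def p_def Z_def \<phi>_def Let_def)
  ultimately have "real (card G) * weil_height x = real e * (ln (of_int (lead_coeff p)) + (\<Sum>z\<in>Z. \<phi> z))"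
    using p(5) by simp
  also have "\<dots> = real e * ln (of_int (lead_coeff p)) + real e * (\<Sum>z\<in>Z. \<phi> z)" by (rule distrib_left)
  also have "real e * ln (of_int (lead_coeff p)) = ln (den x)"
    unfolding den_def using p(2) by (simp add: p_def e_def ln_realpow)
  finally show ?thesis using S by (simp add: \<phi>_def)
qed

text \<open>By primitivity, \<open>c / den y\<close> is an algebraic integer with a rational power.\<close>
lemma den_le_norm:
  assumes y: "y \<in> K" and c: "c \<noteq> 0" "n > 0" "c ^ n \<in> \<rat>"
    and int: "\<And>i. algebraic_int (coeff (smult c (\<Prod>s\<in>G. [:- E s y, 1:])) i)"
  shows "den y \<le> cmod c"
proof -
  define P where "P = min_int_poly y ^ (card G div degree (min_int_poly y))"
  define u where "u = c / of_real (den y)"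
  have d: "den y \<ge> 1" by (rule den_ge_1[OF y])
  have cP: "Polynomial.content P = 1"
    unfolding P_def by (rule content_power_eq_1[OF min_int_poly(4)[OF algebraic_K[OF y]]])
  have "smult u (map_poly of_int P) = smult u (smult (of_real (den y)) (\<Prod>s\<in>G. [:- E s y, 1:]))"
    unfolding P_def den_charpoly(1)[OF y] by simp
  also have "\<dots> = smult c (\<Prod>s\<in>G. [:- E s y, 1:])" using d by (simp add: u_def)
  finally have eqP: "smult u (map_poly of_int P) = smult c (\<Prod>s\<in>G. [:- E s y, 1:])" .
  have "algebraic_int (u * of_int (coeff P i))" for i
    using int[of i] unfolding eqP[symmetric] by simp
  then have "algebraic_int (u * of_int (Polynomial.content P))" by (rule algebraic_int_mult_content)
  then have u: "algebraic_int u" by (simp add: cP)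
  \<comment> \<open>A rational algebraic integer is an integer, and being nonzero it has modulus at
    least 1. The exponent admits irrational \<open>c\<close>, such as the n-th root in
    \<open>weil_height_power_ge\<close>.\<close>
  have "u ^ n = c ^ n / of_int (lead_coeff (min_int_poly y) ^ (card G div degree (min_int_poly y) * n))"
    by (simp add: u_def den_def power_divide power_mult)
  also have "\<dots> \<in> \<rat>" using c(3) by (intro Rats_divide) auto
  finally have "u ^ n \<in> \<int>" using rational_algebraic_int_is_int[OF algebraic_int_power[OF u]] by blast
  then obtain k where k: "u ^ n = of_int k" by (auto elim: Ints_cases)
  have "u \<noteq> 0" using c(1) d by (simp add: u_def)
  then have "k \<noteq> 0" using k by auto
  have "cmod u ^ n = \<bar>real_of_int k\<bar>" using k by (metis norm_of_int norm_power)
  also have "\<dots> \<ge> 1" using \<open>k \<noteq> 0\<close> by linarith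
  finally have "cmod u \<ge> 1" using c(2) by (metis norm_ge_zero not_le power_less_one_iff)
  then show ?thesis using d by (simp add: u_def norm_divide field_simps)
qed

lemma algebraic_int_den_mult_prod:
  assumes x: "x \<in> K" and S: "S \<subseteq> G"
  shows "algebraic_int (of_real (den x) * (\<Prod>s\<in>S. E s x))"
proof -
  have "algebraic_int (coeff (smult (of_real (den x)) (\<Prod>s\<in>G. [:- E s x, 1:])) i)" for i
    unfolding den_charpoly(1)[OF x] by simp
  then have "algebraic_int (coeff (smult (of_real (den x)) (\<Prod>s\<in>S. [:- E s x, 1:])) 0)"
    by (rule algebraic_int_coeffs_subproduct[OF fin _ S])
  then have "algebraic_int (of_real (den x) * (\<Prod>s\<in>S. - E s x))" by (simp add: coeff_0_prod_poly)
  also have "of_real (den x) * (\<Prod>s\<in>S. - E s x) = (-1) ^ card S * (of_real (den x) * (\<Prod>s\<in>S. E s x))"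
    by (subst prod_uminus) simp
  finally have X: "algebraic_int ((-1) ^ card S * (of_real (den x) * (\<Prod>s\<in>S. E s x)))" .
  have "algebraic_int ((-1) ^ card S * ((-1) ^ card S * (of_real (den x) * (\<Prod>s\<in>S. E s x))))"
    by (rule algebraic_int_mult[OF algebraic_int_power X]) simp
  then show ?thesis by (simp flip: mult.assoc power_mult_distrib)
qed

text \<open>The product is cut into \<open>d\<close> layers: layer l contains each embedding with l
  < k s once, so one factor \<open>den x\<close> makes it integral.\<close>

lemma algebraic_int_den_power_mult_prod:
  assumes x: "x \<in> K" and k: "\<And>s. s \<in> G \<Longrightarrow> k s \<le> d"
  shows "algebraic_int (of_real (den x) ^ d * (\<Prod>s\<in>G. E s x ^ k s))"
proof -
  have "(\<Prod>l<d. \<Prod>s\<in>{s\<in>G. l < k s}. E s x) = (\<Prod>l<d. \<Prod>s\<in>G. if l < k s then E s x else 1)"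
    by (intro prod.cong[OF refl] prod.inter_filter[OF fin])
  also have "\<dots> = (\<Prod>s\<in>G. \<Prod>l<d. if l < k s then E s x else 1)" by (rule prod.swap)
  also have "\<dots> = (\<Prod>s\<in>G. E s x ^ k s)"
  proof (intro prod.cong refl)
    fix s assume s: "s \<in> G"
    have "(\<Prod>l<d. if l < k s then E s x else 1) = (\<Prod>l\<in>{l\<in>{..<d}. l < k s}. E s x)"
      by (rule prod.inter_filter[symmetric]) simp
    also have "{l\<in>{..<d}. l < k s} = {..<k s}" using k[OF s] by auto
    finally show "(\<Prod>l<d. if l < k s then E s x else 1) = E s x ^ k s" by simp
  qed
  finally have "of_real (den x) ^ d * (\<Prod>s\<in>G. E s x ^ k s) = (\<Prod>l<d. of_real (den x) * (\<Prod>s\<in>{s\<in>G. l < k s}. E s x))"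
    by (simp add: prod.distrib)
  also have "algebraic_int \<dots>"
    by (intro algebraic_int_prod algebraic_int_den_mult_prod x) auto
  finally show ?thesis .
qed

text \<open>At the embeddings this is elementary. For the denominators, let b be the n-th root of
  \<open>den (x ^ n)\<close>: b times a product of distinct images of \<open>x\<close> is integral
  because its n-th power is. So b times the characteristic polynomial of \<open>x\<close> is
  integral, and \<open>den x\<close> is at most b.\<close>

lemma weil_height_power_ge:
  assumes x: "x \<in> K" and n: "n > 0"
  shows "weil_height (x ^ n) \<ge> real n * weil_height x"
proof -
  define y where "y = x ^ n"
  have y: "y \<in> K" unfolding y_def by (rule subfield_power[OF K x])
  define b where "b = root n (den y)"
  have d: "den y \<ge> 1" by (rule den_ge_1[OF y])
  have b: "b ^ n = den y" "b > 0" using d n by (auto simp: b_def real_root_pow_pos2)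
  have "den x \<le> cmod (of_real b)"
  proof (rule den_le_norm[OF x _ n])
    show "of_real b \<noteq> (0::complex)" using b by simp
    have "of_real b ^ n = (of_int (lead_coeff (min_int_poly y) ^ (card G div degree (min_int_poly y))) :: complex)"
      unfolding of_real_power[symmetric] b by (simp add: den_def)
    then show "(of_real b :: complex) ^ n \<in> \<rat>" by simp
    fix i
    have v: "algebraic_int (of_real b * (\<Prod>s\<in>S. - E s x))" if "S \<subseteq> G" for S
    proof (rule algebraic_int_root)
      have "(of_real b * (\<Prod>s\<in>S. - E s x)) ^ n = of_real (den y) * (\<Prod>s\<in>S. (- E s x) ^ n)"
        by (simp add: power_mult_distrib prod_power_distrib b(1) flip: of_real_power)
      also have "(\<Prod>s\<in>S. (- E s x) ^ n) = (\<Prod>s\<in>S. (-1) ^ n * E s y)"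
        using that x by (intro prod.cong refl) (auto simp: y_def E_power power_minus' power_minus[of "E _ x"])
      finally show "poly (monom 1 n) (of_real b * (\<Prod>s\<in>S. - E s x)) = ((-1) ^ n) ^ card S * (of_real (den y) * (\<Prod>s\<in>S. E s y))"
        by (simp add: poly_monom prod.distrib)
      show "algebraic_int (((-1) ^ n) ^ card S * (of_real (den y) * (\<Prod>s\<in>S. E s y)))"
        by (intro algebraic_int_mult[OF algebraic_int_power[OF algebraic_int_power]] algebraic_int_den_mult_prod y that) auto
    qed (use n in \<open>auto simp: degree_monom_eq\<close>)
    \<comment> \<open>Expanding over subsets of \<open>G\<close> shows each coefficient as a sum of
      products covered by \<open>v\<close>.\<close>
    have "(\<Prod>s\<in>G. [:- E s x, 1:]) = (\<Prod>s\<in>G. [:- E s x:] + [:0, 1:])" by simp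
    also have "\<dots> = (\<Sum>S\<in>Pow G. (\<Prod>s\<in>S. [:- E s x:]) * (\<Prod>s\<in>G-S. [:0, 1:]))" by (rule prod_add[OF fin])
    also have "\<dots> = (\<Sum>S\<in>Pow G. smult (\<Prod>s\<in>S. - E s x) (monom 1 (card (G - S))))"
      by (intro sum.cong refl) (simp add: monom_altdef prod_const_poly del: prod_uminus)
    finally have "coeff (smult (of_real b) (\<Prod>s\<in>G. [:- E s x, 1:])) i =
       (\<Sum>S\<in>Pow G. (of_real b * (\<Prod>s\<in>S. - E s x)) * coeff (monom 1 (card (G - S))) i)"
      by (simp add: coeff_sum sum_distrib_left mult.assoc del: prod_uminus)
    also have "algebraic_int \<dots>"
      by (intro algebraic_int_sum algebraic_int_mult v) (auto simp: coeff_monom)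
    finally show "algebraic_int (coeff (smult (of_real b) (\<Prod>s\<in>G. [:- E s x, 1:])) i)" .
  qed
  then have "den x \<le> b" using b by simp
  then have "den x ^ n \<le> den y" using den_ge_1[OF x] b by (metis power_mono zero_le_one order_trans)
  then have "ln (den x ^ n) \<le> ln (den y)" using den_ge_1[OF x] d by (intro ln_mono) auto
  then have 1: "real n * ln (den x) \<le> ln (den y)" using den_ge_1[OF x] by (simp add: ln_realpow)
  have 2: "ln (max 1 (cmod (E s y))) \<ge> real n * ln (max 1 (cmod (E s x)))" if s: "s \<in> G" for s
  proof -
    have "max 1 (cmod (E s x)) ^ n \<le> max 1 (cmod (E s y))"
      using s x by (auto simp: y_def E_power norm_power max_def one_le_power)
    then have "ln (max 1 (cmod (E s x)) ^ n) \<le> ln (max 1 (cmod (E s y)))"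
      by (intro ln_mono) auto
    then show ?thesis by (simp add: ln_realpow)
  qed
  have "real (card G) * (real n * weil_height x) = real n * (real (card G) * weil_height x)" by simp
  also have "\<dots> = real n * ln (den x) + (\<Sum>s\<in>G. real n * ln (max 1 (cmod (E s x))))"
    unfolding weil_height_eq[OF x] by (simp add: distrib_left sum_distrib_left)
  also have "\<dots> \<le> ln (den y) + (\<Sum>s\<in>G. ln (max 1 (cmod (E s y))))"
    using 1 2 by (intro add_mono sum_mono) auto
  also have "\<dots> = real (card G) * weil_height y" by (rule weil_height_eq[OF y, symmetric])
  finally show ?thesis using card_pos by (simp add: y_def)
qed

lemma weil_height_nonneg: assumes x: "x \<in> K" shows "weil_height x \<ge> 0"
proof -
  have "real (card G) * weil_height x \<ge> 0"
    unfolding weil_height_eq[OF x] using den_ge_1[OF x] by (intro add_nonneg_nonneg sum_nonneg) auto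
  then show ?thesis using card_pos by (simp add: zero_le_mult_iff)
qed

end

section \<open>Heights of quotients of polynomials\<close>

text \<open>Numerator and denominator of a fraction share \<open>M\<close> and \<open>ex\<close> and
  differ only in the coefficients, so that one degree bound per variable serves both.\<close>

definition mpoly_eval :: "'m set \<Rightarrow> 'i set \<Rightarrow> ('m \<Rightarrow> 'i \<Rightarrow> nat) \<Rightarrow> ('m \<Rightarrow> int) \<Rightarrow> ('i \<Rightarrow> complex) \<Rightarrow> complex" where
  "mpoly_eval M I ex a x = (\<Sum>m\<in>M. of_int (a m) * (\<Prod>i\<in>I. x i ^ ex m i))"

context number_field begin

lemma mpoly_eval_K: "(\<And>i. i \<in> I \<Longrightarrow> x i \<in> K) \<Longrightarrow> mpoly_eval M I ex a x \<in> K"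
  unfolding mpoly_eval_def
  by (intro subfield_sum[OF K] KD(6) subfield_of_int[OF K] subfield_prod[OF K] subfield_power[OF K])

lemma E_mpoly_eval:
  "s \<in> G \<Longrightarrow> (\<And>i. i \<in> I \<Longrightarrow> x i \<in> K) \<Longrightarrow> E s (mpoly_eval M I ex a x) = mpoly_eval M I ex a (\<lambda>i. E s (x i))"
  unfolding mpoly_eval_def
  by (simp add: E_sum E_mult E_of_int E_prod E_power KD(6) subfield_of_int[OF K] subfield_prod[OF K] subfield_power[OF K])

text \<open>The product formula in disguise. The factor c, built from powers of the
  \<open>den (x i)\<close> and the norm of the denominator \<open>v\<close>, makes the
  characteristic polynomial of \<open>y\<close> integral, so \<open>den y\<close> is at most its
  modulus. The norm of \<open>v\<close> is then used up at the embeddings, where |v| max(1, |y|) =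
  max(|v|, |u|).\<close>

lemma weil_height_fraction_le:
  fixes x :: "'i \<Rightarrow> complex" and M :: "'m set"
  assumes I: "finite I" and M: "finite M" and x: "\<And>i. i \<in> I \<Longrightarrow> x i \<in> K"
    and ex: "\<And>m i. m \<in> M \<Longrightarrow> i \<in> I \<Longrightarrow> ex m i \<le> d i"
    and a: "(\<Sum>m\<in>M. \<bar>real_of_int (a m)\<bar>) \<le> L" and b: "(\<Sum>m\<in>M. \<bar>real_of_int (b m)\<bar>) \<le> L" and L: "L > 0"
    and nz: "mpoly_eval M I ex b x \<noteq> 0"
  shows "weil_height (mpoly_eval M I ex a x / mpoly_eval M I ex b x) \<le> (\<Sum>i\<in>I. real (d i) * weil_height (x i)) + ln L"
proof -
  define u where "u = mpoly_eval M I ex a x"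
  define v where "v = mpoly_eval M I ex b x"
  have u: "u \<in> K" and v: "v \<in> K" unfolding u_def v_def by (rule mpoly_eval_K, rule x, assumption)+
  have v0: "v \<noteq> 0" using nz by (simp add: v_def)
  define y where "y = u / v"
  have y: "y \<in> K" unfolding y_def by (rule KD(8)[OF u v])
  define mon where "mon = (\<lambda>s m. \<Prod>i\<in>I. E s (x i) ^ ex m i)"
  have Eu: "E s u = (\<Sum>m\<in>M. of_int (a m) * mon s m)" and Ev: "E s v = (\<Sum>m\<in>M. of_int (b m) * mon s m)" if "s \<in> G" for s
    using E_mpoly_eval[OF that x] unfolding u_def v_def by (simp_all add: mpoly_eval_def mon_def)
  have Ev0: "E s v \<noteq> 0" if "s \<in> G" for s by (rule E_nonzero[OF that v v0])
  define A where "A = (\<Prod>i\<in>I. den (x i) ^ d i)"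
  have A: "A \<ge> 1" unfolding A_def using den_ge_1[OF x] by (intro prod_ge_1 one_le_power)
  have dp: "den (x i) > 0" if "i \<in> I" for i using den_ge_1[OF x[OF that]] by linarith
  define c where "c = of_real A * (\<Prod>s\<in>G. E s v)"
  have "den y \<le> cmod c"
  proof (rule den_le_norm[OF y])
    show "c \<noteq> 0" using A Ev0 fin by (auto simp: c_def)
    show "(1::nat) > 0" by simp
    have "(of_real A :: complex) = of_int (\<Prod>i\<in>I. (lead_coeff (min_int_poly (x i)) ^ (card G div degree (min_int_poly (x i)))) ^ d i)"
      by (simp add: A_def den_def)
    then have "(of_real A :: complex) \<in> \<rat>" by (metis Rats_of_int)
    moreover have "(\<Prod>s\<in>G. - E s v) \<in> \<rat>" using charpoly_Rats[OF v, of 0] by (simp add: coeff_0_prod_poly del: prod_uminus)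
    then have "(-1) ^ card G * (\<Prod>s\<in>G. E s v) \<in> \<rat>" unfolding prod_uminus .
    then have "(-1) ^ card G * ((-1) ^ card G * (\<Prod>s\<in>G. E s v)) \<in> \<rat>" by (rule Rats_mult[rotated]) simp
    then have "(\<Prod>s\<in>G. E s v) \<in> \<rat>" by (simp flip: mult.assoc power_mult_distrib)
    ultimately show "c ^ 1 \<in> \<rat>" unfolding c_def power_one_right by (rule Rats_mult)
    fix j
    \<comment> \<open>Distributing the norm of \<open>v\<close> over the factors turns each into one
      that is linear in the monomials of \<open>u\<close> and \<open>v\<close>.\<close>
    have "smult c (\<Prod>s\<in>G. [:- E s y, 1:]) = smult (of_real A) (\<Prod>s\<in>G. smult (E s v) [:- E s y, 1:])"
      by (simp add: c_def prod_smult del: smult_pCons)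
    also have "(\<Prod>s\<in>G. smult (E s v) [:- E s y, 1:]) = (\<Prod>s\<in>G. \<Sum>m\<in>M. smult (mon s m) (map_poly of_int [:- a m, b m:]))"
    proof (intro prod.cong refl)
      fix s assume s: "s \<in> G"
      have "smult (E s v) [:- E s y, 1:] = [:- E s u, E s v:]"
        using Ev0[OF s] E_divide[OF s u v v0] by (simp add: y_def)
      also have "\<dots> = (\<Sum>m\<in>M. smult (mon s m) (map_poly of_int [:- a m, b m:]))"
        unfolding Eu[OF s] Ev[OF s]
        by (rule poly_eqI) (auto simp: coeff_sum coeff_pCons sum_negf mult.commute of_int_hom.map_poly_pCons_hom split: nat.splits)
      finally show "smult (E s v) [:- E s y, 1:] = (\<Sum>m\<in>M. smult (mon s m) (map_poly of_int [:- a m, b m:]))" .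
    qed
    also have "\<dots> = (\<Sum>g\<in>G \<rightarrow>\<^sub>E M. \<Prod>s\<in>G. smult (mon s (g s)) (map_poly of_int [:- a (g s), b (g s):]))"
      by (rule prod_sum_PiE[OF fin M])
    also have "\<dots> = (\<Sum>g\<in>G \<rightarrow>\<^sub>E M. smult (\<Prod>s\<in>G. mon s (g s)) (map_poly of_int (\<Prod>s\<in>G. [:- a (g s), b (g s):])))"
      by (simp only: prod_smult of_int_poly_hom.hom_prod)
    finally have "coeff (smult c (\<Prod>s\<in>G. [:- E s y, 1:])) j = 
        (\<Sum>g\<in>G \<rightarrow>\<^sub>E M. (of_real A * (\<Prod>s\<in>G. mon s (g s))) * of_int (coeff (\<Prod>s\<in>G. [:- a (g s), b (g s):]) j))"
      by (simp add: coeff_sum sum_distrib_left mult.assoc)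
    also have "algebraic_int \<dots>"
    proof (intro algebraic_int_sum)
      fix g assume g: "g \<in> G \<rightarrow>\<^sub>E M"
      \<comment> \<open>Here every embedding s has chosen a monomial \<open>g s\<close>, so the
        image of \<open>x i\<close> under s occurs with an exponent of at most
        \<open>d i\<close>.\<close>
      have "of_real A * (\<Prod>s\<in>G. mon s (g s)) = (\<Prod>i\<in>I. of_real (den (x i)) ^ d i * (\<Prod>s\<in>G. E s (x i) ^ ex (g s) i))"
        unfolding mon_def A_def prod.distrib by (subst prod.swap) simp
      also have "algebraic_int \<dots>"
        by (intro algebraic_int_prod algebraic_int_den_power_mult_prod x ex) (use g in auto)
      finally show "algebraic_int ((of_real A * (\<Prod>s\<in>G. mon s (g s))) * of_int (coeff (\<Prod>s\<in>G. [:- a (g s), b (g s):]) j))"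
        by (rule algebraic_int_mult) simp
    qed
    finally show "algebraic_int (coeff (smult c (\<Prod>s\<in>G. [:- E s y, 1:])) j)" .
  qed
  also have "cmod c = A * (\<Prod>s\<in>G. cmod (E s v))" using A by (simp add: c_def norm_mult prod_norm)
  finally have "ln (den y) \<le> ln (A * (\<Prod>s\<in>G. cmod (E s v)))" using den_ge_1[OF y] by (intro ln_mono) auto
  also have "\<dots> = ln A + (\<Sum>s\<in>G. ln (cmod (E s v)))"
    using A Ev0 by (subst ln_mult) (auto intro!: prod_pos simp: ln_prod fin)
  finally have lnden: "ln (den y) \<le> ln A + (\<Sum>s\<in>G. ln (cmod (E s v)))" .
  define B where "B = (\<lambda>s. \<Prod>i\<in>I. max 1 (cmod (E s (x i))) ^ d i)"
  have B1: "B s \<ge> 1" for s unfolding B_def by (intro prod_ge_1 one_le_power) auto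
  have mon: "cmod (mon s m) \<le> B s" if "m \<in> M" for s m
  proof -
    have "cmod (E s (x i)) ^ ex m i \<le> max 1 (cmod (E s (x i))) ^ d i" if "i \<in> I" for i
    proof -
      have "cmod (E s (x i)) ^ ex m i \<le> max 1 (cmod (E s (x i))) ^ ex m i" by (intro power_mono) auto
      also have "\<dots> \<le> max 1 (cmod (E s (x i))) ^ d i" by (intro power_increasing ex \<open>m \<in> M\<close> that) auto
      finally show ?thesis .
    qed
    then show ?thesis unfolding mon_def B_def prod_norm[symmetric] norm_power by (intro prod_mono) auto
  qed
  have bound: "cmod (\<Sum>m\<in>M. of_int (f m) * mon s m) \<le> L * B s" if "(\<Sum>m\<in>M. \<bar>real_of_int (f m)\<bar>) \<le> L" for f s
  proof -
    have "cmod (\<Sum>m\<in>M. of_int (f m) * mon s m) \<le> (\<Sum>m\<in>M. \<bar>real_of_int (f m)\<bar> * B s)"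
      by (intro sum_norm_le) (auto simp: norm_mult intro: mult_left_mono mon)
    also have "\<dots> \<le> L * B s" unfolding sum_distrib_right[symmetric] using that B1[of s] by (intro mult_right_mono) auto
    finally show ?thesis .
  qed
  \<comment> \<open>The term \<open>ln (cmod (E s v))\<close> is the share of this embedding in the
    bound on \<open>den y\<close>.\<close>
  have loc: "ln (cmod (E s v)) + ln (max 1 (cmod (E s y))) \<le> ln L + (\<Sum>i\<in>I. real (d i) * ln (max 1 (cmod (E s (x i)))))" if s: "s \<in> G" for s
  proof -
    have pv: "cmod (E s v) > 0" using Ev0[OF s] by simp
    have "ln (cmod (E s v)) + ln (max 1 (cmod (E s y))) = ln (cmod (E s v) * max 1 (cmod (E s y)))"
      using pv by (subst ln_mult) auto
    also have "cmod (E s v) * max 1 (cmod (E s y)) = max (cmod (E s v)) (cmod (E s u))"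
      using pv E_divide[OF s u v v0] by (simp add: y_def norm_divide max_mult_distrib_left)
    also have "ln \<dots> \<le> ln (L * B s)"
    proof (rule ln_mono)
      show "max (cmod (E s v)) (cmod (E s u)) \<le> L * B s"
        using bound[OF a, of s] bound[OF b, of s] unfolding Eu[OF s] Ev[OF s] by (rule max.boundedI[rotated])
      show "0 < max (cmod (E s v)) (cmod (E s u))" using pv by (simp add: less_max_iff_disj)
    qed
    also have "\<dots> = ln L + (\<Sum>i\<in>I. real (d i) * ln (max 1 (cmod (E s (x i)))))"
      using L B1[of s] by (subst ln_mult) (auto simp: B_def ln_prod I ln_realpow)
    finally show ?thesis .
  qed
  have "real (card G) * weil_height y \<le> ln A + (\<Sum>s\<in>G. ln (cmod (E s v)) + ln (max 1 (cmod (E s y))))"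
    unfolding weil_height_eq[OF y] using lnden by (simp add: sum.distrib)
  also have "\<dots> \<le> ln A + (\<Sum>s\<in>G. ln L + (\<Sum>i\<in>I. real (d i) * ln (max 1 (cmod (E s (x i))))))"
    using loc by (intro add_left_mono sum_mono)
  also have "(\<Sum>s\<in>G. ln L + (\<Sum>i\<in>I. real (d i) * ln (max 1 (cmod (E s (x i))))))
      = real (card G) * ln L + (\<Sum>i\<in>I. real (d i) * (\<Sum>s\<in>G. ln (max 1 (cmod (E s (x i))))))"
    unfolding sum.distrib sum_distrib_left by (subst sum.swap) simp
  also have "ln A = (\<Sum>i\<in>I. real (d i) * ln (den (x i)))"
    unfolding A_def by (subst ln_prod) (auto simp: I ln_realpow dp less_imp_neq[OF dp, symmetric])
  also have "(\<Sum>i\<in>I. real (d i) * ln (den (x i))) + (real (card G) * ln L + (\<Sum>i\<in>I. real (d i) * (\<Sum>s\<in>G. ln (max 1 (cmod (E s (x i)))))))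
     = (\<Sum>i\<in>I. real (d i) * (ln (den (x i)) + (\<Sum>s\<in>G. ln (max 1 (cmod (E s (x i))))))) + real (card G) * ln L"
    by (simp add: distrib_left sum.distrib)
  also have "\<dots> = (\<Sum>i\<in>I. real (d i) * (real (card G) * weil_height (x i))) + real (card G) * ln L"
    using weil_height_eq[OF x] by simp
  also have "\<dots> = real (card G) * ((\<Sum>i\<in>I. real (d i) * weil_height (x i)) + ln L)"
    by (simp add: distrib_left sum_distrib_left mult_ac)
  finally show ?thesis using card_pos by (simp add: y_def u_def v_def)
qed

end

lemma weil_height_fraction_le:
  fixes x :: "'i \<Rightarrow> complex" and M :: "'m set"
  assumes "finite I" "finite M" and "\<And>i. i \<in> I \<Longrightarrow> algebraic (x i)"
    and "\<And>m i. m \<in> M \<Longrightarrow> i \<in> I \<Longrightarrow> ex m i \<le> d i"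
    and "(\<Sum>m\<in>M. \<bar>real_of_int (a m)\<bar>) \<le> L" "(\<Sum>m\<in>M. \<bar>real_of_int (b m)\<bar>) \<le> L" "L > 0"
    and "mpoly_eval M I ex b x \<noteq> 0"
  shows "weil_height (mpoly_eval M I ex a x / mpoly_eval M I ex b x) \<le> (\<Sum>i\<in>I. real (d i) * weil_height (x i)) + ln L"
proof -
  obtain K G E where K: "number_field K G E" "x ` I \<subseteq> K"
    using assms(1,3) by (elim ex_number_field[of "x ` I", rotated 2]) auto
  then have "x i \<in> K" if "i \<in> I" for i using that by auto
  from number_field.weil_height_fraction_le[OF K(1) assms(1,2) this assms(4-8)] show ?thesis .
qed

lemma algebraic_arith:
  fixes x y :: complex
  assumes "algebraic x"
  shows "algebraic y \<Longrightarrow> algebraic (x * y)" "algebraic y \<Longrightarrow> algebraic (x / y)"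
    "algebraic y \<Longrightarrow> algebraic (x - y)" "algebraic (x ^ n)" "algebraic (inverse x)" "algebraic (- x)"
proof -
  obtain K G E where NF: "number_field K G E" "{x} \<subseteq> K"
    using assms by (elim ex_number_field[of "{x}", rotated 2]) auto
  interpret number_field K G E by (rule NF(1))
  have x: "x \<in> K" using NF(2) by auto
  show "algebraic (x ^ n)" "algebraic (inverse x)" "algebraic (- x)"
    by (intro algebraic_K subfield_power[OF K x] KD(7)[OF x] KD(3)[OF x])+
next
  assume "algebraic y"
  then obtain K G E where NF: "number_field K G E" "{x, y} \<subseteq> K"
    using assms by (elim ex_number_field[of "{x, y}", rotated 2]) auto
  interpret number_field K G E by (rule NF(1))
  have x: "x \<in> K" and y: "y \<in> K" using NF(2) by auto
  show "algebraic (x * y)" "algebraic (x / y)" "algebraic (x - y)"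
    by (intro algebraic_K KD(6)[OF x y] KD(8)[OF x y] KD(5)[OF x y])+
qed

section \<open>Height inequalities for products, inverses and powers\<close>

lemma weil_height_nonneg: "algebraic x \<Longrightarrow> weil_height x \<ge> 0"
  by (rule ex_number_field[of "{x}"]) (auto intro: number_field.weil_height_nonneg)

lemma weil_height_power_ge:
  assumes "algebraic x" shows "weil_height (x ^ n) \<ge> real n * weil_height x"
proof (cases "n = 0")
  case True then show ?thesis using weil_height_nonneg[OF algebraic_int_imp_algebraic[OF algebraic_int_1]] by simp
next
  case False
  obtain K G E where NF: "number_field K G E" "{x} \<subseteq> K"
    using assms by (elim ex_number_field[of "{x}", rotated 2]) auto
  show ?thesis using number_field.weil_height_power_ge[OF NF(1), of x n] NF(2) False by simp
qed

text \<open>The fraction x y / 1 over the two monomials 1 and x y, indexed by 0 and 1, with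
  coefficient sum 1. Negation and inversion follow the same pattern in one variable.\<close>

lemma weil_height_mult_le:
  assumes "algebraic x" "algebraic y"
  shows "weil_height (x * y) \<le> weil_height x + weil_height y"
proof -
  let ?x = "\<lambda>i::nat. if i = 0 then x else y"
  let ?h = "weil_height (mpoly_eval {0,1::nat} {0,1} (\<lambda>m i. m) int ?x / mpoly_eval {0,1} {0,1} (\<lambda>m i. m) (\<lambda>m. 1 - int m) ?x)"
  have "?h \<le> (\<Sum>i\<in>{0,1}. real 1 * weil_height (?x i)) + ln 1"
    by (rule weil_height_fraction_le) (use assms in \<open>auto simp: mpoly_eval_def\<close>)
  then show ?thesis by (simp add: mpoly_eval_def)
qed

lemma weil_height_1: "weil_height 1 = 0"
proof -
  have "weil_height (mpoly_eval {0::nat} ({}::nat set) (\<lambda>m i. m) (\<lambda>_. 1) (\<lambda>_. 1) / mpoly_eval {0::nat} ({}::nat set) (\<lambda>m i. m) (\<lambda>_. 1) (\<lambda>_. 1))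
     \<le> (\<Sum>i\<in>({}::nat set). real 1 * weil_height 1) + ln 1"
    by (rule weil_height_fraction_le) (auto simp: mpoly_eval_def)
  then show ?thesis using weil_height_nonneg[OF algebraic_int_imp_algebraic[OF algebraic_int_1]]
    by (simp add: mpoly_eval_def)
qed

lemma weil_height_uminus_le:
  assumes "algebraic x"
  shows "weil_height (- x) \<le> weil_height x"
proof -
  have "weil_height (mpoly_eval {0,1::nat} {0::nat} (\<lambda>m i. m) (\<lambda>m. - int m) (\<lambda>_. x) / mpoly_eval {0,1} {0::nat} (\<lambda>m i. m) (\<lambda>m. 1 - int m) (\<lambda>_. x))
     \<le> (\<Sum>i\<in>{0::nat}. real 1 * weil_height x) + ln 1"
    by (rule weil_height_fraction_le) (use assms in \<open>auto simp: mpoly_eval_def\<close>)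
  then show ?thesis by (simp add: mpoly_eval_def)
qed

lemma weil_height_inverse_le:
  assumes "algebraic x"
  shows "weil_height (inverse x) \<le> weil_height x"
proof (cases "x = 0")
  case False
  have "weil_height (mpoly_eval {0,1::nat} {0::nat} (\<lambda>m i. m) (\<lambda>m. 1 - int m) (\<lambda>_. x) / mpoly_eval {0,1} {0::nat} (\<lambda>m i. m) int (\<lambda>_. x))
     \<le> (\<Sum>i\<in>{0::nat}. real 1 * weil_height x) + ln 1"
    by (rule weil_height_fraction_le) (use assms False in \<open>auto simp: mpoly_eval_def\<close>)
  then show ?thesis by (simp add: mpoly_eval_def inverse_eq_divide)
qed simp

text \<open>Indices 0 and 1 stand for p and q, index 2 for the constant monomial. Each variable has
  degree 1, and two coefficients of modulus 1 cost log 2.\<close>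

lemma weil_height_diff_quotient_le:
  assumes "algebraic p" "algebraic q" "q \<noteq> 1"
  shows "weil_height ((1 - p) / (q - 1)) \<le> weil_height p + weil_height q + ln 2"
proof -
  let ?x = "\<lambda>i::nat. if i = 0 then p else q" and ?ex = "\<lambda>m i::nat. if m = i then 1 else 0 :: nat"
  have "weil_height (mpoly_eval {0,1,2::nat} {0,1} ?ex (\<lambda>m. if m = 0 then -1 else if m = 1 then 0 else 1) ?x /
      mpoly_eval {0,1,2::nat} {0,1} ?ex (\<lambda>m. if m = 0 then 0 else if m = 1 then 1 else -1) ?x)
     \<le> (\<Sum>i\<in>{0,1}. real 1 * weil_height (?x i)) + ln 2"
    by (rule weil_height_fraction_le) (use assms in \<open>auto simp: mpoly_eval_def\<close>)
  then show ?thesis by (simp add: mpoly_eval_def)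
qed

lemma weil_height_power_le:
  assumes "algebraic x"
  shows "weil_height (x ^ n) \<le> real n * weil_height x"
proof (induction n)
  case (Suc n)
  then show ?case using weil_height_mult_le[OF assms algebraic_arith(4)[OF assms, of n]] by (simp add: algebra_simps)
qed (simp add: weil_height_1)

lemma weil_height_power_quotient_le:
  assumes "algebraic z" and nz: "z \<noteq> 0"
  shows "weil_height (z ^ m / z ^ l) \<le> \<bar>real m - real l\<bar> * weil_height z"
proof -
  show ?thesis
  proof (cases "l \<le> m")
    case True
    then have "z ^ m / z ^ l = z ^ (m - l)" using nz by (simp add: power_diff)
    then show ?thesis using weil_height_power_le[OF assms(1), of "m - l"] True by (simp add: of_nat_diff)
  next
    case l: False
    then have "z ^ m / z ^ l = inverse (z ^ (l - m))" using nz by (simp add: power_diff)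
    then have "weil_height (z ^ m / z ^ l) \<le> weil_height (z ^ (l - m))" 
      using weil_height_inverse_le[OF algebraic_arith(4)[OF assms(1)]] by simp
    also have "\<dots> \<le> real (l - m) * weil_height z" by (rule weil_height_power_le[OF assms(1)])
    finally show ?thesis using l by (simp add: of_nat_diff)
  qed
qed

section \<open>Pade approximation to powers of a linear form\<close>

text \<open>
  The denominators of the Pade approximants to \<open>(1 - x)\<^bsup>L + K\<^esup>\<close>, with numerator degree \<open>L\<close> and
  denominator degree \<open>M\<close>. In closed form, the coefficient of \<open>x\<^sup>j\<close> is
  \<open>(L + M - j choose L) * (K - 1 + j choose j)\<close>.
\<close>
fun pade :: "nat \<Rightarrow> nat \<Rightarrow> nat \<Rightarrow> int poly" where
  "pade L 0 K = 1"
| "pade L (Suc M) 0 = [:int ((L + Suc M) choose L):]"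
| "pade L (Suc M) (Suc K) = pade L (Suc M) K + pCons 0 (pade L M (Suc K))"

lemma coeff_1_minus_X_power: "coeff ([:1, -1::int:] ^ n) s = (-1) ^ s * int (n choose s)"
proof (cases "s \<le> n")
  case True then show ?thesis by (simp add: coeff_linear_poly_power)
next
  case False
  then have "degree ([:1, -1::int:] ^ n) < s" by (simp add: degree_power_eq)
  then show ?thesis using False by (simp add: coeff_eq_0 binomial_eq_0)
qed

text \<open>The recursion of \<open>pade\<close> is made to fit Pascal's rule in both binomial
  factors. The upper argument of \<open>gchoose\<close> turns negative for s > L + M, where the
  coefficients need not vanish.\<close>

lemma coeff_pade_mult:
  "real_of_int (coeff (pade L M K * [:1, -1:] ^ (L + K)) s) =
     (-1) ^ s * ((real (L + M) - real s) gchoose M) * real ((L + K + M) choose s)"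
proof (induction L M K arbitrary: s rule: pade.induct)
  case (1 L K)
  show ?case by (simp add: coeff_1_minus_X_power)
next
  case (2 L M)
  \<comment> \<open>For s \<le> L, nested subsets are counted in two ways. For larger s both sides
    vanish, the right one first through \<open>gchoose\<close> and beyond L + M + 1 through the
    binomial coefficient.\<close>
  have "real ((L + Suc M) choose L) * real (L choose s) =
    ((real (L + Suc M) - real s) gchoose Suc M) * real ((L + Suc M) choose s)"
  proof (cases "s \<le> L")
    case True
    have "(L + Suc M choose L) * (L choose s) = (L + Suc M choose s) * (L + Suc M - s choose (L - s))"
      using True by (intro choose_mult) auto
    also have "L + Suc M - s choose (L - s) = (L + Suc M - s choose Suc M)"
      using binomial_symmetric[of "L - s" "L + Suc M - s"] True by (simp del: binomial_Suc_Suc)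
    finally have "real (L + Suc M choose L) * real (L choose s) = 
        real (L + Suc M choose s) * real (L + Suc M - s choose Suc M)"
      by (metis of_nat_mult)
    moreover have "real (L + Suc M) - real s = real (L + Suc M - s)" using True by simp
    ultimately show ?thesis by (simp only: binomial_gbinomial mult.commute)
  next
    case False
    show ?thesis
    proof (cases "s \<le> L + Suc M")
      case True
      then have "real (L + Suc M) - real s = real (L + Suc M - s)" by simp
      then have "(real (L + Suc M) - real s) gchoose Suc M = real ((L + Suc M - s) choose Suc M)"
        by (simp only: binomial_gbinomial)
      also have "(L + Suc M - s) choose Suc M = 0" using False by (intro binomial_eq_0) auto
      finally show ?thesis using False by (simp add: binomial_eq_0)
    next
      case False
      then show ?thesis by (simp add: binomial_eq_0 del: binomial_Suc_Suc)
    qed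
  qed
  then show ?case by (simp add: coeff_1_minus_X_power mult_ac del: binomial_Suc_Suc)
next
  case (3 L M K)
  have A: "pade L (Suc M) (Suc K) * [:1, -1:] ^ (L + Suc K) =
        [:1, -1:] * (pade L (Suc M) K * [:1, -1:] ^ (L + K)) + pCons 0 (pade L M (Suc K) * [:1, -1:] ^ (L + Suc K))"
    by (simp add: algebra_simps)
  show ?case
  proof (cases s)
    case 0 
    then show ?thesis using 3(1)[of 0] unfolding A by simp
  next
    case (Suc r)
    define n where "n = L + K + Suc M"
    define a where "a = real (L + M) - real r"
    have "real_of_int (coeff (pade L (Suc M) (Suc K) * [:1, -1:] ^ (L + Suc K)) s) =
      real_of_int (coeff (pade L (Suc M) K * [:1, -1:] ^ (L + K)) (Suc r))
      - real_of_int (coeff (pade L (Suc M) K * [:1, -1:] ^ (L + K)) r)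
      + real_of_int (coeff (pade L M (Suc K) * [:1, -1:] ^ (L + Suc K)) r)"
      unfolding A Suc by simp
    also have "\<dots> = (-1) ^ Suc r * (a gchoose Suc M) * real (n choose Suc r)
       - (-1) ^ r * ((a + 1) gchoose Suc M) * real (n choose r)
       + (-1) ^ r * (a gchoose M) * real (n choose r)"
      unfolding 3 n_def a_def by (simp add: algebra_simps)
    \<comment> \<open>Pascal's rule on a + 1 cancels the third term; Pascal's rule on n then merges
      the other two.\<close>
    also have "\<dots> = (-1) ^ Suc r * (a gchoose Suc M) * real (Suc n choose Suc r)"
      unfolding gbinomial_Suc_Suc by (simp add: algebra_simps)
    finally show ?thesis by (simp add: Suc n_def a_def algebra_simps)
  qed
qed

lemma degree_pade: "degree (pade L M K) \<le> M"
  by (induction L M K rule: pade.induct) (auto intro!: degree_add_le simp: degree_pCons_eq_if)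

lemma coeff_pade_nonneg: "coeff (pade L M K) i \<ge> 0"
  by (induction L M K arbitrary: i rule: pade.induct) (auto simp: coeff_pCons split: nat.splits)

lemma coeff_pade_pos: "K > 0 \<Longrightarrow> coeff (pade L M K) M > 0"
  by (induction L M K rule: pade.induct) (auto intro!: add_nonneg_pos coeff_pade_nonneg)

text \<open>With nonnegative coefficients the value at 1 is the sum of their moduli. The recursion
  adds two values, each bounded by half of the claimed power of 2.\<close>

lemma poly_pade_1: "poly (pade L M K) 1 \<le> 2 ^ (L + M + K)"
proof (induction L M K rule: pade.induct)
  case (2 L M)
  have "(L + Suc M) choose L \<le> 2 ^ (L + Suc M)" by (rule binomial_le_pow2)
  then have "int ((L + Suc M) choose L) \<le> 2 ^ (L + Suc M)" by (metis of_nat_le_iff of_nat_numeral of_nat_power)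
  then show ?case by simp
qed auto

lemma sum_abs_coeff_mult_1_minus_X_power:
  fixes p :: "int poly"
  assumes "degree p \<le> n"
  shows "(\<Sum>i\<le>n+k. \<bar>coeff (p * [:1, -1:] ^ k) i\<bar>) \<le> 2 ^ k * (\<Sum>i\<le>n. \<bar>coeff p i\<bar>)"
proof (induction k)
  case (Suc k)
  define q where "q = p * [:1, -1:] ^ k"
  have dq: "degree q \<le> n + k"
    unfolding q_def using assms degree_mult_le[of p "[:1, -1:] ^ k"] by (simp add: degree_power_eq)
  have q: "p * [:1, -1:] ^ Suc k = [:1, -1:] * q" by (simp add: q_def algebra_simps)
  have "(\<Sum>i\<le>n + Suc k. \<bar>coeff ([:1, -1:] * q) i\<bar>) \<le> (\<Sum>i\<le>Suc (n + k). \<bar>coeff q i\<bar> + \<bar>coeff (pCons 0 q) i\<bar>)"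
    unfolding add_Suc_right by (intro sum_mono) (auto simp: coeff_pCons split: nat.splits)
  also have "\<dots> = (\<Sum>i\<le>Suc (n + k). \<bar>coeff q i\<bar>) + (\<Sum>i\<le>Suc (n + k). \<bar>coeff (pCons 0 q) i\<bar>)"
    by (rule sum.distrib)
  also have "(\<Sum>i\<le>Suc (n + k). \<bar>coeff (pCons 0 q) i\<bar>) = (\<Sum>i\<le>n + k. \<bar>coeff q i\<bar>)"
    by (subst sum.atMost_Suc_shift) simp
  also have "(\<Sum>i\<le>Suc (n + k). \<bar>coeff q i\<bar>) = (\<Sum>i\<le>n + k. \<bar>coeff q i\<bar>)"
    using dq by (simp add: coeff_eq_0)
  finally show ?case using Suc q by (simp add: q_def)
qed simp

text \<open>
  The approximation property is read off from \<open>coeff_pade_mult\<close>: the generalized binomial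
  coefficient vanishes for \<open>L < s \<le> L + M\<close>.
\<close>
lemma pade_approximant:
  assumes LM: "L + M = 2 * N - 1" "L + K = 2 * N" "L \<le> N" "M \<le> N" "N > 0"
  obtains P R :: "int poly" where
    "monom 1 (2*N) * P + pade L M K * [:1, -1:] ^ (2*N) = R"
    "degree P \<le> N" "degree R \<le> L" "coeff R L \<noteq> 0"
    "(\<Sum>i\<le>N. \<bar>coeff (pade L M K) i\<bar>) \<le> 2 ^ (5*N)"
    "(\<Sum>i\<le>N. \<bar>coeff P i\<bar>) \<le> 2 ^ (5*N)" "(\<Sum>i\<le>N. \<bar>coeff R i\<bar>) \<le> 2 ^ (5*N)"
proof -
  define Q where "Q = pade L M K"
  define A where "A = Q * [:1, -1:] ^ (2*N)"
  \<comment> \<open>\<open>R\<close> and - x^(2N) \<open>P\<close> are the parts of \<open>A\<close>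
    of degree at most L and at least 2N. As L + M = 2N - 1, the vanishing coefficients fill exactly
    the range between.\<close>
  define R where "R = (\<Sum>i\<le>L. monom (coeff A i) i)"
  define P where "P = - (\<Sum>i\<le>N. monom (coeff A (2*N+i)) i)"
  have dQ: "degree Q \<le> M" unfolding Q_def by (rule degree_pade)
  have dA: "degree A \<le> 3 * N"
    unfolding A_def using dQ LM degree_mult_le[of Q "[:1, -1:] ^ (2*N)"] by (simp add: degree_power_eq)
  have cA: "real_of_int (coeff A s) = (-1) ^ s * ((real (L + M) - real s) gchoose M) * real ((L + K + M) choose s)" for s
    using coeff_pade_mult[of L M K s] LM by (simp add: A_def Q_def)
  have A0: "coeff A s = 0" if "L < s" "s < 2*N" for s
  proof -
    have "real (L + M) - real s = real (L + M - s)" using that LM by simp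
    then have "(real (L + M) - real s) gchoose M = real ((L + M - s) choose M)"
      by (simp only: binomial_gbinomial)
    also have "(L + M - s) choose M = 0" using that LM by (intro binomial_eq_0) auto
    finally show ?thesis using cA[of s] by simp
  qed
  have cR: "coeff R i = (if i \<le> L then coeff A i else 0)" for i
    by (simp add: R_def coeff_sum)
  have cP: "coeff P i = (if i \<le> N then - coeff A (2*N+i) else 0)" for i
    by (simp add: P_def coeff_sum)
  have sumQ: "(\<Sum>i\<le>N. \<bar>coeff Q i\<bar>) \<le> 2 ^ (3*N)"
  proof -
    have "(\<Sum>i\<le>N. \<bar>coeff Q i\<bar>) = (\<Sum>i\<le>N. coeff Q i)"
      unfolding Q_def by (simp add: coeff_pade_nonneg)
    also have "\<dots> = (\<Sum>i\<le>degree Q. coeff Q i)"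
      using dQ LM by (intro sum.mono_neutral_right) (auto simp: coeff_eq_0)
    also have "\<dots> = poly Q 1" by (simp add: poly_altdef)
    also have "\<dots> \<le> 2 ^ (L + M + K)" unfolding Q_def by (rule poly_pade_1)
    also have "\<dots> \<le> 2 ^ (3*N)" using LM by (intro power_increasing) auto
    finally show ?thesis .
  qed
  \<comment> \<open>A factor 2^(3N) comes from \<open>Q\<close> and 2^(2N) from the power of 1 -
    x.\<close>
  have sumA: "(\<Sum>i\<le>N+2*N. \<bar>coeff A i\<bar>) \<le> 2 ^ (5*N)"
  proof -
    have "(\<Sum>i\<le>N+2*N. \<bar>coeff A i\<bar>) \<le> 2 ^ (2*N) * (\<Sum>i\<le>N. \<bar>coeff Q i\<bar>)"
      unfolding A_def using dQ LM by (intro sum_abs_coeff_mult_1_minus_X_power) simp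
    also have "\<dots> \<le> 2 ^ (2*N) * 2 ^ (3*N)" using sumQ by simp
    finally show ?thesis by (simp add: power_add[symmetric])
  qed
  show thesis
  proof (rule that[of P R])
    show "monom 1 (2*N) * P + pade L M K * [:1, -1:] ^ (2*N) = R"
    proof (rule poly_eqI)
      fix i
      have "coeff A i = 0" if "i > 3 * N" using that dA by (simp add: coeff_eq_0)
      then show "coeff (monom 1 (2*N) * P + pade L M K * [:1, -1:] ^ (2*N)) i = coeff R i"
        unfolding Q_def[symmetric] A_def[symmetric]
        using A0[of i] LM by (auto simp: coeff_monom_mult cP cR)
    qed
    show "degree P \<le> N" "degree R \<le> L" by (auto intro!: degree_le simp: cP cR)
    have "real (L + M) - real L = real M" by simp
    moreover have "real M gchoose M = 1" using binomial_gbinomial[of M M, where 'a = real] by simp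
    ultimately have "real_of_int (coeff R L) = (-1) ^ L * real ((L + K + M) choose L)"
      by (simp only: cR cA order_refl if_True mult_1_right)
    then have "real_of_int (coeff R L) \<noteq> 0" by simp
    then show "coeff R L \<noteq> 0" by simp
    show "(\<Sum>i\<le>N. \<bar>coeff (pade L M K) i\<bar>) \<le> 2 ^ (5*N)"
      using sumQ unfolding Q_def by (rule order_trans) (rule power_increasing, auto)
    have "(\<Sum>i\<le>N. \<bar>coeff R i\<bar>) \<le> (\<Sum>i\<le>N. \<bar>coeff A i\<bar>)" by (intro sum_mono) (simp add: cR)
    also have "\<dots> \<le> (\<Sum>i\<le>N+2*N. \<bar>coeff A i\<bar>)" by (intro sum_mono2) auto
    finally show "(\<Sum>i\<le>N. \<bar>coeff R i\<bar>) \<le> 2 ^ (5*N)" using sumA by simp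
    have "(\<Sum>i\<le>N. \<bar>coeff P i\<bar>) = (\<Sum>i\<in>(+) (2*N) ` {..N}. \<bar>coeff A i\<bar>)"
      by (subst sum.reindex) (auto simp: cP)
    also have "\<dots> \<le> (\<Sum>i\<le>N+2*N. \<bar>coeff A i\<bar>)" by (intro sum_mono2) auto
    finally show "(\<Sum>i\<le>N. \<bar>coeff P i\<bar>) \<le> 2 ^ (5*N)" using sumA by simp
  qed
qed

definition pade_triple :: "nat \<Rightarrow> int poly \<Rightarrow> int poly \<Rightarrow> int poly \<Rightarrow> bool" where
  "pade_triple N P Q R \<longleftrightarrow> monom 1 (2*N) * P + Q * [:1, -1:] ^ (2*N) = R \<and>
     degree P \<le> N \<and> degree Q \<le> N \<and> degree R \<le> N \<and>
     (\<Sum>i\<le>N. \<bar>coeff P i\<bar>) \<le> 2 ^ (5*N) \<and> (\<Sum>i\<le>N. \<bar>coeff Q i\<bar>) \<le> 2 ^ (5*N) \<and>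
     (\<Sum>i\<le>N. \<bar>coeff R i\<bar>) \<le> 2 ^ (5*N)"

lemma coeff_mult_at_degree_bounds:
  fixes p q :: "'a::comm_semiring_0 poly"
  assumes "degree p \<le> m" "degree q \<le> n"
  shows "coeff (p * q) (m + n) = coeff p m * coeff q n"
proof -
  have "coeff (p * q) (m + n) = (\<Sum>i\<in>{m}. coeff p i * coeff q (m + n - i))"
    unfolding coeff_mult
  proof (rule sum.mono_neutral_right)
    show "\<forall>i\<in>{..m + n} - {m}. coeff p i * coeff q (m + n - i) = 0"
    proof
      fix i assume "i \<in> {..m + n} - {m}"
      then have "i > m \<or> m + n - i > n" by auto
      then show "coeff p i * coeff q (m + n - i) = 0" using assms by (auto simp: coeff_eq_0)
    qed
  qed auto
  then show ?thesis by simp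
qed

text \<open>Two neighbours in the Pade table. Their determinant is divisible by x^(2N), because Q1
  R2 - Q2 R1 = x^(2N) (Q1 P2 - Q2 P1), and has degree at most 2N. Its coefficient there is minus the
  product of the top coefficients of Q2 and R1, since Q1 R2 has degree at most 2N - 2.\<close>

lemma independent_pade_triples:
  assumes N: "N > 0"
  obtains P1 Q1 R1 P2 Q2 R2 c where "pade_triple N P1 Q1 R1" "pade_triple N P2 Q2 R2"
    "Q1 * R2 - Q2 * R1 = monom c (2*N)" "c \<noteq> 0"
proof -
  define Q1 Q2 where "Q1 = pade N (N-1) N" and "Q2 = pade (N-1) N (N+1)"
  have sides1: "N + (N-1) = 2*N - 1" "N + N = 2*N" "N \<le> N" "N - 1 \<le> N" "0 < N"
    and sides2: "(N-1) + N = 2*N - 1" "(N-1) + (N+1) = 2*N" "N - 1 \<le> N" "N \<le> N" "0 < N"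
    using N by auto
  obtain P1 R1 where 1: "monom 1 (2*N) * P1 + Q1 * [:1, -1:] ^ (2*N) = R1"
    "degree P1 \<le> N" "degree R1 \<le> N" "coeff R1 N \<noteq> 0" "(\<Sum>i\<le>N. \<bar>coeff Q1 i\<bar>) \<le> 2 ^ (5*N)"
    "(\<Sum>i\<le>N. \<bar>coeff P1 i\<bar>) \<le> 2 ^ (5*N)" "(\<Sum>i\<le>N. \<bar>coeff R1 i\<bar>) \<le> 2 ^ (5*N)"
    using pade_approximant[OF sides1, folded Q1_def] by blast
  obtain P2 R2 where 2: "monom 1 (2*N) * P2 + Q2 * [:1, -1:] ^ (2*N) = R2"
    "degree P2 \<le> N" "degree R2 \<le> N - 1" "coeff R2 (N-1) \<noteq> 0" "(\<Sum>i\<le>N. \<bar>coeff Q2 i\<bar>) \<le> 2 ^ (5*N)"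
    "(\<Sum>i\<le>N. \<bar>coeff P2 i\<bar>) \<le> 2 ^ (5*N)" "(\<Sum>i\<le>N. \<bar>coeff R2 i\<bar>) \<le> 2 ^ (5*N)"
    using pade_approximant[OF sides2, folded Q2_def] by blast
  have dQ: "degree Q1 \<le> N - 1" "degree Q2 \<le> N" unfolding Q1_def Q2_def by (rule degree_pade)+
  define D where "D = Q1 * R2 - Q2 * R1"
  define W where "W = Q1 * P2 - Q2 * P1"
  have DW: "D = monom 1 (2*N) * W"
    unfolding D_def W_def 1(1)[symmetric] 2(1)[symmetric] by (simp add: algebra_simps)
  have dD: "degree D \<le> 2*N"
    unfolding D_def using dQ 1(3) 2(3) degree_mult_le[of Q1 R2] degree_mult_le[of Q2 R1]
    by (intro degree_diff_le) auto
  have "coeff D i = 0" if "i \<noteq> 2*N" for i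
  proof (cases "i < 2*N")
    case True then show ?thesis unfolding DW by (simp add: coeff_monom_mult)
  next
    case False then show ?thesis using that dD by (intro coeff_eq_0) auto
  qed
  then have D: "D = monom (coeff D (2*N)) (2*N)" by (intro poly_eqI) auto
  have "coeff (Q1 * R2) (2*N) = 0"
    using dQ 2(3) N degree_mult_le[of Q1 R2] by (intro coeff_eq_0) auto
  moreover have "coeff (Q2 * R1) (N + N) = coeff Q2 N * coeff R1 N"
    using dQ 1(3) by (intro coeff_mult_at_degree_bounds) auto
  moreover have "coeff Q2 N > 0" unfolding Q2_def by (intro coeff_pade_pos) simp
  ultimately have "coeff D (2*N) \<noteq> 0" using 1(4) by (simp add: D_def mult_2)
  moreover have "pade_triple N P1 Q1 R1" "pade_triple N P2 Q2 R2"
    using 1 2 dQ N by (auto simp: pade_triple_def)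
  ultimately show thesis using that[of P1 Q1 R1 P2 Q2 R2 "coeff D (2*N)"] D by (simp add: D_def)
qed

section \<open>Height estimates on a line\<close>

lemma ipoly_altdef_bound: "degree p \<le> N \<Longrightarrow> ipoly p x = (\<Sum>j\<le>N. of_int (coeff p j) * x ^ j)"
  unfolding poly_altdef by (simp add: coeff_eq_0) (rule sum.mono_neutral_left, auto simp: coeff_eq_0)

text \<open>
  Eliminating \<open>(1 - x)\<^bsup>2N\<^esup>\<close> between the hypothesis and \<open>P x\<^bsup>2N\<^esup> + Q (1 - x)\<^bsup>2N\<^esup> = R\<close> gives
  \<open>x\<^bsup>2N\<^esup> = (Q - b R) / (a Q - b P)\<close>, whose height is about \<open>N\<close> times that of \<open>x\<close>. Of two independent
  triples, at least one has a nonzero denominator.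
\<close>
lemma weil_height_pade_le:
  assumes alg: "algebraic x" "algebraic a" "algebraic b" and x0: "x \<noteq> 0" and N: "N > 0"
    and eq: "a * x ^ (2*N) + b * (1 - x) ^ (2*N) = 1"
  shows "real N * weil_height x \<le> weil_height a + weil_height b + real (5*N+1) * ln 2"
proof -
  obtain P1 Q1 R1 P2 Q2 R2 c where pt: "pade_triple N P1 Q1 R1" "pade_triple N P2 Q2 R2"
    and D: "Q1 * R2 - Q2 * R1 = monom c (2*N)" "c \<noteq> 0"
    by (rule independent_pade_triples[OF N])
  \<comment> \<open>If Q - b R vanished at \<open>x\<close> for both triples, so would the
    determinant, which is a nonzero monomial.\<close>
  have "ipoly Q1 x * ipoly R2 x - ipoly Q2 x * ipoly R1 x = ipoly (Q1 * R2 - Q2 * R1) x"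
    by (simp add: of_int_poly_hom.hom_mult of_int_poly_hom.hom_minus)
  also have "\<dots> \<noteq> 0" unfolding D(1) using D(2) x0 by (simp add: map_poly_monom poly_monom)
  finally have "\<not> (ipoly Q1 x = b * ipoly R1 x \<and> ipoly Q2 x = b * ipoly R2 x)"
    by (auto simp: algebra_simps)
  then obtain P Q R where T: "pade_triple N P Q R" and F0: "ipoly Q x - b * ipoly R x \<noteq> 0"
    using pt by auto
  define F where "F = ipoly Q x - b * ipoly R x"
  define G where "G = a * ipoly Q x - b * ipoly P x"
  have dg: "degree P \<le> N" "degree Q \<le> N" "degree R \<le> N" using T by (auto simp: pade_triple_def)
  have id: "monom 1 (2*N) * P + Q * [:1, -1:] ^ (2*N) = R" using T by (simp add: pade_triple_def)
  have "ipoly (monom 1 (2*N) * P + Q * [:1, -1:] ^ (2*N)) x = ipoly R x" by (simp only: id)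
  then have ev: "x ^ (2*N) * ipoly P x + ipoly Q x * (1 - x) ^ (2*N) = ipoly R x"
    by (simp add: of_int_poly_hom.hom_mult of_int_poly_hom.hom_add of_int_poly_hom.hom_power map_poly_monom poly_monom
        of_int_hom.map_poly_pCons_hom)
  have "F = ipoly Q x * (a * x ^ (2*N) + b * (1 - x) ^ (2*N)) - b * (x ^ (2*N) * ipoly P x + ipoly Q x * (1 - x) ^ (2*N))"
    by (simp only: F_def eq ev mult_1_right)
  also have "\<dots> = x ^ (2*N) * G" by (simp add: G_def algebra_simps)
  finally have FG: "F = x ^ (2*N) * G" .
  then have G0: "G \<noteq> 0" using F0 by (auto simp: F_def)
  have quot: "x ^ (2*N) = F / G" using FG G0 by simp
  \<comment> \<open>The index (j, t) stands for x^j, x^j a or x^j b according to t = 0, 1, 2: degree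
    N in x, degree 1 in a and in b. Two polynomials occur in each combination, hence the bound 2^(5N
    + 1).\<close>
  define M where "M = {..N} \<times> {0,1,2::nat}"
  define X where "X = (\<lambda>i::nat. if i = 0 then x else if i = 1 then a else b)"
  define d where "d = (\<lambda>i::nat. if i = 0 then N else 1)"
  define ex where "ex = (\<lambda>(j::nat, t::nat) i::nat. if i = 0 then j else if i = t then 1 else 0)"
  define cF where "cF = (\<lambda>(j, t::nat). if t = 0 then coeff Q j else if t = 1 then 0 else - coeff R j)"
  define cG where "cG = (\<lambda>(j, t::nat). if t = 0 then 0 else if t = 1 then coeff Q j else - coeff P j)"
  have sumM: "(\<Sum>m\<in>M. g m) = (\<Sum>j\<le>N. g (j, 0)) + (\<Sum>j\<le>N. g (j, 1)) + (\<Sum>j\<le>N. g (j, 2))" for g :: "nat \<times> nat \<Rightarrow> 'b::comm_monoid_add"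
  proof -
    have "(\<Sum>m\<in>M. g m) = (\<Sum>j\<le>N. \<Sum>t\<in>{0,1,2}. g (j, t))" unfolding sum.cartesian_product M_def by simp
    also have "\<dots> = (\<Sum>j\<le>N. g (j, 0) + g (j, 1) + g (j, 2))" by (simp add: add.assoc)
    finally show ?thesis by (simp add: sum.distrib)
  qed
  have evF: "mpoly_eval M {0,1,2} ex cF X = F"
    by (simp add: mpoly_eval_def sumM cF_def ex_def X_def F_def ipoly_altdef_bound[OF dg(2)] ipoly_altdef_bound[OF dg(3)]
        sum_distrib_left sum_negf mult_ac)
  have evG: "mpoly_eval M {0,1,2} ex cG X = G"
    by (simp add: mpoly_eval_def sumM cG_def ex_def X_def G_def ipoly_altdef_bound[OF dg(2)] ipoly_altdef_bound[OF dg(1)]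
        sum_distrib_left sum_negf mult_ac)
  have nrm: "(\<Sum>j\<le>N. \<bar>real_of_int (coeff p j)\<bar>) \<le> 2 ^ (5*N)" if "(\<Sum>j\<le>N. \<bar>coeff p j\<bar>) \<le> 2 ^ (5*N)" for p
  proof -
    have "real_of_int (\<Sum>j\<le>N. \<bar>coeff p j\<bar>) \<le> real_of_int (2 ^ (5*N))" using that by (simp only: of_int_le_iff)
    then show ?thesis by simp
  qed
  have n: "(\<Sum>j\<le>N. \<bar>real_of_int (coeff P j)\<bar>) \<le> 2 ^ (5*N)" "(\<Sum>j\<le>N. \<bar>real_of_int (coeff Q j)\<bar>) \<le> 2 ^ (5*N)"
    "(\<Sum>j\<le>N. \<bar>real_of_int (coeff R j)\<bar>) \<le> 2 ^ (5*N)"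
    using T by (auto simp: pade_triple_def intro!: nrm)
  have "weil_height (mpoly_eval M {0,1,2} ex cF X / mpoly_eval M {0,1,2} ex cG X)
      \<le> (\<Sum>i\<in>{0,1,2}. real (d i) * weil_height (X i)) + ln (2 ^ (5*N+1))"
  proof (rule weil_height_fraction_le)
    show "finite M" by (simp add: M_def)
    show "ex m i \<le> d i" if "m \<in> M" "i \<in> {0,1,2}" for m i using that N by (auto simp: M_def ex_def d_def)
    show "(\<Sum>m\<in>M. \<bar>real_of_int (cF m)\<bar>) \<le> 2 ^ (5*N+1)" using n by (simp add: sumM cF_def)
    show "(\<Sum>m\<in>M. \<bar>real_of_int (cG m)\<bar>) \<le> 2 ^ (5*N+1)" using n by (simp add: sumM cG_def)
    show "mpoly_eval M {0,1,2} ex cG X \<noteq> 0" by (simp only: evG G0 not_False_eq_True)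
  qed (use alg in \<open>auto simp: X_def\<close>)
  also have "(\<Sum>i\<in>{0,1,2}. real (d i) * weil_height (X i)) = real N * weil_height x + weil_height a + weil_height b"
    by (simp add: d_def X_def)
  also have "ln ((2::real) ^ (5*N+1)) = real (5*N+1) * ln 2" by (rule ln_realpow)
  finally have "weil_height (x ^ (2*N)) \<le> real N * weil_height x + weil_height a + weil_height b + real (5*N+1) * ln 2"
    unfolding evF evG quot[symmetric] .
  \<comment> \<open>The left side carries 2N copies of the height of \<open>x\<close>, the bound
    only N; the difference is the gain.\<close>
  moreover have "real (2*N) * weil_height x \<le> weil_height (x ^ (2*N))" by (rule weil_height_power_ge[OF alg(1)])
  ultimately show ?thesis by simp
qed

lemma weil_height_uminus: assumes "algebraic x" shows "weil_height (- x) = weil_height x"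
  using weil_height_uminus_le[of x] weil_height_uminus_le[of "- x"] algebraic_arith(6)[OF assms] assms by simp

lemma weil_height_inverse: assumes "algebraic x" shows "weil_height (inverse x) = weil_height x"
  using weil_height_inverse_le[of x] weil_height_inverse_le[of "inverse x"] algebraic_arith(5)[OF assms] assms by simp

text \<open>The cross product made explicit. If (p : q : 1) is v / u, subtracting the two line
  equations gives (p - 1) u1 = (1 - q) u2, and p = 1 would force q = 1, that is, equal
  points.\<close>

lemma weil_height_ratio_le_of_line_points:
  assumes alg: "algebraic u1" "algebraic u2" "algebraic u3" "algebraic v1" "algebraic v2" "algebraic v3"
    and nz: "u1 \<noteq> 0" "u2 \<noteq> 0" "u3 \<noteq> 0" "v1 \<noteq> 0" "v2 \<noteq> 0" "v3 \<noteq> 0"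
    and u: "u1 + u2 + u3 = 0" and v: "v1 + v2 + v3 = 0" and ne: "\<not> (v1 / u1 = v3 / u3 \<and> v2 / u2 = v3 / u3)"
  shows "weil_height (u1 / u2) \<le> weil_height ((v1 / u1) / (v3 / u3)) + weil_height ((v2 / u2) / (v3 / u3)) + ln 2"
proof -
  define p where "p = (v1 / u1) / (v3 / u3)"
  define q where "q = (v2 / u2) / (v3 / u3)"
  have "p * u1 + q * u2 + u3 = (v1 + v2 + v3) * (u3 / v3)"
    unfolding p_def q_def using nz by (simp add: field_simps)
  then have "p * u1 + q * u2 + u3 = 0" using v by simp
  moreover have "(p - 1) * u1 - (1 - q) * u2 = (p * u1 + q * u2 + u3) - (u1 + u2 + u3)"
    by (simp add: algebra_simps)
  ultimately have pq: "(p - 1) * u1 = (1 - q) * u2" using u by simp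
  have "p \<noteq> 1"
  proof
    assume p: "p = 1"
    then have "q = 1" using pq nz by simp
    then show False using p ne nz by (simp add: p_def q_def field_simps)
  qed
  then have "u1 / u2 = (1 - q) / (p - 1)" using pq nz by (simp add: frac_eq_eq mult.commute)
  moreover have "algebraic p" "algebraic q" unfolding p_def q_def by (intro algebraic_arith alg)+
  ultimately show ?thesis using weil_height_diff_quotient_le[of q p] \<open>p \<noteq> 1\<close> by (simp add: p_def q_def)
qed

text \<open>Put x = - u1 / u3, so that 1 - x = - u2 / u3. The even exponent removes these signs, and
  the coefficients a and b are, up to sign, the coordinates of v / u^(2N).\<close>

lemma weil_height_pade_points_le:
  assumes alg: "algebraic u1" "algebraic u2" "algebraic u3" "algebraic v1" "algebraic v2" "algebraic v3"
    and nz: "u1 \<noteq> 0" "u2 \<noteq> 0" "u3 \<noteq> 0" "v3 \<noteq> 0" and N: "N > 0"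
    and u: "u1 + u2 + u3 = 0" and v: "v1 + v2 + v3 = 0"
  shows "real N * weil_height (u1 / u3) \<le> weil_height ((v1 / v3) * (u3 / u1) ^ (2*N))
     + weil_height ((v2 / v3) * (u3 / u2) ^ (2*N)) + real (5*N+1) * ln 2"
proof -
  define x where "x = - (u1 / u3)"
  have "u2 = (u1 + u2 + u3) - u1 - u3" "v2 = (v1 + v2 + v3) - v1 - v3" by simp_all
  then have u2: "u2 = - u1 - u3" and v2: "v2 = - v1 - v3" using u v by simp_all
  have y: "1 - x = - (u2 / u3)" using nz by (simp add: x_def u2 field_simps)
  define a where "a = - ((v1 / v3) * (u3 / u1) ^ (2*N))"
  define b where "b = - ((v2 / v3) * (u3 / u2) ^ (2*N))"
  have ax: "a * x ^ (2*N) = - (v1 / v3)" unfolding a_def x_def using nz by (simp add: power_divide)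
  have bx: "b * (1 - x) ^ (2*N) = - (v2 / v3)" unfolding b_def y using nz by (simp add: power_divide)
  have A: "algebraic ((v1 / v3) * (u3 / u1) ^ (2*N))" "algebraic ((v2 / v3) * (u3 / u2) ^ (2*N))" "algebraic (u1 / u3)"
    by (intro algebraic_arith alg)+
  have "real N * weil_height x \<le> weil_height a + weil_height b + real (5*N+1) * ln 2"
  proof (rule weil_height_pade_le)
    show "a * x ^ (2*N) + b * (1 - x) ^ (2*N) = 1" unfolding ax bx using nz by (simp add: v2 field_simps)
    show "algebraic x" "algebraic a" "algebraic b" unfolding x_def a_def b_def by (intro algebraic_arith(6) A)+
    show "x \<noteq> 0" using nz by (simp add: x_def)
  qed (rule N)
  then show ?thesis unfolding x_def a_def b_def using A by (simp add: weil_height_uminus)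
qed

text \<open>Induction by removing an element with maximal \<open>T\<close>, which exceeds every
  remaining one by the factor 3/2.\<close>

lemma geometric_growth_of_gaps:
  fixes T :: "'a \<Rightarrow> real"
  assumes "finite S" "card S = Suc r" "T0 > 0" "\<And>s. s \<in> S \<Longrightarrow> T0 \<le> T s"
    and gap: "\<And>a b. a \<in> S \<Longrightarrow> b \<in> S \<Longrightarrow> a \<noteq> b \<Longrightarrow> T a \<le> T b \<Longrightarrow> 3 * T a \<le> 2 * T b"
  shows "\<exists>s\<in>S. (3/2) ^ r * T0 \<le> T s"
  using assms
proof (induction r arbitrary: S)
  case 0
  then obtain s where "s \<in> S" by fastforce
  then show ?case using 0 by auto
next
  case (Suc r)
  have ne: "S \<noteq> {}" using Suc.prems(2) by auto
  have "Max (T ` S) \<in> T ` S" using Suc.prems(1) ne by (intro Max_in) auto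
  then obtain s where "s \<in> S" "Max (T ` S) = T s" by auto
  then have s: "s \<in> S" "\<And>a. a \<in> S \<Longrightarrow> T a \<le> T s"
    using Suc.prems(1) by (auto simp flip: \<open>Max (T ` S) = T s\<close>)
  have "card (S - {s}) = Suc r" using s(1) Suc.prems by simp
  then obtain a where a: "a \<in> S - {s}" "(3/2) ^ r * T0 \<le> T a"
    using Suc.IH[of "S - {s}"] Suc.prems by auto
  then have "3 * T a \<le> 2 * T s" using Suc.prems(5)[of a s] s by auto
  then have "(3/2) ^ Suc r * T0 \<le> T s" using a(2) by simp
  then show ?case using s(1) by blast
qed

text \<open>A bound on finite sets of pairs (function, zero) also yields finiteness, which excludes
  the value \<infinity> of \<open>mult_ge\<close>.\<close>

lemma sum_mult_ge_le:
  assumes B: "\<And>S. finite S \<Longrightarrow> S \<subseteq> {(j, n). j \<in> J \<and> \<nu> \<le> real n \<and> g j n = 0} \<Longrightarrow> card S \<le> B"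
    and J: "finite J"
  shows "(\<Sum>j\<in>J. mult_ge \<nu> (g j)) \<le> enat B"
proof -
  define Z where "Z = (\<lambda>j. {n. \<nu> \<le> real n \<and> g j n = 0})"
  define X where "X = (SIGMA j:J. Z j)"
  have XB: "card S \<le> B" if "finite S" "S \<subseteq> X" for S
    using that by (intro B) (auto simp: X_def Z_def)
  have finX: "finite X"
  proof (rule ccontr)
    assume "infinite X"
    then obtain S where "finite S" "card S = Suc B" "S \<subseteq> X" by (metis infinite_arbitrarily_large)
    then show False using XB[of S] by simp
  qed
  have finZ: "finite (Z j)" if "j \<in> J" for j
  proof -
    have "Pair j ` Z j \<subseteq> X" using that by (auto simp: X_def)
    then have "finite (Pair j ` Z j)" using finX finite_subset by blast
    then show ?thesis by (simp add: finite_image_iff inj_on_def)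
  qed
  have "(\<Sum>j\<in>J. mult_ge \<nu> (g j)) = (\<Sum>j\<in>J. of_nat (card (Z j)))"
    using finZ by (intro sum.cong refl) (simp add: mult_ge_def Z_def of_nat_eq_enat)
  also have "\<dots> = of_nat (\<Sum>j\<in>J. card (Z j))" by (rule of_nat_sum[symmetric])
  also have "(\<Sum>j\<in>J. card (Z j)) = card X" unfolding X_def using J finZ by (simp add: card_SigmaI)
  also have "of_nat (card X) = enat (card X)" by (rule of_nat_eq_enat)
  also have "\<dots> \<le> enat B" using XB[OF finX] by simp
  finally show ?thesis .
qed

section \<open>Zeros of ternary recurrences\<close>

lemma UNIV_3_eq: "i \<noteq> j \<Longrightarrow> i \<noteq> k \<Longrightarrow> j \<noteq> k \<Longrightarrow> (UNIV :: 3 set) = {i, j, k}"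
  using exhaust_3[of i] exhaust_3[of j] exhaust_3[of k] by (auto simp: UNIV_3)

lemma Gm3D: "x \<in> Gm3 \<Longrightarrow> algebraic (vec_nth x i)" "x \<in> Gm3 \<Longrightarrow> vec_nth x i \<noteq> 0"
  by (auto simp: Gm3_def)

lemma weil_height_ratio_le_hstar:
  assumes x: "x \<in> Gm3" and ij: "i \<noteq> j"
  shows "weil_height (vec_nth x i / vec_nth x j) \<le> hstar x"
proof -
  have inv: "weil_height (vec_nth x i / vec_nth x j) = weil_height (vec_nth x j / vec_nth x i)" for i j
    using weil_height_inverse[OF algebraic_arith(2)[OF Gm3D(1)[OF x, of j] Gm3D(1)[OF x, of i]]] by simp
  have "weil_height (vec_nth x 1 / vec_nth x 2) \<le> hstar x" "weil_height (vec_nth x 1 / vec_nth x 3) \<le> hstar x"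
    "weil_height (vec_nth x 2 / vec_nth x 3) \<le> hstar x" by (auto simp: hstar_def)
  then show ?thesis using exhaust_3[of i] exhaust_3[of j] ij inv[of 2 1] inv[of 3 1] inv[of 3 2] by auto
qed

lemma hstar_attained:
  obtains i j k :: 3 where "i \<noteq> j" "i \<noteq> k" "j \<noteq> k" "hstar x = weil_height (vec_nth x i / vec_nth x j)"
proof -
  have "hstar x \<in> {weil_height (vec_nth x 1 / vec_nth x 2), weil_height (vec_nth x 1 / vec_nth x 3),
      weil_height (vec_nth x 2 / vec_nth x 3)}"
    unfolding hstar_def by (rule Max_in) auto
  then consider "hstar x = weil_height (vec_nth x 1 / vec_nth x 2)" | "hstar x = weil_height (vec_nth x 1 / vec_nth x 3)"
    | "hstar x = weil_height (vec_nth x 2 / vec_nth x 3)" by auto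
  then show thesis by cases (use that[of 1 2 3] that[of 1 3 2] that[of 2 3 1] in auto)
qed

locale recurrence_zeros =
  fixes \<alpha> :: "complex ^ 3" and \<theta> :: real
  assumes \<alpha>: "\<alpha> \<in> Gm3" and H: "hstar \<alpha> > 0" and \<theta>: "\<theta> \<ge> 0"
begin

definition pt :: "complex ^ 3 \<Rightarrow> nat \<Rightarrow> 3 \<Rightarrow> complex" where
  "pt c n i = vec_nth c i * vec_nth \<alpha> i ^ n"

definition zero_at :: "complex ^ 3 \<Rightarrow> nat \<Rightarrow> bool" where
  "zero_at c n \<longleftrightarrow> c \<in> Gm3 \<and> hstar c \<le> \<theta> \<and> (\<Sum>i\<in>UNIV. pt c n i) = 0"

lemma pt_alg: "c \<in> Gm3 \<Longrightarrow> algebraic (pt c n i)" and pt_nz: "c \<in> Gm3 \<Longrightarrow> pt c n i \<noteq> 0"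
  unfolding pt_def using Gm3D[OF \<alpha>] Gm3D[of c] by (auto intro!: algebraic_arith)

lemma coeff_ratio_le: "c \<in> Gm3 \<Longrightarrow> hstar c \<le> \<theta> \<Longrightarrow> i \<noteq> j \<Longrightarrow> weil_height (vec_nth c i / vec_nth c j) \<le> \<theta>"
  using weil_height_ratio_le_hstar[of c i j] by simp

lemma weil_height_pt_ratio_ge:
  assumes c: "c \<in> Gm3" "hstar c \<le> \<theta>" and ij: "i \<noteq> j"
  shows "real n * weil_height (vec_nth \<alpha> i / vec_nth \<alpha> j) - \<theta> \<le> weil_height (pt c n i / pt c n j)"
proof -
  let ?a = "vec_nth \<alpha> i / vec_nth \<alpha> j"
  have alg: "algebraic ?a" "algebraic (vec_nth c j / vec_nth c i)" "algebraic (pt c n i / pt c n j)"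
    using Gm3D(1)[OF \<alpha>] Gm3D(1)[OF c(1)] pt_alg[OF c(1)] by (intro algebraic_arith(2); blast)+
  have "?a ^ n = (pt c n i / pt c n j) * (vec_nth c j / vec_nth c i)"
    using Gm3D(2)[OF c(1), of i] Gm3D(2)[OF c(1), of j] Gm3D(2)[OF \<alpha>, of j] by (simp add: pt_def field_simps)
  then have "weil_height (?a ^ n) \<le> weil_height (pt c n i / pt c n j) + weil_height (vec_nth c j / vec_nth c i)"
    using weil_height_mult_le[OF alg(3,2)] by simp
  then show ?thesis
    using weil_height_power_ge[OF alg(1), of n] coeff_ratio_le[OF c, of j i] ij by auto
qed

text \<open>The height of one coordinate ratio of u is at least n h - \<theta>, and by the line
  argument at most twice the height of v / u plus log 2, where h =
  \<open>hstar \<alpha>\<close>.\<close>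

lemma gap:
  assumes c: "zero_at c n" and d: "zero_at d m" and nm: "n \<le> m"
    and ne: "\<not> (\<forall>i k. pt d m i / pt c n i = pt d m k / pt c n k)"
  shows "3 * (real n * hstar \<alpha> - 5 * \<theta> - 1) \<le> 2 * (real m * hstar \<alpha> - 5 * \<theta> - 1)"
proof -
  have c': "c \<in> Gm3" "hstar c \<le> \<theta>" "(\<Sum>i\<in>UNIV. pt c n i) = 0" using c by (auto simp: zero_at_def)
  have d': "d \<in> Gm3" "hstar d \<le> \<theta>" "(\<Sum>i\<in>UNIV. pt d m i) = 0" using d by (auto simp: zero_at_def)
  obtain i j k :: 3 where ijk: "i \<noteq> j" "i \<noteq> k" "j \<noteq> k" and Hij: "hstar \<alpha> = weil_height (vec_nth \<alpha> i / vec_nth \<alpha> j)"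
    by (rule hstar_attained)
  note U = UNIV_3_eq[OF ijk]
  have su: "pt c n i + pt c n j + pt c n k = 0" using c'(3) ijk unfolding U by (simp add: add.assoc)
  have sv: "pt d m i + pt d m j + pt d m k = 0" using d'(3) ijk unfolding U by (simp add: add.assoc)
  have "\<not> (pt d m i / pt c n i = pt d m k / pt c n k \<and> pt d m j / pt c n j = pt d m k / pt c n k)"
  proof
    assume *: "pt d m i / pt c n i = pt d m k / pt c n k \<and> pt d m j / pt c n j = pt d m k / pt c n k"
    have X: "pt d m l / pt c n l = pt d m k / pt c n k" for l
    proof -
      have "l \<in> {i, j, k}" unfolding U[symmetric] by simp
      then show ?thesis using * by auto
    qed
    have "\<forall>i k. pt d m i / pt c n i = pt d m k / pt c n k"
      by (intro allI) (rule trans[OF X X[symmetric]])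
    with ne show False by contradiction
  qed
  then have 1: "weil_height (pt c n i / pt c n j) \<le> weil_height ((pt d m i / pt c n i) / (pt d m k / pt c n k))
      + weil_height ((pt d m j / pt c n j) / (pt d m k / pt c n k)) + ln 2"
    using su sv by (intro weil_height_ratio_le_of_line_points pt_alg pt_nz c' d')
  \<comment> \<open>A ratio of coordinates of v / u is one coefficient ratio from each of d and c,
    costing \<theta> apiece, times the power m - n of a ratio of coordinates of \<alpha>.\<close>
  have 2: "weil_height ((pt d m l / pt c n l) / (pt d m k / pt c n k)) \<le> 2 * \<theta> + (real m - real n) * hstar \<alpha>" if "l \<noteq> k" for l
  proof -
    let ?a = "vec_nth \<alpha> l / vec_nth \<alpha> k" and ?d = "vec_nth d l / vec_nth d k" and ?c = "vec_nth c k / vec_nth c l"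
    have alg: "algebraic ?a" "algebraic ?d" "algebraic ?c"
      using Gm3D(1)[OF \<alpha>] Gm3D(1)[OF c'(1)] Gm3D(1)[OF d'(1)] by (intro algebraic_arith(2); blast)+
    have a0: "?a \<noteq> 0" using Gm3D(2)[OF \<alpha>] by simp
    have "(pt d m l / pt c n l) / (pt d m k / pt c n k) = ?d * ?c * (?a ^ m / ?a ^ n)"
      using Gm3D(2)[OF c'(1), of l] Gm3D(2)[OF d'(1), of k] Gm3D(2)[OF c'(1), of k] Gm3D(2)[OF \<alpha>, of l] Gm3D(2)[OF \<alpha>, of k]
      by (simp add: pt_def power_divide mult_ac)
    also have "weil_height \<dots> \<le> weil_height (?d * ?c) + weil_height (?a ^ m / ?a ^ n)"
      by (intro weil_height_mult_le algebraic_arith(1) alg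
          algebraic_arith(2)[OF algebraic_arith(4)[OF alg(1)] algebraic_arith(4)[OF alg(1)]])
    also have "\<dots> \<le> weil_height ?d + weil_height ?c + \<bar>real m - real n\<bar> * weil_height ?a"
      using alg by (intro add_mono weil_height_mult_le weil_height_power_quotient_le a0)
    also have "\<dots> \<le> \<theta> + \<theta> + \<bar>real m - real n\<bar> * hstar \<alpha>"
      using that by (intro add_mono mult_left_mono coeff_ratio_le c' d' weil_height_ratio_le_hstar \<alpha>) auto
    finally show ?thesis using nm by simp
  qed
  have "real n * hstar \<alpha> - \<theta> \<le> weil_height (pt c n i / pt c n j)"
    unfolding Hij by (rule weil_height_pt_ratio_ge[OF c'(1,2) ijk(1)])
  then have "real n * hstar \<alpha> - \<theta> \<le> 4 * \<theta> + 2 * ((real m - real n) * hstar \<alpha>) + 1"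
    using 1 2[OF ijk(2)] 2[OF ijk(3)] ln_2_less_1 by linarith
  then show ?thesis by (simp add: algebra_simps)
qed

lemma no_distant_zeros:
  assumes c: "zero_at c n" and d: "zero_at d m" 
    and n: "real n * hstar \<alpha> \<ge> 33.1 + 73.1 * \<theta>" and nm: "7 * n \<le> m"
  shows False
proof -
  have c': "c \<in> Gm3" "hstar c \<le> \<theta>" "(\<Sum>i\<in>UNIV. pt c n i) = 0" using c by (auto simp: zero_at_def)
  have d': "d \<in> Gm3" "hstar d \<le> \<theta>" "(\<Sum>i\<in>UNIV. pt d m i) = 0" using d by (auto simp: zero_at_def)
  obtain i j k :: 3 where ijk: "i \<noteq> j" "i \<noteq> k" "j \<noteq> k" and Hij: "hstar \<alpha> = weil_height (vec_nth \<alpha> i / vec_nth \<alpha> j)"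
    by (rule hstar_attained)
  note U = UNIV_3_eq[OF ijk]
  have su: "pt c n i + pt c n k + pt c n j = 0" using c'(3) ijk unfolding U by (simp add: add_ac)
  have sv: "pt d m i + pt d m k + pt d m j = 0" using d'(3) ijk unfolding U by (simp add: add_ac)
  have n0: "n > 0" using n \<theta> by (cases n) auto
  \<comment> \<open>This is m / (2n) rounded to a nearest integer, so that 2 N n differs from m by
    at most n.\<close>
  define N where "N = (m + n) div (2 * n)"
  have "2 * n * N + (m + n) mod (2 * n) = m + n" unfolding N_def by simp
  moreover have "(m + n) mod (2 * n) < 2 * n" using n0 by simp
  ultimately have N: "2 * N * n \<le> m + n" "m + n < 2 * N * n + 2 * n" by (auto simp: algebra_simps)
  have N4: "N \<ge> 4"
  proof -
    have "(8 * n) div (2 * n) \<le> N" unfolding N_def using nm by (intro div_le_mono) simp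
    moreover have "(8 * n) div (2 * n) = 4" using n0 by (simp add: div_mult_mult2[of n 8 2, simplified])
    ultimately show ?thesis by simp
  qed
  have dist: "\<bar>real m - real (2 * N * n)\<bar> \<le> real n"
    using N by linarith
  \<comment> \<open>The coefficients enter once through d and 2N times through c; of the powers of
    \<alpha> only the exponent m - 2 N n survives.\<close>
  have up: "weil_height ((pt d m l / pt d m j) * (pt c n j / pt c n l) ^ (2*N)) \<le> (2 * real N + 1) * \<theta> + real n * hstar \<alpha>" if "l \<noteq> j" for l
  proof -
    let ?a = "vec_nth \<alpha> l / vec_nth \<alpha> j" and ?d = "vec_nth d l / vec_nth d j" and ?c = "vec_nth c j / vec_nth c l"
    have alg: "algebraic ?a" "algebraic ?d" "algebraic ?c"
      using Gm3D(1)[OF \<alpha>] Gm3D(1)[OF c'(1)] Gm3D(1)[OF d'(1)] by (intro algebraic_arith(2); blast)+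
    have a0: "?a \<noteq> 0" using Gm3D(2)[OF \<alpha>] by simp
    have "(pt d m l / pt d m j) * (pt c n j / pt c n l) ^ (2*N) = ?d * ?c ^ (2*N) * (?a ^ m / ?a ^ (2*N*n))"
      by (simp add: pt_def power_divide power_mult_distrib power_mult[symmetric] mult_ac)
    also have "weil_height \<dots> \<le> weil_height (?d * ?c ^ (2*N)) + weil_height (?a ^ m / ?a ^ (2*N*n))"
      by (intro weil_height_mult_le algebraic_arith(1,4) alg
          algebraic_arith(2)[OF algebraic_arith(4)[OF alg(1)] algebraic_arith(4)[OF alg(1)]])
    also have "\<dots> \<le> weil_height ?d + real (2*N) * weil_height ?c + \<bar>real m - real (2*N*n)\<bar> * weil_height ?a"
      using alg by (intro add_mono order_trans[OF weil_height_mult_le] weil_height_power_le weil_height_power_quotient_le a0 algebraic_arith(4) order_refl)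
    also have "\<dots> \<le> \<theta> + real (2*N) * \<theta> + real n * hstar \<alpha>"
      using that alg dist by (intro add_mono mult_mono mult_left_mono coeff_ratio_le c' d' weil_height_ratio_le_hstar \<alpha> weil_height_nonneg) auto
    finally show ?thesis by (simp add: algebra_simps)
  qed
  \<comment> \<open>Coordinate j takes the place of u3, so that the ratio being bounded is the one
    for which the ratio of coordinates of \<alpha> attains \<open>hstar \<alpha>\<close>.\<close>
  have "real N * weil_height (pt c n i / pt c n j) \<le> weil_height ((pt d m i / pt d m j) * (pt c n j / pt c n i) ^ (2*N))
     + weil_height ((pt d m k / pt d m j) * (pt c n j / pt c n k) ^ (2*N)) + real (5*N+1) * ln 2"
    using su sv N4 by (intro weil_height_pade_points_le pt_alg pt_nz c' d') auto
  also have "\<dots> \<le> ((2 * real N + 1) * \<theta> + real n * hstar \<alpha>) + ((2 * real N + 1) * \<theta> + real n * hstar \<alpha>) + real (5*N+1) * 1"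
    using ln_2_less_1 ijk by (intro add_mono up mult_left_mono) auto
  finally have 1: "real N * weil_height (pt c n i / pt c n j) \<le> 2 * ((2 * real N + 1) * \<theta> + real n * hstar \<alpha>) + real (5*N+1)"
    by (simp add: mult_ac)
  have "real N * (real n * hstar \<alpha> - \<theta>) \<le> real N * weil_height (pt c n i / pt c n j)"
    unfolding Hij using weil_height_pt_ratio_ge[OF c'(1,2) ijk(1)] by (intro mult_left_mono) auto
  \<comment> \<open>The errors in two coordinates account for the loss of 2. For N \<ge> 4 the right
    side is less than N - 2 times the assumed lower bound on n
    \<open>hstar \<alpha>\<close>.\<close>
  with 1 have "(real N - 2) * (real n * hstar \<alpha>) \<le> (5 * real N + 2) * \<theta> + (5 * real N + 1)"
    by (simp add: algebra_simps)
  moreover have "(real N - 2) * (33.1 + 73.1 * \<theta>) \<le> (real N - 2) * (real n * hstar \<alpha>)"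
    using n N4 by (intro mult_left_mono) auto
  moreover have "(5 * real N + 2) * \<theta> \<le> (real N - 2) * 73.1 * \<theta>"
    using N4 \<theta> by (intro mult_right_mono) auto
  moreover have "5 * real N + 1 < (real N - 2) * 33.1" using N4 by auto
  moreover have "(real N - 2) * (33.1 + 73.1 * \<theta>) = (real N - 2) * 33.1 + (real N - 2) * 73.1 * \<theta>"
    by (simp add: algebra_simps)
  ultimately show False by linarith
qed

text \<open>Proportionality would make a ratio of coordinates of \<alpha> a root of unity, hence of
  height 0, although its height is \<open>hstar \<alpha>\<close> > 0. This separates zeros of the
  same function.\<close>

lemma zeros_not_proportional:
  assumes c: "c \<in> Gm3" and nm: "n \<noteq> m"
  shows "\<not> (\<forall>i k. pt c m i / pt c n i = pt c m k / pt c n k)"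
proof
  assume eq: "\<forall>i k. pt c m i / pt c n i = pt c m k / pt c n k"
  obtain i j k :: 3 where ijk: "i \<noteq> j" and Hij: "hstar \<alpha> = weil_height (vec_nth \<alpha> i / vec_nth \<alpha> j)"
    by (rule hstar_attained)
  define a where "a = vec_nth \<alpha> i / vec_nth \<alpha> j"
  have alg: "algebraic a" unfolding a_def using Gm3D(1)[OF \<alpha>] by (intro algebraic_arith(2))
  have a0: "a \<noteq> 0" unfolding a_def using Gm3D(2)[OF \<alpha>] by simp
  have "a ^ m = a ^ n"
    using eq[rule_format, of i j] Gm3D(2)[OF c, of i] Gm3D(2)[OF c, of j] Gm3D(2)[OF \<alpha>, of i] Gm3D(2)[OF \<alpha>, of j]
    by (simp add: pt_def a_def power_divide field_simps)
  then have "a ^ (max m n - min m n) = 1" using a0 by (cases "m \<le> n") (auto simp: power_diff)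
  then have "real (max m n - min m n) * weil_height a \<le> 0"
    using weil_height_power_ge[OF alg, of "max m n - min m n"] by (simp add: weil_height_1)
  moreover have "real (max m n - min m n) > 0" using nm by auto
  ultimately show False using H Hij by (simp add: a_def mult_le_0_iff)
qed

text \<open>The exponent in the equivalence is m - n, and the common ratio \<open>l\<close> is the
  projective scalar. By contraposition, zeros of inequivalent functions give distinct
  points.\<close>

lemma equivalent_if_proportional:
  assumes g: "coeff_of g = c" "coeff_of g' = d" and c: "c \<in> Gm3" and d: "d \<in> Gm3"
    and eq: "\<forall>i k. pt d m i / pt c n i = pt d m k / pt c n k"
  shows "equivalent \<alpha> g g'"
proof -
  define l where "l = pt d m 1 / pt c n 1"
  have l: "algebraic l" "l \<noteq> 0" unfolding l_def using pt_alg pt_nz c d by (auto intro: algebraic_arith)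
  have "vec_nth \<alpha> i powi (int m - int n) * vec_nth d i = l * vec_nth c i" for i
  proof -
    have "pt d m i = l * pt c n i" using eq[rule_format, of i 1] pt_nz[OF c, of n i] by (simp add: l_def field_simps)
    then show ?thesis using Gm3D(2)[OF \<alpha>, of i] by (simp add: pt_def power_int_diff field_simps)
  qed
  then have e: "(\<chi> i. vec_nth \<alpha> i powi (int m - int n) * vec_nth d i) = l *s c"
    by (simp add: vec_eq_iff vector_scalar_mult_def)
  have "proj_point c = proj_point (l *s c)"
  proof -
    have "\<exists>t'. t *s c = t' *s (l *s c) \<and> algebraic t' \<and> t' \<noteq> 0" if "algebraic t" "t \<noteq> 0" for t
      using that l by (intro exI[of _ "t / l"]) (auto simp: vector_smult_assoc intro: algebraic_arith)
    moreover have "\<exists>t'. t *s (l *s c) = t' *s c \<and> algebraic t' \<and> t' \<noteq> 0" if "algebraic t" "t \<noteq> 0" for t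
      using that l by (intro exI[of _ "t * l"]) (auto simp: vector_smult_assoc intro: algebraic_arith)
    ultimately show ?thesis unfolding proj_point_def by blast
  qed
  then show ?thesis unfolding equivalent_def g e[symmetric] by blast
qed

end

theorem theorem2p2:
  fixes \<theta> :: real and \<alpha> :: "complex ^ 3" and N :: nat and f :: "nat \<Rightarrow> lin_rec3"
  assumes "\<theta> \<ge> 0"
    and "\<alpha> \<in> Gm3"
    and "hstar \<alpha> > 0"
    and "\<And>j. j \<in> {1..N} \<Longrightarrow> f j \<in> L3 \<alpha> \<theta>"
    and "\<And>i j. i \<in> {1..N} \<Longrightarrow> j \<in> {1..N} \<Longrightarrow> i \<noteq> j \<Longrightarrow> \<not> equivalent \<alpha> (f i) (f j)"
  shows "(\<Sum>j = 1..N. mult_ge ((2.8 + 6 * \<theta>) / hstar \<alpha>) (fun_of (f j))) \<le> 24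
    \<and> (\<Sum>j = 1..N. mult_ge ((33.1 + 73.1 * \<theta>) / hstar \<alpha>) (fun_of (f j))) \<le> 5"
proof -
  interpret recurrence_zeros \<alpha> \<theta> using assms(1-3) by unfold_locales
  \<comment> \<open>The parameter is the numerator of the threshold, so membership bounds n
    \<open>hstar \<alpha>\<close> from below without a division.\<close>
  define Z where "Z = (\<lambda>\<nu>. {(j, n). j \<in> {1..N} \<and> \<nu> / hstar \<alpha> \<le> real n \<and> fun_of (f j) n = 0})"
  define T where "T = (\<lambda>(j::nat, n). real n * hstar \<alpha> - 5 * \<theta> - 1)"
  have zero: "zero_at (coeff_of (f j)) n" if "j \<in> {1..N}" "fun_of (f j) n = 0" for j n
  proof -
    obtain g c where gc: "f j = (g, c)" by (cases "f j")
    then show ?thesis using assms(4)[OF that(1)] that(2) by (auto simp: L3_def zero_at_def sum_3 pt_def)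
  qed
  have bound: "\<nu> \<le> real n * hstar \<alpha>" if "(j, n) \<in> Z \<nu>" for j n \<nu>
    using that H by (simp add: Z_def pos_divide_le_eq)
  have gapT: "3 * T a \<le> 2 * T b" if "a \<in> Z \<nu>" "b \<in> Z \<nu>'" "a \<noteq> b" "T a \<le> T b" for a b \<nu> \<nu>'
  proof -
    obtain j n j' m where ab: "a = (j, n)" "b = (j', m)" by (cases a, cases b)
    have z: "zero_at (coeff_of (f j)) n" "zero_at (coeff_of (f j')) m" and J: "j \<in> {1..N}" "j' \<in> {1..N}"
      using that(1,2) zero by (auto simp: ab Z_def)
    have G: "coeff_of (f j) \<in> Gm3" "coeff_of (f j') \<in> Gm3" using z by (auto simp: zero_at_def)
    have "n \<le> m" using that(4) H by (simp add: T_def ab)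
    moreover have "\<not> (\<forall>i k. pt (coeff_of (f j')) m i / pt (coeff_of (f j)) n i = pt (coeff_of (f j')) m k / pt (coeff_of (f j)) n k)"
    proof (cases "j = j'")
      case True
      then show ?thesis using zeros_not_proportional[OF G(1), of n m] that(3) by (auto simp: ab)
    next
      case False
      then show ?thesis using equivalent_if_proportional[OF refl refl G] assms(5)[OF J] by blast
    qed
    ultimately show ?thesis using gap[OF z] by (simp add: T_def ab)
  qed
  have five: "card S \<le> 5" if S: "finite S" "S \<subseteq> Z (33.1 + 73.1 * \<theta>)" for S
  proof (rule ccontr)
    assume "\<not> card S \<le> 5"
    then obtain S' where S': "S' \<subseteq> S" "card S' = Suc 5" "finite S'"
      using obtain_subset_with_card_n[of "Suc 5" S] by auto
    have sub: "S' \<subseteq> Z (33.1 + 73.1 * \<theta>)" using S S' by blast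
    \<comment> \<open>Growth is measured from the least zero itself, because
      \<open>no_distant_zeros\<close> compares two actual zeros.\<close>
    have "Min (T ` S') \<in> T ` S'" using S' by (intro Min_in) auto
    then obtain a where a: "a \<in> S'" "Min (T ` S') = T a" by auto
    then have le: "T a \<le> T s" if "s \<in> S'" for s using that S'(3) by (simp flip: a(2))
    obtain j n where ajn: "a = (j, n)" by (cases a)
    have n: "33.1 + 73.1 * \<theta> \<le> real n * hstar \<alpha>" using bound sub a ajn by blast
    then have "T a > 0" using \<theta> by (simp add: T_def ajn)
    then obtain b where b: "b \<in> S'" "(3/2) ^ 5 * T a \<le> T b"
      using geometric_growth_of_gaps[of S' 5 "T a" T] S' le gapT sub by blast
    obtain j' m where bjm: "b = (j', m)" by (cases b)
    have "(3/2) ^ 5 * (real n * hstar \<alpha> - 5 * \<theta> - 1) \<le> real m * hstar \<alpha> - 5 * \<theta> - 1"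
      using b by (simp add: T_def ajn bjm)
    \<comment> \<open>(3/2)^5 is about 7.59; the surplus over 7, times 33.1 + 73.1 \<theta>, absorbs
      the shift by 5 \<theta> + 1.\<close>
    then have "7 * (real n * hstar \<alpha>) \<le> real m * hstar \<alpha>"
      using n \<theta> by (simp add: power_numeral_even power_numeral_odd field_simps)
    then have "real (7 * n) * hstar \<alpha> \<le> real m * hstar \<alpha>" by (simp add: mult.assoc)
    then have "7 * n \<le> m" using H by (simp only: mult_le_cancel_right_pos of_nat_le_iff)
    moreover have "zero_at (coeff_of (f j)) n" "zero_at (coeff_of (f j')) m"
      using sub a b zero by (auto simp: ajn bjm Z_def)
    ultimately show False using no_distant_zeros[OF _ _ n] by blast
  qed
  have twenty_four: "card S \<le> 24" if S: "finite S" "S \<subseteq> Z (2.8 + 6 * \<theta>)" for S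
  proof -
    \<comment> \<open>The cut is the value of \<open>T\<close> at the second threshold: 33.1 + 73.1
      \<theta> minus 5 \<theta> + 1. Below it lie at most 11 zeros, above it at most 5, in total at
      most 16.\<close>
    define S1 where "S1 = {s \<in> S. T s < 32.1 + 68.1 * \<theta>}"
    have "card S1 \<le> 11"
    proof (rule ccontr)
      assume "\<not> card S1 \<le> 11"
      then obtain S' where S': "S' \<subseteq> S1" "card S' = Suc 11" "finite S'"
        using obtain_subset_with_card_n[of "Suc 11" S1] by auto
      have sub: "S' \<subseteq> Z (2.8 + 6 * \<theta>)" using S S' by (auto simp: S1_def)
      \<comment> \<open>The value of \<open>T\<close> at the first threshold: 2.8 + 6 \<theta> minus
        5 \<theta> + 1.\<close>
      have low: "1.8 + \<theta> \<le> T s" if "s \<in> S'" for s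
      proof -
        obtain j n where "s = (j, n)" by (cases s)
        then show ?thesis using bound[of j n "2.8 + 6 * \<theta>"] sub that by (auto simp: T_def)
      qed
      have "0 < 1.8 + \<theta>" using \<theta> by simp
      then obtain b where b: "b \<in> S'" "(3/2) ^ 11 * (1.8 + \<theta>) \<le> T b"
        using geometric_growth_of_gaps[of S' 11 "1.8 + \<theta>" T] S' low gapT sub by blast
      then have "(3/2) ^ 11 * (1.8 + \<theta>) < 32.1 + 68.1 * \<theta>" using S' by (force simp: S1_def)
      \<comment> \<open>(3/2)^11 is about 86.5 and exceeds both 32.1 / 1.8 and the ratio 68.1 of the
        \<theta> coefficients; the latter decides the exponent, since (3/2)^10 is only about
        57.7.\<close>
      then show False using \<theta> by (simp add: power_numeral_even power_numeral_odd field_simps)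
    qed
    moreover have "card (S - S1) \<le> 5"
    proof (rule five)
      show "finite (S - S1)" using S by simp
      show "S - S1 \<subseteq> Z (33.1 + 73.1 * \<theta>)"
        using S H by (force simp: S1_def T_def Z_def pos_divide_le_eq)
    qed
    moreover have "card S = card S1 + card (S - S1)"
      using S by (metis (no_types, lifting) S1_def card_Diff_subset card_mono finite_subset le_add_diff_inverse mem_Collect_eq subsetI)
    ultimately show ?thesis by simp
  qed
  have "(\<Sum>j = 1..N. mult_ge ((2.8 + 6 * \<theta>) / hstar \<alpha>) (fun_of (f j))) \<le> enat 24"
    by (rule sum_mult_ge_le[OF twenty_four]) (auto simp: Z_def)
  moreover have "(\<Sum>j = 1..N. mult_ge ((33.1 + 73.1 * \<theta>) / hstar \<alpha>) (fun_of (f j))) \<le> enat 5"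
    by (rule sum_mult_ge_le[OF five]) (auto simp: Z_def)
  ultimately show ?thesis by (simp add: numeral_eq_enat)
qed

end
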